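(* Let $G$ be a smooth bounded domain in $\mathbb R^d$, $\{h_k,k\ge1\}$ an orthonormal basis in $L_2(G)$, and $\dot W(x)=\sum_{k\ge1}h_k(x)\xi_k$ the space white noise on $L_2(G)$. Consider the Dirichlet problem (summation over repeated indices) $$-D_i\big(a_{ij}(x)D_ju(x)\big)+D_i\big(\sigma_{ij}(x)D_ju(x)\big)\diamond\dot W(x)=f(x),\ x\in G,\qquad u|_{\partial G}=0,$$ with non-random $a_{ij},\sigma_{ij},f$. Assume (E1) $a_{ij}$ and $\sigma_{ij}$ are measurable and bounded in $\bar G$; (E2) there exist positive numbers $A_1,A_2$ so that $A_1|y|^2\le a_{ij}(x)y_iy_j\le A_2|y|^2$ for all $x\in\bar G$, $y\in\mathbb R^d$; (E3) each $h_k$ is bounded and Lipschitz continuous. Let $V=\overset{\circ}{H}{}^1_2(G)$, $V'=H_2^{-1}(G)$, $\mathbf Au=-D_i(a_{ij}D_ju)$, $\mathbf M_ku=h_kD_i(\sigma_{ij}D_ju)$, and let $C_k$ be positive numbers with $\|\mathbf A^{-1}\mathbf M_kv\|_V\le C_k\|v\|_V$ for all $v\in V$. If $f\in H_2^{-1}(G)$, then there exists a unique solution $u\in\mathcal RL_2(\mathbb F;\overset{\circ}{H}{}^1_2(G))$ of the Dirichlet problem such that $$\|u\|_{\mathcal RL_2(\mathbb F;\overset{\circ}{H}{}^1_2(G))}\le C\,\|f\|_{H_2^{-1}(G)}$$ with $C$ independent of $f$. The weights $r_\alpha$ can be taken in the form $$r_\alpha=\frac{q^\alpha}{\sqrt{|\alpha|!}},\qquad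 q^\alpha=\prod_{k\ge1}q_k^{\alpha_k},$$ where the positive numbers $q_k$, $k\ge1$, are chosen so that $\sum_{k\ge1}C_k^2q_k^2<1$.
   Context: $\xi_k$, $k\ge1$, are independent standard Gaussian random variables on a complete probability space $\mathbb F=(\Omega,\mathcal F,\mathbb P)$ whose $\sigma$-algebra they generate. $\mathcal J$ is the set of multi-indices $\alpha=(\alpha_1,\alpha_2,\dots)$ of non-negative integers with $|\alpha|=\sum_k\alpha_k<\infty$; $(0)$ is the zero multi-index; $\varepsilon_k$ has $1$ in position $k$ and $0$ elsewhere. $\xi_\alpha=\prod_k H_{\alpha_k}(\xi_k)/\sqrt{\alpha_k!}$, $H_n(x)=(-1)^ne^{x^2/2}\frac{d^n}{dx^n}e^{-x^2/2}$. For positive weights $\{r_\alpha\}$ and a Hilbert space $X$, $\mathcal RL_2(\mathbb F;X)$ is the space of formal series $v=\sum_\alpha v_\alpha\xi_\alpha$, $v_\alpha\in X$, with $\|v\|^2_{\mathcal RL_2(\mathbb F;X)}=\sum_\alpha r_\alpha^2\|v_\alpha\|_X^2<\infty$. $\overset{\circ}{H}{}^1_2(G)$ is the Sobolev space usually written $H^1_0(G)$; $H_2^{-1}(G)$ is its dual relative to the inner product in $L_2(G)$. Under (E1)–(E3), $\mathbf A:V\to V'$ is an isomorphism and each $\mathbf M_k:V\to V'$ is bounded, so the numbers $C_k$ exist. Solution: $u=\sum_\alpha u_\alpha\xi_\alpha$ with $u_\alpha\in V$ such that, for every $\alpha\in\mathcal J$, $\mathbf Au_\alpha+\sum_{k\ge1}\sqrt{\alpha_k}\,\mathbf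 M_ku_{\alpha-\varepsilon_k}=f\,I_{(\alpha=(0))}$ in $V'$ (terms with $\alpha_k=0$ are zero). *)

theory Defs
  imports "HOL-Probability.Probability" "HOL-Library.Poly_Mapping"
begin

section \<open>Smooth functions and smooth bounded domains\<close>

definition partial_deriv :: "'n \<Rightarrow> (real^'n \<Rightarrow> real) \<Rightarrow> real^'n \<Rightarrow> real" where
  "partial_deriv i f x = frechet_derivative f (at x) (axis i 1)"

text \<open>Only meant for open \<^term>\<open>S\<close>.\<close>

primrec Ck_on :: "nat \<Rightarrow> (real^'n) set \<Rightarrow> (real^'n \<Rightarrow> real) \<Rightarrow> bool" where
  "Ck_on 0 S f \<longleftrightarrow> continuous_on S f"
| "Ck_on (Suc k) S f \<longleftrightarrow> f differentiable_on S \<and> (\<forall>i. Ck_on k S (partial_deriv i f))"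

definition smooth_on :: "(real^'n) set \<Rightarrow> (real^'n \<Rightarrow> real) \<Rightarrow> bool" where
  "smooth_on S f \<longleftrightarrow> (\<forall>k. Ck_on k S f)"

text \<open>Near each boundary point, \<^term>\<open>G\<close> is the sublevel set of a smooth function with
  non-vanishing gradient; in particular \<^term>\<open>G\<close> lies on one side of its boundary.\<close>

definition smooth_bounded_domain :: "(real^'n) set \<Rightarrow> bool" where
  "smooth_bounded_domain G \<longleftrightarrow>
     open G \<and> connected G \<and> G \<noteq> {} \<and> bounded G \<and>
     (\<forall>p\<in>frontier G. \<exists>U \<rho>. open U \<and> p \<in> U \<and> smooth_on U \<rho> \<and>
        (\<forall>x\<in>U. \<exists>i. partial_deriv i \<rho> x \<noteq> 0) \<and> G \<inter> U = {x\<in>U. \<rho> x < 0})"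

section \<open>The spaces \<open>L\<^sub>2(G)\<close>, \<open>H\<^sup>1\<^sub>0(G)\<close> and \<open>H\<^sup>-\<^sup>1(G)\<close>\<close>

text \<open>Elements of the function spaces are represented by functions on the whole of
  \<open>\<real>\<^sup>n\<close> of which only the values on \<^term>\<open>G\<close> matter, and two of them are identified if
  \<open>ae_eq\<close> relates them.\<close>

definition ae_eq :: "(real^'n) set \<Rightarrow> (real^'n \<Rightarrow> real) \<Rightarrow> (real^'n \<Rightarrow> real) \<Rightarrow> bool" where
  "ae_eq G u v \<longleftrightarrow> (AE x in lebesgue_on G. u x = v x)"

definition L2 :: "(real^'n) set \<Rightarrow> (real^'n \<Rightarrow> real) set" where
  "L2 G = {u \<in> borel_measurable (lebesgue_on G). integrable (lebesgue_on G) (\<lambda>x. (u x)\<^sup>2)}"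

definition L2_inner :: "(real^'n) set \<Rightarrow> (real^'n \<Rightarrow> real) \<Rightarrow> (real^'n \<Rightarrow> real) \<Rightarrow> real" where
  "L2_inner G u v = (LINT x|lebesgue_on G. u x * v x)"

definition L2_norm :: "(real^'n) set \<Rightarrow> (real^'n \<Rightarrow> real) \<Rightarrow> real" where
  "L2_norm G u = sqrt (L2_inner G u u)"

definition L2_orthonormal_basis :: "(real^'n) set \<Rightarrow> (nat \<Rightarrow> real^'n \<Rightarrow> real) \<Rightarrow> bool" where
  "L2_orthonormal_basis G h \<longleftrightarrow>
     (\<forall>k. h k \<in> L2 G) \<and>
     (\<forall>j k. L2_inner G (h j) (h k) = (if j = k then 1 else 0)) \<and>
     (\<forall>u\<in>L2 G. (\<lambda>N. L2_norm G (\<lambda>x. u x - (\<Sum>k<N. L2_inner G u (h k) * h k x))) \<longlonglongrightarrow> 0)"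

definition test_funs :: "(real^'n) set \<Rightarrow> (real^'n \<Rightarrow> real) set" where
  "test_funs G = {\<phi>. smooth_on UNIV \<phi> \<and> compact (closure {x. \<phi> x \<noteq> 0}) \<and>
                     closure {x. \<phi> x \<noteq> 0} \<subseteq> G}"

definition has_weak_partial ::
  "(real^'n) set \<Rightarrow> 'n \<Rightarrow> (real^'n \<Rightarrow> real) \<Rightarrow> (real^'n \<Rightarrow> real) \<Rightarrow> bool" where
  "has_weak_partial G i u g \<longleftrightarrow>
     g \<in> L2 G \<and> (\<forall>\<phi>\<in>test_funs G. L2_inner G u (partial_deriv i \<phi>) = - L2_inner G g \<phi>)"

text \<open>The weak derivative is determined up to \<open>ae_eq\<close>.\<close>

definition weak_partial :: "(real^'n) set \<Rightarrow> 'n \<Rightarrow> (real^'n \<Rightarrow> real) \<Rightarrow> real^'n \<Rightarrow> real" where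
  "weak_partial G i u = (SOME g. has_weak_partial G i u g)"

definition H1 :: "(real^'n) set \<Rightarrow> (real^'n \<Rightarrow> real) set" where
  "H1 G = {u \<in> L2 G. \<forall>i. \<exists>g. has_weak_partial G i u g}"

definition H1_norm :: "(real^'n) set \<Rightarrow> (real^'n \<Rightarrow> real) \<Rightarrow> real" where
  "H1_norm G u = sqrt ((L2_norm G u)\<^sup>2 + (\<Sum>i\<in>UNIV. (L2_norm G (weak_partial G i u))\<^sup>2))"

definition H10 :: "(real^'n) set \<Rightarrow> (real^'n \<Rightarrow> real) set" where
  "H10 G = {u \<in> H1 G. \<exists>\<phi>. (\<forall>m. \<phi> m \<in> test_funs G) \<and>
                         (\<lambda>m::nat. H1_norm G (\<lambda>x. u x - \<phi> m x)) \<longlonglongrightarrow> 0}"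

text \<open>Elements of the dual space are functionals of which only the values on \<^term>\<open>H10 G\<close>
  matter. Being the dual relative to the inner product of \<open>L\<^sub>2(G)\<close>, it contains
  \<open>g \<in> L\<^sub>2(G)\<close> as the functional \<^term>\<open>\<lambda>v. L2_inner G g v\<close>. Linearity and boundedness
  force \<^term>\<open>F\<close> to respect \<open>ae_eq\<close>.\<close>

definition Hm1 :: "(real^'n) set \<Rightarrow> ((real^'n \<Rightarrow> real) \<Rightarrow> real) set" where
  "Hm1 G = {F. (\<forall>u\<in>H10 G. \<forall>v\<in>H10 G. F (\<lambda>x. u x + v x) = F u + F v) \<and>
               (\<forall>c. \<forall>u\<in>H10 G. F (\<lambda>x. c * u x) = c * F u) \<and>
               (\<exists>K. \<forall>u\<in>H10 G. \<bar>F u\<bar> \<le> K * H1_norm G u)}"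

definition Hm1_norm :: "(real^'n) set \<Rightarrow> ((real^'n \<Rightarrow> real) \<Rightarrow> real) \<Rightarrow> real" where
  "Hm1_norm G F = (SUP v\<in>{v \<in> H10 G. H1_norm G v \<le> 1}. \<bar>F v\<bar>)"

section \<open>The operators\<close>

text \<open>The functional \<open>D\<^sub>i(b\<^sub>i\<^sub>j D\<^sub>j u)\<close>: for \<open>g \<in> L\<^sub>2(G)\<close>, the derivative \<open>D\<^sub>i g\<close> is the element
  \<open>v \<mapsto> - (g, D\<^sub>i v)\<close> of the dual space.\<close>

definition div_op ::
  "(real^'n) set \<Rightarrow> ('n \<Rightarrow> 'n \<Rightarrow> real^'n \<Rightarrow> real) \<Rightarrow> (real^'n \<Rightarrow> real) \<Rightarrow> (real^'n \<Rightarrow> real) \<Rightarrow> real"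
  where
  "div_op G b u v =
     (\<Sum>i\<in>UNIV. - L2_inner G (\<lambda>x. \<Sum>j\<in>UNIV. b i j x * weak_partial G j u x) (weak_partial G i v))"

definition A_op ::
  "(real^'n) set \<Rightarrow> ('n \<Rightarrow> 'n \<Rightarrow> real^'n \<Rightarrow> real) \<Rightarrow> (real^'n \<Rightarrow> real) \<Rightarrow> (real^'n \<Rightarrow> real) \<Rightarrow> real"
  where
  "A_op G a u = (\<lambda>v. - div_op G a u v)"

text \<open>The product of a function \<open>\<eta>\<close> with a functional \<open>F\<close> is \<open>v \<mapsto> F (\<eta> v)\<close>; below,
  \<open>\<eta> = h\<^sub>k\<close>.\<close>

definition M_op ::
  "(real^'n) set \<Rightarrow> ('n \<Rightarrow> 'n \<Rightarrow> real^'n \<Rightarrow> real) \<Rightarrow> (real^'n \<Rightarrow> real) \<Rightarrow>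
     (real^'n \<Rightarrow> real) \<Rightarrow> (real^'n \<Rightarrow> real) \<Rightarrow> real"
  where
  "M_op G \<sigma> \<eta> u = (\<lambda>v. div_op G \<sigma> u (\<lambda>x. \<eta> x * v x))"

definition A_inv ::
  "(real^'n) set \<Rightarrow> ('n \<Rightarrow> 'n \<Rightarrow> real^'n \<Rightarrow> real) \<Rightarrow> ((real^'n \<Rightarrow> real) \<Rightarrow> real) \<Rightarrow> real^'n \<Rightarrow> real"
  where
  "A_inv G a F = (SOME w. w \<in> H10 G \<and> (\<forall>v\<in>H10 G. A_op G a w v = F v))"

section \<open>Weighted chaos spaces\<close>

text \<open>The index set \<open>{1, 2, \<dots>}\<close> of the Gaussian variables and of the basis functions is
  shifted to \<^typ>\<open>nat\<close>. On a complete probability space, the \<open>\<sigma>\<close>-algebra generated by random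
  variables is understood to contain the null sets.\<close>

definition gaussian_space :: "'w measure \<Rightarrow> (nat \<Rightarrow> 'w \<Rightarrow> real) \<Rightarrow> bool" where
  "gaussian_space P \<xi> \<longleftrightarrow>
     prob_space P \<and> complete_measure P \<and>
     prob_space.indep_vars P (\<lambda>_. borel) \<xi> UNIV \<and>
     (\<forall>k. distributed P lborel (\<xi> k) (\<lambda>x. ennreal (std_normal_density x))) \<and>
     sets P = sigma_sets (space P)
       ({\<xi> k -` B \<inter> space P | k B. B \<in> sets borel} \<union> null_sets P)"

type_synonym multi_index = "nat \<Rightarrow>\<^sub>0 nat"

definition mi_size :: "multi_index \<Rightarrow> nat" where
  "mi_size \<alpha> = (\<Sum>k\<in>Poly_Mapping.keys \<alpha>. Poly_Mapping.lookup \<alpha> k)"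

definition hermite :: "nat \<Rightarrow> real \<Rightarrow> real" where
  "hermite n x = (- 1) ^ n * exp (x\<^sup>2 / 2) * (deriv ^^ n) (\<lambda>y. exp (- (y\<^sup>2) / 2)) x"

definition chaos_basis :: "(nat \<Rightarrow> 'w \<Rightarrow> real) \<Rightarrow> multi_index \<Rightarrow> 'w \<Rightarrow> real" where
  "chaos_basis \<xi> \<alpha> \<omega> =
     (\<Prod>k\<in>Poly_Mapping.keys \<alpha>.
        hermite (Poly_Mapping.lookup \<alpha> k) (\<xi> k \<omega>) / sqrt (fact (Poly_Mapping.lookup \<alpha> k)))"

text \<open>A formal series \<open>\<Sum>\<^sub>\<alpha> v\<^sub>\<alpha> \<xi>\<^sub>\<alpha>\<close>, with \<open>\<xi>\<^sub>\<alpha> =\<close> \<^term>\<open>chaos_basis \<xi> \<alpha>\<close>, is given by the family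
  \<open>v\<close> of its coefficients; the series need not converge, so the random variables \<open>\<xi>\<^sub>\<alpha>\<close> only
  label the coefficients. The coefficient space is passed as a carrier \<open>X\<close> with its norm.\<close>

definition RL2 :: "(multi_index \<Rightarrow> real) \<Rightarrow> 'x set \<Rightarrow> ('x \<Rightarrow> real) \<Rightarrow> (multi_index \<Rightarrow> 'x) set" where
  "RL2 r X norm_X =
     {v. (\<forall>\<alpha>. v \<alpha> \<in> X) \<and> (\<lambda>\<alpha>. (r \<alpha>)\<^sup>2 * (norm_X (v \<alpha>))\<^sup>2) summable_on UNIV}"

definition RL2_norm :: "(multi_index \<Rightarrow> real) \<Rightarrow> ('x \<Rightarrow> real) \<Rightarrow> (multi_index \<Rightarrow> 'x) \<Rightarrow> real" where
  "RL2_norm r norm_X v = sqrt (\<Sum>\<^sub>\<infinity>\<alpha>. (r \<alpha>)\<^sup>2 * (norm_X (v \<alpha>))\<^sup>2)"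

definition chaos_weight :: "(nat \<Rightarrow> real) \<Rightarrow> multi_index \<Rightarrow> real" where
  "chaos_weight q \<alpha> =
     (\<Prod>k\<in>Poly_Mapping.keys \<alpha>. q k ^ Poly_Mapping.lookup \<alpha> k) / sqrt (fact (mi_size \<alpha>))"

text \<open>The equation for each coefficient holds in the dual space, i.e. tested against
  all of \<^term>\<open>H10 G\<close>.\<close>

definition is_solution ::
  "(real^'n) set \<Rightarrow> ('n \<Rightarrow> 'n \<Rightarrow> real^'n \<Rightarrow> real) \<Rightarrow> ('n \<Rightarrow> 'n \<Rightarrow> real^'n \<Rightarrow> real) \<Rightarrow>
     (nat \<Rightarrow> real^'n \<Rightarrow> real) \<Rightarrow> ((real^'n \<Rightarrow> real) \<Rightarrow> real) \<Rightarrow>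
     (multi_index \<Rightarrow> real^'n \<Rightarrow> real) \<Rightarrow> bool"
  where
  "is_solution G a \<sigma> h f u \<longleftrightarrow>
     (\<forall>\<alpha>. u \<alpha> \<in> H10 G) \<and>
     (\<forall>\<alpha>. \<forall>v\<in>H10 G.
        A_op G a (u \<alpha>) v
          + (\<Sum>k\<in>Poly_Mapping.keys \<alpha>. sqrt (real (Poly_Mapping.lookup \<alpha> k))
               * M_op G \<sigma> (h k) (u (\<alpha> - Poly_Mapping.single k 1)) v)
        = (if \<alpha> = 0 then f v else 0))"

end

theory Submission
  imports Defs
begin

text \<open>A function \<open>u \<in> H\<^sup>1(G)\<close> is encoded by its jet \<open>(u, D\<^sub>1u, \<dots>, D\<^sub>nu)\<close> in a power of the Hilbert space
  \<open>L\<^sub>2(\<real>\<^sup>n)\<close>, realised as a quotient type, and \<open>H\<^sup>1\<^sub>0(G)\<close> becomes the closed subspace spanned by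
  the jets of test functions. Poincare's inequality makes the form of \<open>A\<close> coercive on it, so
  Lax-Milgram inverts \<open>A\<close>. Multiplication by \<open>h\<^sub>k\<close> preserves \<open>H\<^sup>1\<^sub>0(G)\<close>, hence \<open>M\<^sub>k\<close> maps into the
  dual space. The coefficients are then forced by
  \<open>u\<^sub>0 = A\<inverse>f\<close> and \<open>u\<^sub>\<alpha> = -\<Sum>\<^sub>k \<surd>\<alpha>\<^sub>k A\<inverse>M\<^sub>k u\<^bsub>\<alpha>-\<epsilon>\<^sub>k\<^esub>\<close>. With \<open>t\<^sub>\<alpha> = r\<^sub>\<alpha>\<^sup>2\<parallel>u\<^sub>\<alpha>\<parallel>\<^sup>2\<close> and
  \<open>x\<^sub>k = C\<^sub>k\<^sup>2q\<^sub>k\<^sup>2\<close>, Cauchy-Schwarz gives \<open>t\<^sub>\<alpha> \<le> \<Sum>\<^sub>k x\<^sub>k t\<^bsub>\<alpha>-\<epsilon>\<^sub>k\<^esub>\<close>, so the sum of \<open>t\<^sub>\<alpha>\<close> over \<open>|\<alpha>| = n\<close> is at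
  most \<open>(\<Sum>\<^sub>k x\<^sub>k)\<^sup>n t\<^sub>0\<close>, a convergent geometric series.\<close>

section \<open>Hilbert spaces\<close>

text \<open>The statement speaks of sets of functions with derivatives picked by
  \<open>SOME\<close>, while the existence arguments take place in a complete inner product space.
  \<open>jet\<close> mediates: the norm of \<open>jet G u\<close> is \<open>H1_norm G u\<close>, and
  by \<open>H10I\<close> a function of \<open>L2 G\<close> lies in \<open>H10 G\<close> as soon as
  its L2 class is the first component of an element of \<open>H10_jets G\<close>. The delicate point
  is the product with h_k, which is only Lipschitz. Unless h_k v lies in \<open>H10 G\<close>,
  \<open>M_op\<close> is built from arbitrary values of \<open>weak_partial\<close>, and
  \<open>A_inv\<close> of it is an arbitrary choice. In the summation the weight is made for the
  factor |alpha| that Cauchy-Schwarz produces: r_alpha^2 |alpha| = q_k^2 r_(alpha - eps_k)^2. A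
  level |alpha| = n >= 1 has infinitely many members, so the levels are compared on finite subsets.
  The final constant is 1 / (c sqrt (1 - sum x_k)), where c is the coercivity constant of A; the
  root appears because the geometric series bounds squared norms. Uniqueness comes coefficient by
  coefficient, by induction on |alpha| and injectivity of A.\<close>

lemma nested_bounded_closed_convex_Inter_nonempty:
  fixes K :: "nat \<Rightarrow> 'a::{real_inner,complete_space} set"
  assumes cl: "\<And>n. closed (K n)" and cv: "\<And>n. convex (K n)" and ne: "\<And>n. K n \<noteq> {}"
    and dec: "\<And>m n. m \<le> n \<Longrightarrow> K n \<subseteq> K m"
    and bd: "\<And>x. x \<in> K 0 \<Longrightarrow> norm x \<le> B"
  shows "\<exists>p. \<forall>n. p \<in> K n"
proof -
  \<comment> \<open>The distances \<open>d n\<close> of the sets from the origin increase and are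
    bounded by \<open>B\<close>. Points \<open>p n\<close> that nearly attain them will form a
    Cauchy sequence, and its limit lies in every \<open>K n\<close>.\<close>
  define d where "d n = Inf (norm ` K n)" for n
  have bdd: "bdd_below (norm ` K n)" for n by (rule bdd_belowI[of _ 0]) auto
  have d_le: "d n \<le> norm x" if "x \<in> K n" for x n
    unfolding d_def using that bdd by (intro cInf_lower) auto
  have d_nonneg: "0 \<le> d n" for n
    unfolding d_def using ne by (intro cInf_greatest) auto
  have d_mono: "d m \<le> d n" if "m \<le> n" for m n
    unfolding d_def using ne bdd dec[OF that] by (intro cInf_superset_mono) auto
  have d_B: "d n \<le> B" for n
  proof -
    obtain x where "x \<in> K n" using ne by blast
    then show ?thesis using d_le[of x n] bd[of x] dec[of 0 n] by force
  qed
  have "\<exists>x\<in>K n. norm x < d n + 1 / real (Suc n)" for n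
    using cInf_lessD[of "norm ` K n" "d n + 1 / real (Suc n)"] ne unfolding d_def by auto
  then obtain p where p: "\<And>n. p n \<in> K n" "\<And>n. norm (p n) < d n + 1 / real (Suc n)"
    by metis
  have "incseq d" using d_mono by (auto simp: incseq_def)
  moreover have "Bseq d" by (rule BseqI'[of _ B]) (use d_nonneg d_B in auto)
  ultimately obtain D where D: "d \<longlonglongrightarrow> D" using Bseq_mono_convergent[of d]
    by (auto simp: convergent_def incseq_def)
  have d_D: "d n \<le> D" for n by (rule incseq_le[OF \<open>incseq d\<close> D])
  have p_le: "norm (p m) \<le> D + 1 / real (Suc N)" if "N \<le> m" for m N
    using p(2)[of m] d_D[of m] frac_le[of 1 1 "real (Suc N)" "real (Suc m)"] that by simp
  \<comment> \<open>Parallelogram law: the midpoint of \<open>p m\<close> and \<open>p n\<close>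
    lies in the convex set \<open>K N\<close>, so its norm is at least \<open>d N\<close>, which
    leaves little room for the difference.\<close>
  have key: "(norm (p m - p n))\<^sup>2 \<le> 4 * ((D + 1 / real (Suc N))\<^sup>2 - (d N)\<^sup>2)"
    if "N \<le> m" "N \<le> n" for m n N
  proof -
    have "(1/2) *\<^sub>R p m + (1/2) *\<^sub>R p n \<in> K N"
      using p(1)[of m] p(1)[of n] dec that by (intro convexD[OF cv]) auto
    then have "d N \<le> norm ((1/2) *\<^sub>R (p m + p n))" using d_le by (metis scaleR_add_right)
    then have 1: "2 * d N \<le> norm (p m + p n)" by simp
    have "(2 * d N)\<^sup>2 \<le> (norm (p m + p n))\<^sup>2" using 1 d_nonneg[of N] by (intro power_mono) auto
    moreover have "(norm (p m))\<^sup>2 \<le> (D + 1 / real (Suc N))\<^sup>2"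
      using p_le that by (intro power_mono) auto
    moreover have "(norm (p n))\<^sup>2 \<le> (D + 1 / real (Suc N))\<^sup>2"
      using p_le that by (intro power_mono) auto
    moreover have "(norm (p m + p n))\<^sup>2 + (norm (p m - p n))\<^sup>2
        = 2 * (norm (p m))\<^sup>2 + 2 * (norm (p n))\<^sup>2"
      by (simp add: power2_norm_eq_inner inner_simps inner_commute)
    ultimately show ?thesis by (simp add: power_mult_distrib)
  qed
  have lim0: "(\<lambda>N. 4 * ((D + 1 / real (Suc N))\<^sup>2 - (d N)\<^sup>2)) \<longlonglongrightarrow> 4 * ((D + 0)\<^sup>2 - D\<^sup>2)"
    by (intro tendsto_intros D LIMSEQ_Suc lim_1_over_n)
  have "Cauchy p"
  proof (rule metric_CauchyI)
    fix e :: real assume "e > 0"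
    with lim0 have "\<forall>\<^sub>F N in sequentially. 4 * ((D + 1 / real (Suc N))\<^sup>2 - (d N)\<^sup>2) < e\<^sup>2"
      by (intro order_tendstoD) auto
    then obtain N where N: "4 * ((D + 1 / real (Suc N))\<^sup>2 - (d N)\<^sup>2) < e\<^sup>2"
      by (auto simp: eventually_sequentially)
    show "\<exists>M. \<forall>m\<ge>M. \<forall>n\<ge>M. dist (p m) (p n) < e"
    proof (intro exI allI impI)
      fix m n assume "N \<le> m" "N \<le> n"
      then have "(norm (p m - p n))\<^sup>2 < e\<^sup>2" using key N by fastforce
      then show "dist (p m) (p n) < e"
        using \<open>e > 0\<close> by (simp add: dist_norm power_less_imp_less_base)
    qed
  qed
  then obtain q where q: "p \<longlonglongrightarrow> q" using Cauchy_convergent_iff convergent_def by blast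
  have "q \<in> K n" for n
  proof (rule Lim_in_closed_set[OF cl _ _ q])
    show "\<forall>\<^sub>F m in sequentially. p m \<in> K n"
      unfolding eventually_sequentially using p(1) dec by blast
  qed simp
  then show ?thesis by blast
qed

text \<open>The slices of \<open>K\<close> by balls whose radii decrease to the infimum
  \<open>d\<close> of the norms are nested and nonempty. A common point of all slices attains
  \<open>d\<close>.\<close>

lemma closed_convex_min_norm:
  fixes K :: "'a::{real_inner,complete_space} set"
  assumes "closed K" "convex K" "K \<noteq> {}"
  shows "\<exists>p\<in>K. \<forall>x\<in>K. norm p \<le> norm x"
proof -
  define d where "d = Inf (norm ` K)"
  have bdd: "bdd_below (norm ` K)" by (rule bdd_belowI[of _ 0]) auto
  have "\<exists>x\<in>K. norm x < d + 1 / real (Suc n)" for n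
    using cInf_lessD[of "norm ` K" "d + 1 / real (Suc n)"] assms unfolding d_def by auto
  then have "K \<inter> cball 0 (d + 1 / real (Suc n)) \<noteq> {}" for n
    using less_imp_le by fastforce
  moreover have "K \<inter> cball 0 (d + 1 / real (Suc n)) \<subseteq> K \<inter> cball 0 (d + 1 / real (Suc m))"
    if "m \<le> n" for m n
    using that frac_le[of 1 1 "real (Suc m)" "real (Suc n)"] by auto
  ultimately have "\<exists>p. \<forall>n. p \<in> K \<inter> cball 0 (d + 1 / real (Suc n))"
    using assms
    by (intro nested_bounded_closed_convex_Inter_nonempty[where B = "d + 1"])
       (auto intro: convex_Int closed_Int)
  then obtain p where p: "p \<in> K" "\<And>n. norm p \<le> d + 1 / real (Suc n)" by auto
  have "(\<lambda>n. d + 1 / real (Suc n)) \<longlonglongrightarrow> d + 0"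
    by (intro tendsto_intros LIMSEQ_Suc lim_1_over_n)
  then have "norm p \<le> d + 0" by (rule LIMSEQ_le_const) (use p in auto)
  moreover have "d \<le> norm x" if "x \<in> K" for x
    unfolding d_def using that bdd by (intro cInf_lower) auto
  ultimately show ?thesis using p(1) by force
qed

text \<open>A stand-in for weak compactness: \<open>p\<close> is a common point of the closed convex
  hulls of all tails. Testing with closed convex sets suffices to carry subspace membership and norm
  bounds over to \<open>p\<close>, and no subsequence has to be chosen.\<close>

lemma bounded_seq_weak_limit:
  fixes x :: "nat \<Rightarrow> 'a::{real_inner,complete_space}"
  assumes "\<And>n. norm (x n) \<le> B"
  shows "\<exists>p. \<forall>C n. closed C \<and> convex C \<and> (\<forall>m\<ge>n. x m \<in> C) \<longrightarrow> p \<in> C"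
proof -
  define K where "K n = closure (convex hull (x ` {n..}))" for n
  have "x ` {0..} \<subseteq> cball 0 B" using assms by auto
  then have "K 0 \<subseteq> cball 0 B"
    unfolding K_def by (intro closure_minimal hull_minimal) auto
  moreover have "K n \<subseteq> K m" if "m \<le> n" for m n
    unfolding K_def using that by (intro closure_mono hull_mono image_mono) auto
  ultimately have "\<exists>p. \<forall>n. p \<in> K n"
    by (intro nested_bounded_closed_convex_Inter_nonempty[where B = B])
       (auto simp: K_def intro!: convex_closure)
  then obtain p where p: "\<And>n. p \<in> K n" by blast
  have "p \<in> C" if "closed C" "convex C" "\<forall>m\<ge>n. x m \<in> C" for C n
  proof -
    have "K n \<subseteq> C" unfolding K_def using that by (intro closure_minimal hull_minimal) auto
    then show ?thesis using p by blast
  qed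
  then show ?thesis by blast
qed

text \<open>The representing vector is a multiple of the point \<open>p\<close> of least norm in the
  slice of \<open>S\<close> where \<open>F\<close> equals 1; minimality makes \<open>p\<close>
  orthogonal to the kernel of \<open>F\<close>.\<close>

lemma Riesz_representation_subspace:
  fixes S :: "'a::{real_inner,complete_space} set"
  assumes S: "closed S" "subspace S"
    and add: "\<And>u v. u \<in> S \<Longrightarrow> v \<in> S \<Longrightarrow> F (u + v) = F u + F v"
    and scale: "\<And>c u. u \<in> S \<Longrightarrow> F (c *\<^sub>R u) = c * F u"
    and bound: "\<And>u. u \<in> S \<Longrightarrow> \<bar>F u\<bar> \<le> B * norm u"
  shows "\<exists>w\<in>S. \<forall>v\<in>S. inner w v = F v"
proof (cases "\<forall>v\<in>S. F v = 0")
  case True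
  then show ?thesis using S subspace_0 by (intro bexI[of _ 0]) auto
next
  case False
  then obtain v0 where v0: "v0 \<in> S" "F v0 \<noteq> 0" by blast
  have diff: "F (u - v) = F u - F v" if "u \<in> S" "v \<in> S" for u v
    using add[of u "(-1) *\<^sub>R v"] scale[of v "-1"] subspace_scale[OF S(2) that(2), of "-1"] that by simp
  have lip: "\<bar>F u - F v\<bar> \<le> B * norm (u - v)" if "u \<in> S" "v \<in> S" for u v
    using bound[of "u - v"] subspace_diff[OF S(2)] diff that by metis
  define K where "K = {x\<in>S. F x = 1}"
  have "closed K"
  proof (unfold closed_sequential_limits, intro allI impI, elim conjE)
    fix x l assume x: "\<forall>n. x n \<in> K" and l: "x \<longlonglongrightarrow> l"
    have lS: "l \<in> S" using S(1) x l unfolding closed_sequential_limits K_def by blast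
    have "(\<lambda>n. B * norm (x n - l)) \<longlonglongrightarrow> B * norm (l - l)" by (intro tendsto_intros l)
    moreover have "\<bar>1 - F l\<bar> \<le> B * norm (x n - l)" for n
      using lip[of "x n" l] x lS unfolding K_def by auto
    ultimately have "\<bar>1 - F l\<bar> \<le> B * norm (l - l)" by (intro LIMSEQ_le_const) auto
    then show "l \<in> K" using lS by (simp add: K_def)
  qed
  moreover have "convex K"
    unfolding convex_def K_def
    using add scale subspace_add[OF S(2)] subspace_scale[OF S(2)] by auto
  moreover have "(1 / F v0) *\<^sub>R v0 \<in> K"
    using v0 scale subspace_scale[OF S(2)] by (auto simp: K_def)
  ultimately have "\<exists>p\<in>K. \<forall>x\<in>K. norm p \<le> norm x" by (intro closed_convex_min_norm) auto
  then obtain p where p: "p \<in> K" "\<And>x. x \<in> K \<Longrightarrow> norm p \<le> norm x" by blast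
  have pS: "p \<in> S" "F p = 1" using p(1) by (auto simp: K_def)
  have "p \<noteq> 0" using bound[OF pS(1)] pS(2) by auto
  have orth: "inner p v = 0" if v: "v \<in> S" "F v = 0" for v
  proof (cases "v = 0")
    case False
    \<comment> \<open>The minimiser of the quadratic polynomial that gives the squared norm of
      \<open>p + t *\<^sub>R v\<close>.\<close>
    define t where "t = - inner p v / (norm v)\<^sup>2"
    have "p + t *\<^sub>R v \<in> K" using add scale v pS subspace_add[OF S(2)] subspace_scale[OF S(2)]
      by (auto simp: K_def)
    then have "(norm p)\<^sup>2 \<le> (norm (p + t *\<^sub>R v))\<^sup>2" using p(2) by (intro power_mono) auto
    also have "\<dots> = (norm p)\<^sup>2 + 2 * t * inner p v + t\<^sup>2 * (norm v)\<^sup>2"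
      unfolding power2_norm_eq_inner by (simp add: inner_simps inner_commute power2_eq_square)
    also have "\<dots> = (norm p)\<^sup>2 - (inner p v)\<^sup>2 / (norm v)\<^sup>2"
      using False by (simp add: t_def power2_eq_square field_simps)
    finally show ?thesis using False by (simp add: divide_le_0_iff)
  qed simp
  show ?thesis
  proof (intro bexI ballI)
    fix v assume v: "v \<in> S"
    have "v - F v *\<^sub>R p \<in> S" "F (v - F v *\<^sub>R p) = 0"
      using v pS diff scale subspace_diff[OF S(2)] subspace_scale[OF S(2)] by auto
    then have "inner p (v - F v *\<^sub>R p) = 0" by (rule orth)
    then show "inner ((1 / (norm p)\<^sup>2) *\<^sub>R p) v = F v"
      using \<open>p \<noteq> 0\<close> by (simp add: inner_simps power2_norm_eq_inner)
  qed (use pS subspace_scale[OF S(2)] in auto)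
qed

text \<open>The form is not assumed symmetric, so it cannot serve as an inner product itself. Riesz
  represents \<open>b u\<close> by \<open>T u\<close> and \<open>F\<close> by \<open>g\<close>, and
  \<open>T w = g\<close> is solved as the fixed point of the contraction that sends w to w - rho (T
  w - g).\<close>

theorem Lax_Milgram_subspace:
  fixes S :: "'a::{real_inner,complete_space} set" and b :: "'a \<Rightarrow> 'a \<Rightarrow> real"
  assumes S: "closed S" "subspace S" and b: "bounded_bilinear b"
    and c: "c > 0" and coercive: "\<And>u. u \<in> S \<Longrightarrow> c * (norm u)\<^sup>2 \<le> b u u"
    and add: "\<And>u v. u \<in> S \<Longrightarrow> v \<in> S \<Longrightarrow> F (u + v) = F u + F v"
    and scale: "\<And>r u. u \<in> S \<Longrightarrow> F (r *\<^sub>R u) = r * F u"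
    and bound: "\<And>u. u \<in> S \<Longrightarrow> \<bar>F u\<bar> \<le> B * norm u"
  shows "\<exists>w\<in>S. \<forall>v\<in>S. b w v = F v"
proof -
  interpret b: bounded_bilinear b by fact
  obtain M where M: "M > 0" "\<And>u v. norm (b u v) \<le> norm u * norm v * M"
    using b.pos_bounded by blast
  have "\<exists>w\<in>S. \<forall>v\<in>S. inner w v = b u v" for u
    by (rule Riesz_representation_subspace[OF S, where B = "norm u * M"])
       (use M(2)[of u] in \<open>auto simp: b.add_right b.scaleR_right mult_ac\<close>)
  then obtain T where T: "\<And>u. T u \<in> S" "\<And>u v. v \<in> S \<Longrightarrow> inner (T u) v = b u v" by metis
  obtain g where g: "g \<in> S" "\<And>v. v \<in> S \<Longrightarrow> inner g v = F v"
    using Riesz_representation_subspace[OF S add scale bound] by blast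
  have T_diff: "T u - T v = T (u - v)" for u v
  proof -
    have "T u - T v - T (u - v) \<in> S" using T(1) by (intro subspace_diff[OF S(2)])
    then have "inner (T u - T v - T (u - v)) (T u - T v - T (u - v)) = 0"
      by (subst inner_diff_left, subst inner_diff_left) (simp add: T(2) b.diff_left)
    then show ?thesis by simp
  qed
  have T_bound: "norm (T u) \<le> M * norm u" for u
  proof -
    have "(norm (T u))\<^sup>2 = b u (T u)" using T by (simp add: power2_norm_eq_inner)
    also have "\<dots> \<le> M * norm u * norm (T u)" using M(2)[of u "T u"] by (simp add: mult_ac)
    finally show ?thesis by (cases "T u = 0") (use M in \<open>auto simp: power2_eq_square\<close>)
  qed
  \<comment> \<open>Enlarging the bound to \<open>M' \<ge> c\<close> keeps the radicand in
    \<open>k\<close> nonnegative. The step size c / M'^2 below minimises 1 - 2 rho c + rho^2 M'^2,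
    the squared contraction factor.\<close>
  define M' where "M' = max M c"
  have M': "M' \<ge> c" "M' \<ge> M" "M' > 0" using c by (auto simp: M'_def)
  define \<rho> where "\<rho> = c / M'\<^sup>2"
  define k where "k = sqrt (1 - c\<^sup>2 / M'\<^sup>2)"
  have ratio: "0 < c\<^sup>2 / M'\<^sup>2" "c\<^sup>2 / M'\<^sup>2 \<le> 1" using c M' power_mono[of c M' 2] by auto
  have contract: "norm (u - \<rho> *\<^sub>R T u) \<le> k * norm u" if "u \<in> S" for u
  proof -
    have "(norm (u - \<rho> *\<^sub>R T u))\<^sup>2 = (norm u)\<^sup>2 - 2 * \<rho> * b u u + \<rho>\<^sup>2 * (norm (T u))\<^sup>2"
      using T(2)[OF that, of u] unfolding power2_norm_eq_inner
      by (simp add: inner_simps inner_commute power2_eq_square)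
    also have "\<dots> \<le> (norm u)\<^sup>2 - 2 * \<rho> * (c * (norm u)\<^sup>2) + \<rho>\<^sup>2 * (M' * norm u)\<^sup>2"
    proof (intro add_mono diff_mono mult_left_mono power_mono)
      show "norm (T u) \<le> M' * norm u"
        using T_bound[of u] M' by (meson mult_right_mono norm_ge_zero order_trans)
    qed (use coercive[OF that] c M' in \<open>auto simp: \<rho>_def\<close>)
    also have "\<dots> = (1 - c\<^sup>2 / M'\<^sup>2) * (norm u)\<^sup>2"
      using M' by (simp add: \<rho>_def field_simps power2_eq_square)
    also have "\<dots> = (k * norm u)\<^sup>2" using ratio by (simp add: k_def power_mult_distrib)
    finally show ?thesis
      using ratio by (auto simp: k_def intro: power2_le_imp_le)
  qed
  have "\<exists>!w. w \<in> S \<and> w - \<rho> *\<^sub>R (T w - g) = w"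
  proof (rule Banach_fix[OF complete_eq_closed[THEN iffD2, OF S(1)]])
    show "S \<noteq> {}" using g by blast
    show "0 \<le> k" "k < 1" using ratio by (auto simp: k_def)
    show "(\<lambda>w. w - \<rho> *\<^sub>R (T w - g)) ` S \<subseteq> S"
      using T(1) g(1) by (auto intro!: subspace_diff[OF S(2)] subspace_scale[OF S(2)])
    show "dist (u - \<rho> *\<^sub>R (T u - g)) (v - \<rho> *\<^sub>R (T v - g)) \<le> k * dist u v"
      if "u \<in> S" "v \<in> S" for u v
    proof -
      have "u - \<rho> *\<^sub>R (T u - g) - (v - \<rho> *\<^sub>R (T v - g)) = (u - v) - \<rho> *\<^sub>R T (u - v)"
        by (simp add: T_diff[symmetric] algebra_simps)
      then show ?thesis
        using contract[of "u - v"] subspace_diff[OF S(2) that] unfolding dist_norm by metis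
    qed
  qed
  then obtain w where w: "w \<in> S" "w - \<rho> *\<^sub>R (T w - g) = w" by blast
  then have "T w = g" using c M' by (simp add: \<rho>_def)
  then show ?thesis using w(1) T(2) g(2) by metis
qed

section \<open>The Hilbert space of square-integrable functions\<close>

definition sqint :: "('a::euclidean_space \<Rightarrow> real) set" where
  "sqint = {f \<in> borel_measurable lebesgue. integrable lebesgue (\<lambda>x. (f x)\<^sup>2)}"

lemma sqint_measurable: "f \<in> sqint \<Longrightarrow> f \<in> borel_measurable lebesgue"
  by (simp add: sqint_def)

lemma sqint_square_integrable: "f \<in> sqint \<Longrightarrow> integrable lebesgue (\<lambda>x. (f x)\<^sup>2)"
  by (simp add: sqint_def)

lemma sqint_zero: "(\<lambda>x. 0) \<in> sqint"
  by (simp add: sqint_def)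

lemma sqint_dominated:
  assumes g: "g \<in> sqint" and f: "f \<in> borel_measurable lebesgue"
    and le: "\<And>x. \<bar>f x\<bar> \<le> c * \<bar>g x\<bar>"
  shows "f \<in> sqint"
proof -
  have "integrable lebesgue (\<lambda>x. (f x)\<^sup>2)"
  proof (rule Bochner_Integration.integrable_bound)
    show "integrable lebesgue (\<lambda>x. c\<^sup>2 * (g x)\<^sup>2)" using g by (simp add: sqint_def)
    have "(f x)\<^sup>2 \<le> (c * \<bar>g x\<bar>)\<^sup>2" for x using le[of x] by (intro power2_le_iff_abs_le[THEN iffD2]) auto
    then show "AE x in lebesgue. norm ((f x)\<^sup>2) \<le> norm (c\<^sup>2 * (g x)\<^sup>2)"
      by (simp add: power_mult_distrib)
  qed (use f in measurable)
  then show ?thesis using f by (simp add: sqint_def)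
qed

lemma sqint_scale: "f \<in> sqint \<Longrightarrow> (\<lambda>x. c * f x) \<in> sqint"
  by (rule sqint_dominated[where c = "\<bar>c\<bar>"]) (auto simp: sqint_def abs_mult)

lemma sqint_add:
  assumes "f \<in> sqint" "g \<in> sqint" shows "(\<lambda>x. f x + g x) \<in> sqint"
proof -
  have [measurable]: "f \<in> borel_measurable lebesgue" "g \<in> borel_measurable lebesgue"
    using assms by (auto simp: sqint_def)
  have "integrable lebesgue (\<lambda>x. (f x + g x)\<^sup>2)"
  proof (rule Bochner_Integration.integrable_bound)
    show "integrable lebesgue (\<lambda>x. 2 * (f x)\<^sup>2 + 2 * (g x)\<^sup>2)"
      using assms by (auto simp: sqint_def)
    have "(f x + g x)\<^sup>2 \<le> 2 * (f x)\<^sup>2 + 2 * (g x)\<^sup>2" for x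
      using zero_le_power2[of "f x - g x"] by (simp add: power2_eq_square algebra_simps)
    then show "AE x in lebesgue. norm ((f x + g x)\<^sup>2) \<le> norm (2 * (f x)\<^sup>2 + 2 * (g x)\<^sup>2)"
      by simp
  qed measurable
  then show ?thesis by (simp add: sqint_def)
qed

lemma sqint_minus: "f \<in> sqint \<Longrightarrow> (\<lambda>x. - f x) \<in> sqint"
  using sqint_scale[of f "-1"] by simp

lemma sqint_diff: "f \<in> sqint \<Longrightarrow> g \<in> sqint \<Longrightarrow> (\<lambda>x. f x - g x) \<in> sqint"
  using sqint_add[OF _ sqint_minus, of f g] by simp

lemma sqint_sum: "(\<And>i. i \<in> I \<Longrightarrow> f i \<in> sqint) \<Longrightarrow> (\<lambda>x. \<Sum>i\<in>I. f i x) \<in> sqint"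
  by (induction I rule: infinite_finite_induct) (auto intro: sqint_zero sqint_add)

lemma sqint_mult_integrable:
  assumes "f \<in> sqint" "g \<in> sqint" shows "integrable lebesgue (\<lambda>x. f x * g x)"
proof (rule Bochner_Integration.integrable_bound)
  show "integrable lebesgue (\<lambda>x. (f x)\<^sup>2 + (g x)\<^sup>2)" using assms by (auto simp: sqint_def)
  have "\<bar>f x * g x\<bar> \<le> (f x)\<^sup>2 + (g x)\<^sup>2" for x
  proof -
    have "2 * \<bar>f x * g x\<bar> \<le> (f x)\<^sup>2 + (g x)\<^sup>2"
      using zero_le_power2[of "\<bar>f x\<bar> - \<bar>g x\<bar>"] by (simp add: power2_eq_square algebra_simps abs_mult)
    then show ?thesis by (smt (verit) zero_le_power2)
  qed
  then show "AE x in lebesgue. norm (f x * g x) \<le> norm ((f x)\<^sup>2 + (g x)\<^sup>2)" by simp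
qed (use assms in \<open>auto simp: sqint_def\<close>)

text \<open>A partial equivalence, reflexive exactly on \<open>sqint\<close>: the quotient type
  consists of classes of square-integrable functions only, and the general Hilbert space results
  apply to it as a type.\<close>

definition l2rel :: "('a::euclidean_space \<Rightarrow> real) \<Rightarrow> ('a \<Rightarrow> real) \<Rightarrow> bool" where
  "l2rel f g \<longleftrightarrow> f \<in> sqint \<and> g \<in> sqint \<and> (AE x in lebesgue. f x = g x)"

quotient_type (overloaded) 'a l2 = "'a::euclidean_space \<Rightarrow> real" / partial: l2rel
proof (rule part_equivpI)
  show "\<exists>f. l2rel f f" using sqint_zero by (auto simp: l2rel_def)
  show "symp l2rel" by (auto simp: l2rel_def symp_def)
  show "transp l2rel" by (auto simp: l2rel_def transp_def)
qed

lemma integral_mult_l2rel: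
  "l2rel f f' \<Longrightarrow> l2rel g g' \<Longrightarrow> (LINT x|lebesgue. f x * g x) = (LINT x|lebesgue. f' x * g' x)"
  by (rule integral_cong_AE) (auto simp: l2rel_def sqint_def)

instantiation l2 :: (euclidean_space) real_inner
begin

lift_definition zero_l2 :: "'a l2" is "\<lambda>x. 0" by (simp add: l2rel_def sqint_zero)
lift_definition plus_l2 :: "'a l2 \<Rightarrow> 'a l2 \<Rightarrow> 'a l2" is "\<lambda>f g x. f x + g x"
  by (auto simp: l2rel_def intro: sqint_add)
lift_definition minus_l2 :: "'a l2 \<Rightarrow> 'a l2 \<Rightarrow> 'a l2" is "\<lambda>f g x. f x - g x"
  by (auto simp: l2rel_def intro: sqint_diff)
lift_definition uminus_l2 :: "'a l2 \<Rightarrow> 'a l2" is "\<lambda>f x. - f x"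
  by (auto simp: l2rel_def intro: sqint_minus)
lift_definition scaleR_l2 :: "real \<Rightarrow> 'a l2 \<Rightarrow> 'a l2" is "\<lambda>c f x. c * f x"
  by (auto simp: l2rel_def intro: sqint_scale)
lift_definition inner_l2 :: "'a l2 \<Rightarrow> 'a l2 \<Rightarrow> real" is "\<lambda>f g. LINT x|lebesgue. f x * g x"
  by (rule integral_mult_l2rel)

definition norm_l2 :: "'a l2 \<Rightarrow> real" where "norm_l2 f = sqrt (inner f f)"
definition sgn_l2 :: "'a l2 \<Rightarrow> 'a l2" where "sgn_l2 f = inverse (norm f) *\<^sub>R f"
definition dist_l2 :: "'a l2 \<Rightarrow> 'a l2 \<Rightarrow> real" where "dist_l2 f g = norm (f - g)"
definition uniformity_l2 :: "('a l2 \<times> 'a l2) filter" where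
  "uniformity_l2 = (INF e\<in>{0<..}. principal {(f, g). dist f g < e})"
definition open_l2 :: "'a l2 set \<Rightarrow> bool" where
  "open_l2 U = (\<forall>f\<in>U. \<forall>\<^sub>F (f', g) in uniformity. f' = f \<longrightarrow> g \<in> U)"

instance
proof
  fix a b c :: "'a l2" and r s :: real
  show "a + b + c = a + (b + c)"
    by transfer (auto simp: l2rel_def add.assoc intro!: sqint_add)
  show "a + b = b + a" by transfer (auto simp: l2rel_def add.commute intro!: sqint_add)
  show "0 + a = a" by transfer (auto simp: l2rel_def)
  show "- a + a = 0" by transfer (auto simp: l2rel_def sqint_zero)
  show "a - b = a + - b" by transfer (auto simp: l2rel_def intro: sqint_diff)
  show "r *\<^sub>R (a + b) = r *\<^sub>R a + r *\<^sub>R b"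
    by transfer (auto simp: l2rel_def algebra_simps intro!: sqint_add sqint_scale)
  show "(r + s) *\<^sub>R a = r *\<^sub>R a + s *\<^sub>R a"
    by transfer (auto simp: l2rel_def algebra_simps intro!: sqint_add sqint_scale)
  show "r *\<^sub>R s *\<^sub>R a = (r * s) *\<^sub>R a"
    by transfer (auto simp: l2rel_def algebra_simps intro!: sqint_scale)
  show "1 *\<^sub>R a = a" by transfer (auto simp: l2rel_def)
  show "sgn a = inverse (norm a) *\<^sub>R a" by (rule sgn_l2_def)
  show "dist a b = norm (a - b)" by (rule dist_l2_def)
  show "uniformity = (INF e\<in>{0<..}. principal {(f, g::'a l2). dist f g < e})"
    by (rule uniformity_l2_def)
  show "norm a = sqrt (inner a a)" by (rule norm_l2_def)
  show "inner a b = inner b a" by transfer (simp add: mult.commute)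
  show "inner (a + b) c = inner a c + inner b c"
    by transfer (auto simp: l2rel_def distrib_right intro!: Bochner_Integration.integral_add sqint_mult_integrable)
  show "inner (r *\<^sub>R a) b = r * inner a b"
    by transfer (simp add: mult.assoc)
  show "0 \<le> inner a a" by transfer simp
  show "inner a a = 0 \<longleftrightarrow> a = 0"
  proof transfer
    fix f :: "'a \<Rightarrow> real" assume f: "l2rel f f"
    then have "(LINT x|lebesgue. f x * f x) = 0 \<longleftrightarrow> (AE x in lebesgue. f x * f x = 0)"
      by (intro integral_nonneg_eq_0_iff_AE) (auto simp: l2rel_def intro: sqint_mult_integrable)
    also have "\<dots> \<longleftrightarrow> l2rel f (\<lambda>x. 0)" using f by (auto simp: l2rel_def sqint_zero)
    finally show "(LINT x|lebesgue. f x * f x) = 0 \<longleftrightarrow> l2rel f (\<lambda>x. 0)" .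
  qed
qed (rule open_l2_def)
end

lemma l2rel_refl: "f \<in> sqint \<Longrightarrow> l2rel f f"
  by (simp add: l2rel_def)

lemma rep_l2_sqint: "rep_l2 x \<in> sqint"
  using Quotient3_rep_reflp[OF Quotient3_l2, of x] by (simp add: l2rel_def)

lemma abs_rep_l2: "abs_l2 (rep_l2 x) = x"
  by (rule Quotient3_abs_rep[OF Quotient3_l2])

lemma rep_abs_l2: "f \<in> sqint \<Longrightarrow> AE x in lebesgue. rep_l2 (abs_l2 f) x = f x"
  using Quotient3_rep_abs[OF Quotient3_l2, of f] by (simp add: l2rel_def)

lemma abs_l2_eq_iff: "f \<in> sqint \<Longrightarrow> g \<in> sqint \<Longrightarrow> abs_l2 f = abs_l2 g \<longleftrightarrow> (AE x in lebesgue. f x = g x)"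
  using Quotient3_rel[OF Quotient3_l2, of f g] by (auto simp: l2rel_def)

lemma abs_l2_add: "f \<in> sqint \<Longrightarrow> g \<in> sqint \<Longrightarrow> abs_l2 (\<lambda>x. f x + g x) = abs_l2 f + abs_l2 g"
  using plus_l2.abs_eq[of f g] by (simp add: l2rel_refl)

lemma abs_l2_diff: "f \<in> sqint \<Longrightarrow> g \<in> sqint \<Longrightarrow> abs_l2 (\<lambda>x. f x - g x) = abs_l2 f - abs_l2 g"
  using minus_l2.abs_eq[of f g] by (simp add: l2rel_refl)

lemma abs_l2_scale: "f \<in> sqint \<Longrightarrow> abs_l2 (\<lambda>x. c * f x) = c *\<^sub>R abs_l2 f"
  using scaleR_l2.abs_eq[of f c] by (simp add: l2rel_refl)

lemma abs_l2_zero: "abs_l2 (\<lambda>x. 0) = 0"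
  by (simp add: zero_l2.abs_eq)

lemma abs_l2_sum:
  "(\<And>i. i \<in> I \<Longrightarrow> f i \<in> sqint) \<Longrightarrow> abs_l2 (\<lambda>x. \<Sum>i\<in>I. f i x) = (\<Sum>i\<in>I. abs_l2 (f i))"
  by (induction I rule: infinite_finite_induct)
     (auto simp: abs_l2_zero abs_l2_add sqint_sum)

lemma inner_abs_l2: "f \<in> sqint \<Longrightarrow> g \<in> sqint \<Longrightarrow> inner (abs_l2 f) (abs_l2 g) = (LINT x|lebesgue. f x * g x)"
  by (simp add: inner_l2.abs_eq l2rel_refl)

lemma norm_abs_l2: "f \<in> sqint \<Longrightarrow> norm (abs_l2 f) = sqrt (LINT x|lebesgue. (f x)\<^sup>2)"
  by (simp add: norm_eq_sqrt_inner inner_abs_l2 power2_eq_square)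

lemma norm_abs_l2_le:
  assumes g: "g \<in> sqint" and f: "f \<in> borel_measurable lebesgue"
    and le: "\<And>x. \<bar>f x\<bar> \<le> c * \<bar>g x\<bar>" and c: "0 \<le> c"
  shows "norm (abs_l2 f) \<le> c * norm (abs_l2 g)"
proof -
  have fs: "f \<in> sqint" by (rule sqint_dominated[OF g f le])
  have "(LINT x|lebesgue. (f x)\<^sup>2) \<le> (LINT x|lebesgue. c\<^sup>2 * (g x)\<^sup>2)"
  proof (rule integral_mono)
    show "(f x)\<^sup>2 \<le> c\<^sup>2 * (g x)\<^sup>2" for x
      using power_mono[OF le[of x], of 2] by (simp add: power_mult_distrib)
  qed (use fs g in \<open>auto simp: sqint_def\<close>)
  then have "sqrt (LINT x|lebesgue. (f x)\<^sup>2) \<le> sqrt (c\<^sup>2 * (LINT x|lebesgue. (g x)\<^sup>2))" by simp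
  then show ?thesis using c by (simp add: norm_abs_l2 fs g real_sqrt_mult)
qed

lemma nn_integral_square_sqint:
  assumes "f \<in> sqint"
  shows "(\<integral>\<^sup>+x. ennreal ((f x)\<^sup>2) \<partial>lebesgue) = ennreal ((norm (abs_l2 f))\<^sup>2)"
  using assms nn_integral_eq_integral[of lebesgue "\<lambda>x. (f x)\<^sup>2"]
  by (simp add: norm_abs_l2 sqint_def integral_nonneg_AE)

text \<open>The core of Riesz-Fischer. The partial sums \<open>s n\<close> of the absolute
  increments have norm at most 2, so by monotone convergence the square of their supremum is
  integrable. Hence the increments are absolutely summable almost everywhere.\<close>

lemma l2_summable_norm_limit:
  fixes f :: "nat \<Rightarrow> 'a::euclidean_space \<Rightarrow> real"
  assumes f: "\<And>n. f n \<in> sqint"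
    and fast: "\<And>n. norm (abs_l2 (f (Suc n)) - abs_l2 (f n)) \<le> (1/2) ^ n"
  shows "AE x in lebesgue. convergent (\<lambda>n. f n x)"
proof -
  have [measurable]: "f n \<in> borel_measurable lebesgue" for n using f by (simp add: sqint_def)
  define s where "s n x = (\<Sum>k<n. \<bar>f (Suc k) x - f k x\<bar>)" for n x
  have [measurable]: "s n \<in> borel_measurable lebesgue" for n unfolding s_def by measurable
  have abs_sq: "(\<lambda>x. \<bar>f (Suc k) x - f k x\<bar>) \<in> sqint" for k
    by (rule sqint_dominated[OF sqint_diff[OF f f], where c = 1]) auto
  have s_sq: "s n \<in> sqint" for n unfolding s_def by (intro sqint_sum abs_sq)
  have s_nonneg: "0 \<le> s n x" for n x unfolding s_def by (intro sum_nonneg) auto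
  have s_norm: "norm (abs_l2 (s n)) \<le> 2" for n
  proof -
    have "norm (abs_l2 (s n)) \<le> (\<Sum>k<n. norm (abs_l2 (\<lambda>x. \<bar>f (Suc k) x - f k x\<bar>)))"
      unfolding s_def by (subst abs_l2_sum) (auto intro: abs_sq norm_sum)
    also have "\<dots> \<le> (\<Sum>k<n. (1/2)^k)"
    proof (rule sum_mono)
      fix k
      have "norm (abs_l2 (\<lambda>x. \<bar>f (Suc k) x - f k x\<bar>)) \<le> 1 * norm (abs_l2 (\<lambda>x. f (Suc k) x - f k x))"
        by (rule norm_abs_l2_le[OF sqint_diff[OF f f]]) auto
      then show "norm (abs_l2 (\<lambda>x. \<bar>f (Suc k) x - f k x\<bar>)) \<le> (1/2)^k"
        using fast[of k] by (simp add: abs_l2_diff f)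
    qed
    also have "\<dots> \<le> 2" by (simp add: geometric_sum)
    finally show ?thesis .
  qed
  have inc: "incseq (\<lambda>n. s n x)" for x
    by (rule incseq_SucI) (simp add: s_def)
  have "(\<integral>\<^sup>+x. (SUP n. ennreal ((s n x)\<^sup>2)) \<partial>lebesgue) = (SUP n. \<integral>\<^sup>+x. ennreal ((s n x)\<^sup>2) \<partial>lebesgue)"
  proof (rule nn_integral_monotone_convergence_SUP)
    show "incseq (\<lambda>n x. ennreal ((s n x)\<^sup>2))"
      using inc s_nonneg by (auto simp: incseq_def le_fun_def intro!: ennreal_leI power_mono)
  qed measurable
  also have "\<dots> \<le> 4"
  proof (rule SUP_least)
    fix n
    have "(norm (abs_l2 (s n)))\<^sup>2 \<le> 2\<^sup>2" using s_norm by (intro power_mono) auto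
    then have "ennreal ((norm (abs_l2 (s n)))\<^sup>2) \<le> ennreal 4" by (intro ennreal_leI) simp
    then show "(\<integral>\<^sup>+x. ennreal ((s n x)\<^sup>2) \<partial>lebesgue) \<le> 4"
      by (simp add: nn_integral_square_sqint s_sq)
  qed
  also have "\<dots> < \<infinity>" by simp
  finally have "AE x in lebesgue. (SUP n. ennreal ((s n x)\<^sup>2)) \<noteq> \<infinity>"
    by (intro nn_integral_PInf_AE) auto
  then show ?thesis
  proof (rule AE_mp, intro AE_I2 impI)
    fix x assume "(SUP n. ennreal ((s n x)\<^sup>2)) \<noteq> \<infinity>"
    then obtain r where r: "r \<ge> 0" "(SUP n. ennreal ((s n x)\<^sup>2)) = ennreal r"
      by (metis ennreal_cases infinity_ennreal_def)
    have "s n x \<le> sqrt r" for n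
    proof -
      have "ennreal ((s n x)\<^sup>2) \<le> ennreal r" unfolding r(2)[symmetric] by (intro SUP_upper) auto
      then have "(s n x)\<^sup>2 \<le> r" using r by simp
      then show ?thesis by (rule real_le_rsqrt)
    qed
    then have "summable (\<lambda>k. \<bar>f (Suc k) x - f k x\<bar>)"
      by (intro summableI_nonneg_bounded[where x = "sqrt r"]) (auto simp: s_def)
    then have "summable (\<lambda>k. f (Suc k) x - f k x)" by (rule summable_rabs_cancel)
    then have "convergent (\<lambda>n. \<Sum>k<n. f (Suc k) x - f k x)" by (simp add: summable_iff_convergent)
    then have "convergent (\<lambda>n. f 0 x + (f n x - f 0 x))"
      by (subst (asm) sum_lessThan_telescope) (intro convergent_add convergent_const)
    then show "convergent (\<lambda>n. f n x)" by simp
  qed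
qed

text \<open>A rapidly converging subsequence has representatives that converge almost everywhere.
  Fatou's lemma shows that the pointwise limit is also the limit in norm.\<close>

instance l2 :: (euclidean_space) complete_space
proof
  fix X :: "nat \<Rightarrow> 'a l2" assume X: "Cauchy X"
  have "\<exists>N. \<forall>m\<ge>N. \<forall>n\<ge>N. norm (X m - X n) < (1/2)^k" for k
    using CauchyD[OF X, of "(1/2)^k"] by simp
  then obtain N where N: "\<And>k m n. m \<ge> N k \<Longrightarrow> n \<ge> N k \<Longrightarrow> norm (X m - X n) < (1/2)^k"
    by metis
  \<comment> \<open>The maximum makes \<open>M k\<close> at least \<open>N j\<close> for every
    \<open>j \<le> k\<close>, so that \<open>f m\<close> is close to \<open>f k\<close> whenever
    \<open>k \<le> m\<close>, although \<open>N\<close> need not be monotone.\<close>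
  define M where "M k = Max (N ` {..k})" for k
  have MN: "N j \<le> M k" if "j \<le> k" for j k unfolding M_def using that by (intro Max_ge) auto
  define f where "f k = rep_l2 (X (M k))" for k
  have fs: "f k \<in> sqint" for k by (simp add: f_def rep_l2_sqint)
  have absf: "abs_l2 (f k) = X (M k)" for k by (simp add: f_def abs_rep_l2)
  have [measurable]: "f k \<in> borel_measurable lebesgue" for k using fs by (simp add: sqint_def)
  have fXk: "norm (abs_l2 (f m) - abs_l2 (f k)) \<le> (1/2)^k" if "k \<le> m" for k m
    unfolding absf by (rule less_imp_le[OF N[OF MN[OF that] MN[OF order_refl]]])
  have conv: "AE x in lebesgue. convergent (\<lambda>n. f n x)"
    by (rule l2_summable_norm_limit) (use fs fXk in auto)
  define g where "g x = lim (\<lambda>n. f n x)" for x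
  have [measurable]: "g \<in> borel_measurable lebesgue" unfolding g_def by measurable
  have fg: "(\<integral>\<^sup>+x. ennreal ((g x - f k x)\<^sup>2) \<partial>lebesgue) \<le> ennreal (((1/2)^k)\<^sup>2)" for k
  proof -
    have "(\<integral>\<^sup>+x. ennreal ((g x - f k x)\<^sup>2) \<partial>lebesgue)
        = (\<integral>\<^sup>+x. liminf (\<lambda>n. ennreal ((f n x - f k x)\<^sup>2)) \<partial>lebesgue)"
    proof (rule nn_integral_cong_AE, use conv in eventually_elim)
      fix x assume "convergent (\<lambda>n. f n x)"
      then have "(\<lambda>n. f n x) \<longlonglongrightarrow> g x" unfolding g_def by (simp add: convergent_LIMSEQ_iff)
      then have "(\<lambda>n. ennreal ((f n x - f k x)\<^sup>2)) \<longlonglongrightarrow> ennreal ((g x - f k x)\<^sup>2)"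
        by (intro tendsto_intros)
      then show "ennreal ((g x - f k x)\<^sup>2) = liminf (\<lambda>n. ennreal ((f n x - f k x)\<^sup>2))"
        using lim_imp_Liminf[of sequentially] by (metis sequentially_bot)
    qed
    also have "\<dots> \<le> liminf (\<lambda>n. \<integral>\<^sup>+x. ennreal ((f n x - f k x)\<^sup>2) \<partial>lebesgue)"
      by (rule nn_integral_liminf) measurable
    also have "\<dots> \<le> ennreal (((1/2)^k)\<^sup>2)"
    proof (rule Liminf_le)
      show "\<forall>\<^sub>F n in sequentially. (\<integral>\<^sup>+x. ennreal ((f n x - f k x)\<^sup>2) \<partial>lebesgue) \<le> ennreal (((1/2)^k)\<^sup>2)"
        using eventually_ge_at_top[of k]
      proof eventually_elim
        fix n assume "k \<le> n"
        then show "(\<integral>\<^sup>+x. ennreal ((f n x - f k x)\<^sup>2) \<partial>lebesgue) \<le> ennreal (((1/2)^k)\<^sup>2)"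
          using fXk[of k n] fs
          by (subst nn_integral_square_sqint)
             (auto simp: abs_l2_diff sqint_diff intro!: ennreal_leI power_mono)
      qed
    qed simp
    finally show ?thesis .
  qed
  have gf_sq: "(\<lambda>x. g x - f k x) \<in> sqint" for k
    unfolding sqint_def using fg[of k]
    by (auto intro!: integrableI_bounded simp: top_unique less_top[symmetric])
  \<comment> \<open>Fatou controls only differences; square-integrability of \<open>g\<close> itself
    is recovered by adding \<open>f 0\<close> back.\<close>
  then have "(\<lambda>x. (g x - f 0 x) + f 0 x) \<in> sqint" by (rule sqint_add) (rule fs)
  then have gs: "g \<in> sqint" by simp
  have gk: "norm (abs_l2 g - X (M k)) \<le> (1/2)^k" for k
  proof -
    have "ennreal ((norm (abs_l2 g - abs_l2 (f k)))\<^sup>2) \<le> ennreal (((1/2)^k)\<^sup>2)"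
      using fg[of k] nn_integral_square_sqint[OF gf_sq[of k]] by (simp add: abs_l2_diff gs fs)
    then have "(norm (abs_l2 g - abs_l2 (f k)))\<^sup>2 \<le> ((1/2)^k)\<^sup>2" by simp
    then show ?thesis unfolding absf by (rule power2_le_imp_le) simp
  qed
  have "X \<longlonglongrightarrow> abs_l2 g"
  proof (rule LIMSEQ_I)
    fix e :: real assume "0 < e"
    then obtain k where k: "(1/2)^k < e / 2"
      using real_arch_pow_inv[of "e/2" "1/2"] by auto
    show "\<exists>no. \<forall>n\<ge>no. norm (X n - abs_l2 g) < e"
    proof (intro exI allI impI)
      fix n assume n: "N k \<le> n"
      have "norm (X n - abs_l2 g) \<le> norm (X n - X (M k)) + norm (abs_l2 g - X (M k))"
        using norm_triangle_ineq4[of "X n - X (M k)" "abs_l2 g - X (M k)"] by simp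
      also have "\<dots> < e" using N[OF n MN[of k k]] gk[of k] k by simp
      finally show "norm (X n - abs_l2 g) < e" .
    qed
  qed
  then show "convergent X" by (auto simp: convergent_def)
qed

section \<open>Multiplication by bounded functions as an operator on L2\<close>

definition mult_l2 :: "('a::euclidean_space \<Rightarrow> real) \<Rightarrow> 'a l2 \<Rightarrow> 'a l2" where
  "mult_l2 b x = abs_l2 (\<lambda>t. b t * rep_l2 x t)"

lemma sqint_bounded_mult:
  assumes "b \<in> borel_measurable lebesgue" "\<And>t. \<bar>b t\<bar> \<le> c" "f \<in> sqint"
  shows "(\<lambda>t. b t * f t) \<in> sqint"
  by (rule sqint_dominated[OF assms(3), where c = c])
     (use assms in \<open>auto simp: sqint_def abs_mult intro: mult_right_mono\<close>)

lemma mult_l2_abs: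
  assumes "b \<in> borel_measurable lebesgue" "\<And>t. \<bar>b t\<bar> \<le> c" "f \<in> sqint"
  shows "mult_l2 b (abs_l2 f) = abs_l2 (\<lambda>t. b t * f t)"
  unfolding mult_l2_def using rep_abs_l2[OF assms(3)] assms
  by (subst abs_l2_eq_iff) (auto intro: sqint_bounded_mult rep_l2_sqint)

lemma bounded_linear_mult_l2:
  assumes b: "b \<in> borel_measurable lebesgue" "\<And>t. \<bar>b t\<bar> \<le> c"
  shows "bounded_linear (mult_l2 b)"
proof (rule bounded_linear_intro)
  fix x y :: "'a l2" and r :: real
  obtain f g where f: "x = abs_l2 f" "f \<in> sqint" and g: "y = abs_l2 g" "g \<in> sqint"
    using abs_rep_l2 rep_l2_sqint by metis
  show "mult_l2 b (x + y) = mult_l2 b x + mult_l2 b y"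
    unfolding f(1) g(1) abs_l2_add[OF f(2) g(2), symmetric]
    using f(2) g(2) by (simp add: mult_l2_abs[OF b] sqint_add abs_l2_add[symmetric] sqint_bounded_mult[OF b] distrib_left)
  show "mult_l2 b (r *\<^sub>R x) = r *\<^sub>R mult_l2 b x"
    unfolding f(1) abs_l2_scale[OF f(2), symmetric]
    using f(2) by (simp add: mult_l2_abs[OF b] sqint_scale abs_l2_scale[symmetric] sqint_bounded_mult[OF b] mult_ac)
  have "0 \<le> c" using b(2)[of undefined] by linarith
  then have "norm (abs_l2 (\<lambda>t. b t * f t)) \<le> c * norm (abs_l2 f)"
    using b f(2) by (intro norm_abs_l2_le) (auto simp: sqint_def abs_mult intro: mult_right_mono)
  then show "norm (mult_l2 b x) \<le> norm x * c"
    unfolding f(1) using f(2) by (simp add: mult_l2_abs[OF b] mult.commute)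
qed

section \<open>Smooth functions and integration by parts\<close>

lemma partial_derivI: "(f has_derivative f') (at x) \<Longrightarrow> partial_deriv i f x = f' (axis i 1)"
  unfolding partial_deriv_def using frechet_derivative_at by metis

declare Ck_on.simps(2)[simp del]

lemma Ck_on_Suc_UNIV:
  "Ck_on (Suc k) UNIV f \<longleftrightarrow> (\<forall>x. f differentiable (at x)) \<and> (\<forall>i. Ck_on k UNIV (partial_deriv i f))"
  by (simp add: Ck_on.simps differentiable_on_def)

lemma Ck_on_Suc_imp: "Ck_on (Suc k) UNIV f \<Longrightarrow> Ck_on k UNIV f"
proof (induction k arbitrary: f)
  case 0
  then show ?case by (auto simp: Ck_on.simps intro: differentiable_imp_continuous_on)
next
  case (Suc k)
  then show ?case by (metis Ck_on.simps(2))
qed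

lemma Ck_on_const: "Ck_on k UNIV (\<lambda>x::real^'n. c)"
proof (induction k arbitrary: c)
  case (Suc k)
  have "partial_deriv i (\<lambda>x::real^'n. c) = (\<lambda>x. 0)" for i
    by (rule ext, subst partial_derivI[OF has_derivative_const]) simp
  then show ?case using Suc by (simp add: Ck_on_Suc_UNIV)
qed simp

lemma partial_deriv_add:
  assumes "f differentiable (at x)" "g differentiable (at x)"
  shows "partial_deriv i (\<lambda>x. f x + g x) x = partial_deriv i f x + partial_deriv i g x"
  using has_derivative_add[OF assms[unfolded frechet_derivative_works]]
  by (subst partial_derivI) (auto simp: partial_deriv_def)

lemma partial_deriv_mult:
  assumes "f differentiable (at x)" "g differentiable (at x)"
  shows "partial_deriv i (\<lambda>x. f x * g x) x = partial_deriv i f x * g x + f x * partial_deriv i g x"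
  using has_derivative_mult[OF assms[unfolded frechet_derivative_works]]
  by (subst partial_derivI) (auto simp: partial_deriv_def add.commute)

lemma Ck_on_add: "Ck_on k UNIV f \<Longrightarrow> Ck_on k UNIV g \<Longrightarrow> Ck_on k UNIV (\<lambda>x. f x + g x)"
proof (induction k arbitrary: f g)
  case 0
  then show ?case by (auto intro: continuous_on_add)
next
  case (Suc k)
  then have "partial_deriv i (\<lambda>x. f x + g x) = (\<lambda>x. partial_deriv i f x + partial_deriv i g x)" for i
    by (intro ext partial_deriv_add) (simp_all add: Ck_on_Suc_UNIV)
  then show ?case using Suc by (simp add: Ck_on_Suc_UNIV differentiable_add)
qed

lemma Ck_on_mult: "Ck_on k UNIV f \<Longrightarrow> Ck_on k UNIV g \<Longrightarrow> Ck_on k UNIV (\<lambda>x. f x * g x)"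
proof (induction k arbitrary: f g)
  case 0
  then show ?case by (auto intro: continuous_on_mult)
next
  case (Suc k)
  then have "partial_deriv i (\<lambda>x. f x * g x) = (\<lambda>x. partial_deriv i f x * g x + f x * partial_deriv i g x)" for i
    by (intro ext partial_deriv_mult) (simp_all add: Ck_on_Suc_UNIV)
  moreover have "Ck_on k UNIV f" "Ck_on k UNIV g" using Suc.prems Ck_on_Suc_imp by blast+
  ultimately show ?case using Suc by (simp add: Ck_on_Suc_UNIV differentiable_mult Ck_on_add)
qed

lemma Ck_on_prod:
  "(\<And>i. i \<in> I \<Longrightarrow> Ck_on k UNIV (f i)) \<Longrightarrow> Ck_on k UNIV (\<lambda>x. \<Prod>i\<in>I. f i x)"
  by (induction I rule: infinite_finite_induct) (auto simp: Ck_on_const Ck_on_mult)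

lemma has_derivative_coordinate: "((\<lambda>x::real^'n. x $ i) has_derivative (\<lambda>x. x $ i)) (at x)"
  by (rule bounded_linear_imp_has_derivative) (rule bounded_linear_vec_nth)

lemma Ck_on_coordinate: "Ck_on k UNIV (\<lambda>x::real^'n. x $ i)"
proof (cases k)
  case (Suc m)
  have "partial_deriv j (\<lambda>x::real^'n. x $ i) = (\<lambda>x. axis j 1 $ i)" for j
    by (rule ext, rule partial_derivI[OF has_derivative_coordinate])
  then show ?thesis using Suc has_derivative_coordinate
    by (auto simp: Ck_on_Suc_UNIV Ck_on_const differentiable_def)
qed (simp add: continuous_on_component)

lemma smooth_on_differentiable: "smooth_on UNIV f \<Longrightarrow> f differentiable (at x)"
  unfolding smooth_on_def using Ck_on_Suc_UNIV by blast

lemma smooth_on_partial_deriv: "smooth_on UNIV f \<Longrightarrow> smooth_on UNIV (partial_deriv i f)"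
  unfolding smooth_on_def using Ck_on_Suc_UNIV by blast

lemma smooth_on_imp_Ck1: "smooth_on UNIV f \<Longrightarrow> Ck_on (Suc 0) UNIV f"
  unfolding smooth_on_def by blast

lemma Ck1_differentiable: "Ck_on (Suc 0) UNIV f \<Longrightarrow> f differentiable (at x)"
  by (simp add: Ck_on_Suc_UNIV)

lemma Ck1_continuous: "Ck_on (Suc 0) UNIV f \<Longrightarrow> continuous_on UNIV f"
  using Ck_on_Suc_imp[of 0 f] by simp

lemma Ck1_partial_continuous: "Ck_on (Suc 0) UNIV f \<Longrightarrow> continuous_on UNIV (partial_deriv i f)"
  by (simp add: Ck_on_Suc_UNIV)

lemma Ck1_mult: "Ck_on (Suc 0) UNIV f \<Longrightarrow> Ck_on (Suc 0) UNIV g \<Longrightarrow> Ck_on (Suc 0) UNIV (\<lambda>x. f x * g x)"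
  by (rule Ck_on_mult)

lemma partial_deriv_eq_0_outside_closed:
  assumes "closed K" "\<And>x. x \<notin> K \<Longrightarrow> f x = 0" "x \<notin> K"
  shows "partial_deriv i f x = 0"
proof -
  have "(f has_derivative (\<lambda>h. 0)) (at x)"
    by (rule has_derivative_transform_within_open[of "\<lambda>x. 0", where s = "- K"]) (use assms in auto)
  then show ?thesis by (rule partial_derivI)
qed

lemma has_real_derivative_along_axis:
  assumes "f differentiable (at (x + s *\<^sub>R axis i 1))"
  shows "((\<lambda>s. f (x + s *\<^sub>R axis i 1)) has_real_derivative partial_deriv i f (x + s *\<^sub>R axis i 1)) (at s)"
proof -
  let ?D = "frechet_derivative f (at (x + s *\<^sub>R axis i 1))"
  have D: "(f has_derivative ?D) (at (x + s *\<^sub>R axis i 1))"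
    using assms by (simp add: frechet_derivative_works)
  have "((\<lambda>s. f (x + s *\<^sub>R axis i 1)) has_derivative (\<lambda>h. ?D (h *\<^sub>R axis i 1))) (at s)"
    by (rule has_derivative_compose[where f = "\<lambda>s. x + s *\<^sub>R axis i 1", OF _ D])
       (auto intro!: derivative_eq_intros)
  moreover have "(\<lambda>h. ?D (h *\<^sub>R axis i 1)) = (*) (partial_deriv i f (x + s *\<^sub>R axis i 1))"
    using linear_scale[OF has_derivative_linear[OF D]]
    by (auto simp: partial_deriv_def mult.commute)
  ultimately show ?thesis by (simp add: has_field_derivative_def)
qed

text \<open>The mean value theorem along one axis. It supplies the dominating function for the
  difference quotients in \<open>integral_partial_deriv_eq_0\<close>.\<close>

lemma partial_deriv_Lipschitz_bound:
  assumes df: "\<And>x. f differentiable (at x)" and L: "\<And>x. \<bar>partial_deriv i f x\<bar> \<le> L"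
  shows "\<bar>f (x + s *\<^sub>R axis i 1) - f x\<bar> \<le> L * \<bar>s\<bar>"
proof -
  have "norm ((\<lambda>s. f (x + s *\<^sub>R axis i 1)) s - (\<lambda>s. f (x + s *\<^sub>R axis i 1)) 0) \<le> L * norm (s - 0)"
    by (rule field_differentiable_bound[where S = UNIV])
       (use L in \<open>auto intro!: has_real_derivative_along_axis df simp: has_field_derivative_at_within\<close>)
  then show ?thesis by simp
qed

lemma integrable_continuous_compact_support:
  fixes f :: "real^'n \<Rightarrow> real"
  assumes "continuous_on UNIV f" "compact K" "\<And>x. x \<notin> K \<Longrightarrow> f x = 0"
  shows "integrable lborel f" "integrable lebesgue f"
proof -
  have "integrable lborel (\<lambda>x. indicator K x *\<^sub>R f x)"
    using assms by (intro borel_integrable_compact) (auto intro: continuous_on_subset)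
  moreover have "(\<lambda>x. indicator K x *\<^sub>R f x) = f" using assms(3) by (fastforce simp: indicator_def)
  ultimately show 1: "integrable lborel f" by simp
  then show "integrable lebesgue f" by (simp add: integrable_completion)
qed

lemma continuous_compact_support_bounded:
  fixes f :: "real^'n \<Rightarrow> real"
  assumes "continuous_on UNIV f" "compact K" "\<And>x. x \<notin> K \<Longrightarrow> f x = 0"
  obtains B where "B \<ge> 0" "\<And>x. \<bar>f x\<bar> \<le> B"
proof -
  have "bounded (f ` K)"
    using assms by (intro compact_imp_bounded compact_continuous_image) (auto intro: continuous_on_subset)
  then obtain B where B: "\<And>x. x \<in> K \<Longrightarrow> \<bar>f x\<bar> \<le> B" by (auto simp: bounded_iff)
  show ?thesis
  proof (rule that[of "max B 0"])
    show "\<bar>f x\<bar> \<le> max B 0" for x using B[of x] assms(3)[of x] by (cases "x \<in> K") auto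
  qed simp
qed

lemma integral_lborel_translate:
  fixes f :: "'a::euclidean_space \<Rightarrow> real"
  assumes "f \<in> borel_measurable borel"
  shows "(LINT x|lborel. f (c + x)) = (LINT x|lborel. f x)"
  using integral_distr[of "(+) c" lborel borel f] assms by (simp add: lborel_distr_plus)

text \<open>The difference quotients of \<open>f\<close> have integral zero by translation invariance.\<close>

lemma integral_partial_deriv_eq_0:
  fixes f :: "real^'n \<Rightarrow> real"
  assumes f: "Ck_on (Suc 0) UNIV f" and K: "compact K" and f0: "\<And>x. x \<notin> K \<Longrightarrow> f x = 0"
  shows "(LINT x|lebesgue. partial_deriv i f x) = 0"
proof -
  have cf: "continuous_on UNIV f" and cd: "continuous_on UNIV (partial_deriv i f)"
    using f Ck1_continuous Ck1_partial_continuous by blast+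
  have df: "f differentiable (at x)" for x using f by (rule Ck1_differentiable)
  have [measurable]: "f \<in> borel_measurable borel" "partial_deriv i f \<in> borel_measurable borel"
    using cf cd by (auto intro: borel_measurable_continuous_onI)
  have d0: "partial_deriv i f x = 0" if "x \<notin> K" for x
    using partial_deriv_eq_0_outside_closed[of K f] f0 that compact_imp_closed[OF K] by blast
  obtain L where L: "L \<ge> 0" "\<And>x. \<bar>partial_deriv i f x\<bar> \<le> L"
    using continuous_compact_support_bounded[OF cd K d0] by blast
  obtain R where R: "\<And>x. x \<in> K \<Longrightarrow> norm x \<le> R"
    using compact_imp_bounded[OF K] by (auto simp: bounded_iff)
  define s where "s n = 1 / real (Suc n)" for n
  define g where "g n x = (f (s n *\<^sub>R axis i 1 + x) - f x) / s n" for n x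
  have s: "0 < s n" "s n \<le> 1" for n by (auto simp: s_def)
  \<comment> \<open>The steps \<open>s n\<close> are at most 1, so all difference quotients vanish
    outside the ball of radius \<open>R + 1\<close>, and \<open>L\<close> bounds them inside
    it.\<close>
  have "(\<lambda>n. LINT x|lborel. g n x) \<longlonglongrightarrow> (LINT x|lborel. partial_deriv i f x)"
  proof (rule integral_dominated_convergence[where w = "\<lambda>x. L * indicator (cball 0 (R + 1)) x"])
    show "integrable lborel (\<lambda>x::real^'n. L * indicator (cball 0 (R + 1)) x)"
      by (auto intro!: integrable_mult_right integrable_real_indicator emeasure_bounded_finite)
    show "AE x in lborel. (\<lambda>n. g n x) \<longlonglongrightarrow> partial_deriv i f x"
    proof (intro AE_I2)
      fix x
      have "((\<lambda>h. f (x + h *\<^sub>R axis i 1)) has_real_derivative partial_deriv i f (x + 0 *\<^sub>R axis i 1)) (at 0)"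
        by (intro has_real_derivative_along_axis df)
      then have "((\<lambda>h. (f (x + h *\<^sub>R axis i 1) - f x) / h) \<longlongrightarrow> partial_deriv i f x) (at 0)"
        by (simp add: DERIV_def)
      moreover have "filterlim s (at 0) sequentially"
        using s LIMSEQ_Suc[OF lim_1_over_n[where 'a = real]]
        by (auto simp: filterlim_at less_imp_neq[symmetric] s_def[abs_def])
      ultimately have "(\<lambda>n. (f (x + s n *\<^sub>R axis i 1) - f x) / s n) \<longlonglongrightarrow> partial_deriv i f x"
        by (rule filterlim_compose)
      then show "(\<lambda>n. g n x) \<longlonglongrightarrow> partial_deriv i f x" by (simp add: g_def add.commute)
    qed
    show "AE x in lborel. norm (g n x) \<le> L * indicator (cball 0 (R + 1)) x" for n
    proof (intro AE_I2)
      fix x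
      show "norm (g n x) \<le> L * indicator (cball 0 (R + 1)) x"
      proof (cases "norm x \<le> R + 1")
        case True
        have "\<bar>f (s n *\<^sub>R axis i 1 + x) - f x\<bar> \<le> L * s n"
          using partial_deriv_Lipschitz_bound[of f i L x "s n", OF df L(2)] s[of n] by (simp add: add.commute)
        then show ?thesis using True s[of n] by (simp add: g_def field_simps)
      next
        case False
        have "norm x \<le> norm (s n *\<^sub>R axis i 1 + x) + norm (s n *\<^sub>R axis i (1::real) :: real^'n)"
          using norm_triangle_ineq4[of "s n *\<^sub>R axis i 1 + x" "s n *\<^sub>R axis i 1"] by simp
        also have "\<dots> \<le> norm (s n *\<^sub>R axis i 1 + x) + 1" using s[of n] by simp
        finally have "s n *\<^sub>R axis i 1 + x \<notin> K" "x \<notin> K" using False R by force+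
        then show ?thesis using False f0 by (simp add: g_def)
      qed
    qed
  qed (auto simp: g_def)
  moreover have "(LINT x|lborel. g n x) = 0" for n
  proof -
    have i1: "integrable lborel f" by (rule integrable_continuous_compact_support[OF cf K f0])
    have "integrable lborel (\<lambda>x. f (s n *\<^sub>R axis i 1 + x))"
      using i1 integrable_distr_eq[of "(+) (s n *\<^sub>R axis i 1)" lborel borel f]
      by (simp add: lborel_distr_plus)
    then show ?thesis
      unfolding g_def using i1
      by (simp add: integral_lborel_translate)
  qed
  ultimately have "(LINT x|lborel. partial_deriv i f x) = 0"
    by (simp add: LIMSEQ_const_iff)
  then show ?thesis by (simp add: integral_completion)
qed

text \<open>The product \<open>f x * g x\<close> inherits the compact support of \<open>f\<close>,
  so the integral of its partial derivative is zero.\<close>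

lemma integration_by_parts:
  fixes f g :: "real^'n \<Rightarrow> real"
  assumes f: "Ck_on (Suc 0) UNIV f" and g: "Ck_on (Suc 0) UNIV g"
    and K: "compact K" and f0: "\<And>x. x \<notin> K \<Longrightarrow> f x = 0"
  shows "(LINT x|lebesgue. f x * partial_deriv i g x) = - (LINT x|lebesgue. partial_deriv i f x * g x)"
proof -
  have d0: "partial_deriv i f x = 0" if "x \<notin> K" for x
    using partial_deriv_eq_0_outside_closed[of K f] f0 that compact_imp_closed[OF K] by blast
  have "integrable lebesgue (\<lambda>x. f x * partial_deriv i g x)"
    by (rule integrable_continuous_compact_support[OF _ K])
       (use f0 Ck1_continuous[OF f] Ck1_partial_continuous[OF g] in \<open>auto intro!: continuous_on_mult\<close>)
  moreover have "integrable lebesgue (\<lambda>x. partial_deriv i f x * g x)"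
    by (rule integrable_continuous_compact_support[OF _ K])
       (use d0 Ck1_continuous[OF g] Ck1_partial_continuous[OF f] in \<open>auto intro!: continuous_on_mult\<close>)
  moreover have "(LINT x|lebesgue. partial_deriv i (\<lambda>x. f x * g x) x) = 0"
    by (rule integral_partial_deriv_eq_0[OF Ck1_mult[OF f g] K]) (simp add: f0)
  ultimately show ?thesis
    using f g by (simp add: partial_deriv_mult Ck1_differentiable)
qed

text \<open>Integrating the derivative of \<open>x\<^sub>i f(x)\<^sup>2\<close> by parts.\<close>

lemma Poincare_inequality:
  fixes f :: "real^'n \<Rightarrow> real"
  assumes f: "Ck_on (Suc 0) UNIV f" and K: "compact K" and f0: "\<And>x. x \<notin> K \<Longrightarrow> f x = 0"
    and R: "\<And>x. x \<in> K \<Longrightarrow> norm x \<le> R"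
  shows "(LINT x|lebesgue. (f x)\<^sup>2) \<le> 4 * R\<^sup>2 * (LINT x|lebesgue. (partial_deriv i f x)\<^sup>2)"
proof -
  let ?D = "partial_deriv i f"
  have d0: "?D x = 0" if "x \<notin> K" for x
    using partial_deriv_eq_0_outside_closed[of K f] f0 that compact_imp_closed[OF K] by blast
  have cf: "continuous_on UNIV f" and cd: "continuous_on UNIV ?D"
    using f Ck1_continuous Ck1_partial_continuous by blast+
  have cx: "Ck_on (Suc 0) UNIV (\<lambda>x::real^'n. x $ i)" by (rule Ck_on_coordinate)
  have i1: "integrable lebesgue (\<lambda>x. (f x)\<^sup>2)" and i2: "integrable lebesgue (\<lambda>x. (?D x)\<^sup>2)"
    by (rule integrable_continuous_compact_support[OF _ K];
        use f0 d0 cf cd in \<open>auto intro!: continuous_on_power\<close>)+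
  have i3: "integrable lebesgue (\<lambda>x. 2 * (x $ i * (f x * ?D x)))"
    by (rule integrable_continuous_compact_support[OF _ K])
       (use f0 d0 cf cd in \<open>auto intro!: continuous_on_mult continuous_on_component continuous_on_const\<close>)
  have ff: "Ck_on (Suc 0) UNIV (\<lambda>x. f x * f x)" by (rule Ck1_mult[OF f f])
  have xd: "partial_deriv i (\<lambda>x::real^'n. x $ i) x = 1" for x
    by (simp add: partial_derivI[OF has_derivative_coordinate])
  have pd: "partial_deriv i (\<lambda>x. x $ i * (f x * f x)) x = (f x)\<^sup>2 + 2 * (x $ i * (f x * ?D x))" for x
    using Ck1_differentiable[OF cx] Ck1_differentiable[OF ff] Ck1_differentiable[OF f]
    by (simp add: partial_deriv_mult xd power2_eq_square algebra_simps)
  have "(LINT x|lebesgue. partial_deriv i (\<lambda>x. x $ i * (f x * f x)) x) = 0"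
    by (rule integral_partial_deriv_eq_0[OF Ck1_mult[OF cx ff] K]) (simp add: f0)
  then have "(LINT x|lebesgue. (f x)\<^sup>2) = (LINT x|lebesgue. - (2 * (x $ i * (f x * ?D x))))"
    unfolding pd using i1 i3 by simp
  \<comment> \<open>Young's inequality, weighted so that the term in \<open>f\<close> carries the
    factor 1/2 and can be absorbed on the left. Doubling what remains gives the constant 4
    R^2.\<close>
  also have "\<dots> \<le> (LINT x|lebesgue. (1/2) * (f x)\<^sup>2 + 2 * R\<^sup>2 * (?D x)\<^sup>2)"
  proof (rule integral_mono)
    fix x
    show "- (2 * (x $ i * (f x * ?D x))) \<le> (1/2) * (f x)\<^sup>2 + 2 * R\<^sup>2 * (?D x)\<^sup>2"
    proof (cases "x \<in> K")
      case True
      have xR: "(x $ i)\<^sup>2 \<le> R\<^sup>2"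
        using R[OF True] component_le_norm_cart[of x i] by (intro abs_le_square_iff[THEN iffD1]) auto
      have "0 \<le> (f x + 2 * (x $ i) * ?D x)\<^sup>2" by simp
      then have "- (2 * (x $ i * (f x * ?D x))) \<le> (1/2) * (f x)\<^sup>2 + 2 * (x $ i)\<^sup>2 * (?D x)\<^sup>2"
        by (simp add: power2_eq_square algebra_simps)
      moreover have "(x $ i)\<^sup>2 * (?D x)\<^sup>2 \<le> R\<^sup>2 * (?D x)\<^sup>2" by (intro mult_right_mono xR) auto
      ultimately show ?thesis by linarith
    qed (simp add: f0)
  qed (use i1 i2 i3 in auto)
  also have "\<dots> = (1/2) * (LINT x|lebesgue. (f x)\<^sup>2) + 2 * R\<^sup>2 * (LINT x|lebesgue. (?D x)\<^sup>2)"
    using i1 i2 by simp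
  finally show ?thesis by simp
qed

subsection \<open>Bump functions\<close>

text \<open>The powers of \<open>t\<close> in the denominator make the family closed under
  differentiation: the derivative of a member combines those with indices \<open>m + 1\<close> and
  \<open>m + 2\<close>.\<close>

definition flat_exp :: "nat \<Rightarrow> real \<Rightarrow> real" where
  "flat_exp m t = (if t \<le> 0 then 0 else exp (- 1 / t) / t ^ m)"

text \<open>From (1 + y/n)^n <= exp y with y = 1/t. The choice n = m + 2 leaves
  \<open>t\<^sup>2\<close> after the division by \<open>t ^ m\<close>, which forces the difference
  quotients at 0 to tend to 0.\<close>

lemma flat_exp_le_square:
  assumes "t > 0" shows "\<bar>flat_exp m t\<bar> \<le> real (m + 2) ^ (m + 2) * t\<^sup>2"
proof -
  define n where "n = m + 2"
  have n: "real n > 0" by (simp add: n_def)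
  have c: "real n ^ n > 0" "t ^ n > 0" using n assms by auto
  have "(1 / (t * real n)) ^ n \<le> (1 + (1 / t) / real n) ^ n"
    using assms by (intro power_mono) auto
  also have "\<dots> \<le> exp (1 / t)"
    using assms n by (intro exp_ge_one_plus_x_over_n_power_n) (auto intro: order_trans[of _ 0])
  finally have "1 / (t ^ n * real n ^ n) \<le> exp (1 / t)" by (simp add: power_divide power_mult_distrib)
  then have "exp (- 1 / t) \<le> real n ^ n * t ^ n"
    using c by (simp add: exp_minus field_simps)
  then have "exp (- 1 / t) / t ^ m \<le> real n ^ n * t ^ n / t ^ m"
    using assms by (intro divide_right_mono) auto
  also have "\<dots> = real n ^ n * t\<^sup>2" using assms by (simp add: n_def power_add power2_eq_square)
  finally show ?thesis using assms by (simp add: flat_exp_def n_def)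
qed

lemma flat_exp_deriv:
  "(flat_exp m has_real_derivative (flat_exp (m + 2) t - m * flat_exp (m + 1) t)) (at t)"
proof -
  consider "t < 0" | "t = 0" | "t > 0" by linarith
  then show ?thesis
  proof cases
    case 1
    have "(flat_exp m has_real_derivative 0) (at t)"
      by (rule has_field_derivative_transform_within_open[of "\<lambda>_. 0" _ _ "{..<0}"])
         (use 1 in \<open>auto simp: flat_exp_def\<close>)
    then show ?thesis using 1 by (simp add: flat_exp_def)
  next
    case 2
    let ?c = "real (m + 2) ^ (m + 2)"
    have b: "norm (flat_exp m h / h) \<le> ?c * \<bar>h\<bar>" for h
    proof (cases "h > 0")
      case True
      then show ?thesis using flat_exp_le_square[of h m] by (simp add: field_simps power2_eq_square)
    next
      case False
      have "0 \<le> ?c * \<bar>h\<bar>" by (intro mult_nonneg_nonneg) auto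
      then show ?thesis using False by (simp add: flat_exp_def)
    qed
    have "((\<lambda>h. ?c * \<bar>h\<bar>) \<longlongrightarrow> ?c * \<bar>0\<bar>) (at 0)" by (intro tendsto_intros)
    then have "((\<lambda>h. ?c * \<bar>h\<bar>) \<longlongrightarrow> 0) (at 0)" by (simp only: abs_zero mult_zero_right)
    then have "((\<lambda>h. flat_exp m h / h) \<longlongrightarrow> 0) (at 0)"
      by (rule Lim_null_comparison[OF always_eventually[OF allI[OF b]]])
    then show ?thesis using 2 by (simp add: DERIV_def flat_exp_def)
  next
    case 3
    let ?s = "inverse t"
    have "((\<lambda>t. exp (- inverse t) * inverse t ^ m) has_real_derivative
        exp (- ?s) * ?s\<^sup>2 * ?s ^ m + exp (- ?s) * (real m * ?s ^ (m - 1) * (- (?s\<^sup>2)))) (at t)"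
      using 3 by (auto intro!: derivative_eq_intros simp: power2_eq_square)
    moreover have "exp (- ?s) * ?s\<^sup>2 * ?s ^ m + exp (- ?s) * (real m * ?s ^ (m - 1) * (- (?s\<^sup>2)))
        = exp (- ?s) * ?s ^ (m + 2) - m * (exp (- ?s) * ?s ^ (m + 1))"
      by (cases m) (simp_all add: power2_eq_square algebra_simps)
    ultimately have "((\<lambda>t. exp (- inverse t) * inverse t ^ m) has_real_derivative
        exp (- ?s) * ?s ^ (m + 2) - m * (exp (- ?s) * ?s ^ (m + 1))) (at t)"
      by (simp only:)
    then have "((\<lambda>t. exp (- inverse t) * inverse t ^ m) has_real_derivative
        flat_exp (m + 2) t - m * flat_exp (m + 1) t) (at t)"
      using 3 by (simp add: flat_exp_def divide_inverse power_inverse)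
    then show ?thesis
      by (rule has_field_derivative_transform_within_open[of _ _ _ "{0<..}"])
         (use 3 in \<open>auto simp: flat_exp_def divide_inverse power_inverse\<close>)
  qed
qed

text \<open>The induction keeps \<open>m\<close> general because each differentiation raises the
  index. The affine argument covers both flanks of the bump in one coordinate.\<close>

lemma Ck_on_flat_exp: "Ck_on k UNIV (\<lambda>x::real^'n. flat_exp m (c * x $ i + d))"
proof (induction k arbitrary: m)
  case 0
  have "continuous_on UNIV (flat_exp m)"
    using flat_exp_deriv by (meson DERIV_isCont continuous_at_imp_continuous_on)
  then show ?case
    by (auto intro!: continuous_on_compose2[of UNIV "flat_exp m"] continuous_intros)
next
  case (Suc k)
  let ?e = "\<lambda>m x::real^'n. flat_exp m (c * x $ i + d)"
  have D: "(?e m has_derivative (\<lambda>h. (?e (m+2) x - m * ?e (m+1) x) * (c * h $ i))) (at x)" for x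
  proof -
    have "((\<lambda>x::real^'n. c * x $ i + d) has_derivative (\<lambda>h. c * h $ i)) (at x)"
      by (auto intro!: derivative_eq_intros has_derivative_coordinate)
    from has_derivative_compose[OF this, OF flat_exp_deriv[unfolded has_field_derivative_def]]
    show ?thesis by simp
  qed
  have "partial_deriv j (?e m) = (\<lambda>x. (c * axis j 1 $ i) * (?e (m+2) x + (- real m) * ?e (m+1) x))" for j
    by (rule ext, subst partial_derivI[OF D]) (simp add: algebra_simps)
  then have "Ck_on k UNIV (partial_deriv j (?e m))" for j
    using Suc by (simp only:) (intro Ck_on_mult Ck_on_add Ck_on_const)
  then show ?case using D by (auto simp: Ck_on_Suc_UNIV differentiable_def)
qed

text \<open>A product of one-dimensional bumps, positive exactly on the open box. The factor
  \<open>Suc n\<close> stretches the argument of the flat exponential, so the bumps tend to the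
  indicator of the box.\<close>

definition box_bump :: "real^'n \<Rightarrow> real^'n \<Rightarrow> nat \<Rightarrow> real^'n \<Rightarrow> real" where
  "box_bump a b n x = (\<Prod>i\<in>UNIV. flat_exp 0 (real (Suc n) * (x $ i - a $ i)) *
                              flat_exp 0 (real (Suc n) * (b $ i - x $ i)))"

lemma smooth_box_bump: "smooth_on UNIV (box_bump (a::real^'n) b n)"
proof -
  have 1: "(\<lambda>x. flat_exp 0 (real (Suc n) * (x $ i - a $ i))) =
      (\<lambda>x::real^'n. flat_exp 0 (real (Suc n) * x $ i + (- real (Suc n) * a $ i)))"
    and 2: "(\<lambda>x. flat_exp 0 (real (Suc n) * (b $ i - x $ i))) =
      (\<lambda>x::real^'n. flat_exp 0 ((- real (Suc n)) * x $ i + real (Suc n) * b $ i))" for i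
    by (auto simp: algebra_simps)
  show ?thesis
    unfolding smooth_on_def box_bump_def[abs_def]
    by (intro allI Ck_on_prod Ck_on_mult) (simp_all only: 1 2 Ck_on_flat_exp)
qed

lemma flat_exp_0: "0 \<le> flat_exp 0 t" "flat_exp 0 t \<le> 1" "flat_exp 0 t = 0 \<longleftrightarrow> t \<le> 0"
  by (auto simp: flat_exp_def)

lemma box_bump_nonneg: "0 \<le> box_bump a b n x"
  unfolding box_bump_def by (intro prod_nonneg) (auto simp: flat_exp_0)

lemma box_bump_le_1: "box_bump a b n x \<le> 1"
  unfolding box_bump_def by (intro prod_le_1) (auto simp: flat_exp_0 mult_le_one)

lemma box_bump_eq_0_iff: "box_bump a b n x = 0 \<longleftrightarrow> x \<notin> box a b"
  unfolding box_bump_def by (auto simp: flat_exp_0 mem_box_cart mult_le_0_iff not_less)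

lemma box_bump_tendsto: "(\<lambda>n. box_bump a b n (x::real^'n)) \<longlonglongrightarrow> indicator (box a b) x"
proof (cases "x \<in> box a b")
  case True
  have "(\<lambda>n. flat_exp 0 (real (Suc n) * t)) \<longlonglongrightarrow> 1" if "t > 0" for t
  proof -
    have "(\<lambda>n. exp (- (1 / t) * (1 / real (Suc n)))) \<longlonglongrightarrow> exp (- (1 / t) * 0)"
      by (intro tendsto_intros LIMSEQ_Suc lim_1_over_n)
    moreover have "flat_exp 0 (real (Suc n) * t) = exp (- (1 / t) * (1 / real (Suc n)))" for n
    proof -
      have "0 < real (Suc n) * t" using that by simp
      then show ?thesis unfolding flat_exp_def using that by (simp add: field_simps)
    qed
    ultimately show ?thesis by simp
  qed
  then have "(\<lambda>n. box_bump a b n x) \<longlonglongrightarrow> (\<Prod>i\<in>(UNIV::'n set). 1 * 1)"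
    unfolding box_bump_def using True
    by (intro tendsto_prod tendsto_mult) (auto simp: mem_box_cart)
  then show ?thesis using True by simp
next
  case False
  then have "box_bump a b n x = 0" for n by (simp add: box_bump_eq_0_iff)
  then show ?thesis using False by simp
qed

lemma box_bump_test_fun:
  assumes "cbox a b \<subseteq> G" shows "box_bump a b n \<in> test_funs G"
proof -
  have "{x. box_bump a b n x \<noteq> 0} \<subseteq> cbox a b"
    using box_subset_cbox by (auto simp: box_bump_eq_0_iff)
  then have c: "closure {x. box_bump a b n x \<noteq> 0} \<subseteq> cbox a b" by (rule closure_minimal[OF _ closed_cbox])
  moreover have "compact (closure {x. box_bump a b n x \<noteq> 0})"
    using c by (meson bounded_cbox bounded_subset compact_closure closure_subset order_trans)
  ultimately show ?thesis using assms smooth_box_bump by (auto simp: test_funs_def)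
qed

section \<open>The fundamental lemma of the calculus of variations\<close>

lemma sigma_finite_lebesgue: "sigma_finite_measure (lebesgue :: 'a::euclidean_space measure)"
proof
  obtain A :: "'a set set" where A: "countable A" "A \<subseteq> sets lborel" "\<Union>A = space lborel"
      "\<forall>a\<in>A. emeasure lborel a \<noteq> \<infinity>"
    using lborel.sigma_finite_countable by blast
  then show "\<exists>A::'a set set. countable A \<and> A \<subseteq> sets lebesgue \<and> \<Union>A = space lebesgue \<and>
      (\<forall>a\<in>A. emeasure lebesgue a \<noteq> \<infinity>)"
    by (intro exI[of _ A]) (auto simp: emeasure_completion subset_iff)
qed

text \<open>Open boxes are an intersection-stable generator of the Borel sets, so a Dynkin argument
  extends the vanishing of the integrals to all Borel sets; \<open>total\<close> is what handles
  complements.\<close>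

lemma AE_eq_0_of_box_integrals:
  fixes f :: "'a::euclidean_space \<Rightarrow> real"
  assumes f: "integrable lebesgue f" and total: "(LINT x|lebesgue. f x) = 0"
    and box: "\<And>a b. (LINT x:box a b|lebesgue. f x) = 0"
  shows "AE x in lebesgue. f x = 0"
proof (rule sigma_finite_measure.density_zero[OF sigma_finite_lebesgue f])
  have si: "set_integrable lebesgue A f" if "A \<in> sets lebesgue" for A
    unfolding set_integrable_def by (rule integrable_mult_indicator[OF that f])
  have borel0: "(LINT x:A|lebesgue. f x) = 0" if "A \<in> sets borel" for A :: "'a set"
  proof -
    let ?E = "range (\<lambda>(a, b). box a b :: 'a set)"
    have A: "A \<in> sigma_sets UNIV ?E" using that unfolding borel_eq_box by simp
    have stable: "Int_stable ?E" by (auto simp: Int_stable_def box_Int_box)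
    have "?E \<subseteq> Pow UNIV" by simp
    from stable this A show ?thesis
    proof (induction rule: sigma_sets_induct_disjoint)
      case (compl A)
      have "A \<in> sets borel" using compl(1) unfolding borel_eq_box by simp
      then have "(LINT x|lebesgue. indicator A x *\<^sub>R f x + indicator (UNIV - A) x *\<^sub>R f x)
          = (LINT x:A|lebesgue. f x) + (LINT x:UNIV - A|lebesgue. f x)"
        unfolding set_lebesgue_integral_def
        using si[of A] si[of "UNIV - A"] unfolding set_integrable_def
        by (intro Bochner_Integration.integral_add) auto
      moreover have "(\<lambda>x. indicator A x *\<^sub>R f x + indicator (UNIV - A) x *\<^sub>R f x) = f"
        by (auto simp: indicator_def)
      ultimately show ?case using compl total by simp
    next
      case (union A)
      have A: "A i \<in> sets lebesgue" for i
      proof -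
        have "A i \<in> sets borel" using union(2) unfolding borel_eq_box by auto
        then show ?thesis by simp
      qed
      have "(LINT x:(\<Union>i. A i)|lebesgue. f x) = suminf (\<lambda>i. LINT x:(A i)|lebesgue. f x)"
        using union(1) A by (intro lebesgue_integral_countable_add si) (auto simp: disjoint_family_on_def)
      then show ?case using union by simp
    qed (use box in \<open>auto simp: set_lebesgue_integral_def\<close>)
  qed
  \<comment> \<open>A Lebesgue set differs from a Borel set only by a subset of a null set, which
    the integral does not see.\<close>
  fix A :: "'a set" assume "A \<in> sets lebesgue"
  then obtain B N N' where A: "A = B \<union> N" "N \<subseteq> N'" "N' \<in> null_sets lborel" "B \<in> sets lborel"
    by (rule sets_completionE)
  have "AE x in lebesgue. x \<notin> N'" by (intro AE_not_in null_sets_completionI A)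
  then have "AE x in lebesgue. indicator A x *\<^sub>R f x = indicator B x *\<^sub>R f x"
    by eventually_elim (use A in \<open>auto simp: indicator_def\<close>)
  then have "(LINT x:A|lebesgue. f x) = (LINT x:B|lebesgue. f x)"
    unfolding set_lebesgue_integral_def using si[OF \<open>A \<in> sets lebesgue\<close>] si[of B] A(4)
    by (intro integral_cong_AE) (auto simp: set_integrable_def)
  then show "(LINT x:A|lebesgue. f x) = 0" using borel0 A(4) by simp
qed

lemma sqint_indicator_box: "(indicator (box a b) :: real^'n \<Rightarrow> real) \<in> sqint"
proof -
  have "(\<lambda>x. (indicator (box a b) x :: real)\<^sup>2) = indicator (box a b)"
    by (auto simp: indicator_def)
  moreover have "integrable lebesgue (indicator (box a b) :: real^'n \<Rightarrow> real)"
    by (intro integrable_real_indicator) (auto simp: emeasure_lborel_box_eq)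
  ultimately show ?thesis by (simp add: sqint_def)
qed

lemma sqint_continuous_compact_support:
  fixes f :: "real^'n \<Rightarrow> real"
  assumes "continuous_on UNIV f" "compact K" "\<And>x. x \<notin> K \<Longrightarrow> f x = 0"
  shows "f \<in> sqint"
proof -
  have "integrable lebesgue (\<lambda>x. (f x)\<^sup>2)"
    by (rule integrable_continuous_compact_support(2)[OF _ assms(2)])
       (use assms in \<open>auto intro: continuous_on_power\<close>)
  moreover have "f \<in> borel_measurable lebesgue"
    using borel_measurable_continuous_onI[OF assms(1)] by (intro measurable_completion) simp
  ultimately show ?thesis by (simp add: sqint_def)
qed

text \<open>Box bumps serve as test functions. Their limits show that \<open>g\<close> has integral
  zero over every box whose closure lies in \<open>G\<close>, hence vanishes almost everywhere on
  each such box, and countably many closed boxes cover \<open>G\<close>.\<close>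

lemma fundamental_lemma_calculus_of_variations:
  fixes g :: "real^'n \<Rightarrow> real"
  assumes G: "open G" and g: "g \<in> sqint"
    and zero: "\<And>\<phi>. \<phi> \<in> test_funs G \<Longrightarrow> (LINT x|lebesgue. g x * \<phi> x) = 0"
  shows "AE x in lebesgue. x \<in> G \<longrightarrow> g x = 0"
proof -
  have [measurable]: "g \<in> borel_measurable lebesgue" using g by (rule sqint_measurable)
  have gi: "integrable lebesgue (\<lambda>x. g x * indicator (box a b) x)" for a b
    by (rule sqint_mult_integrable[OF g sqint_indicator_box])
  have box0: "(LINT x|lebesgue. g x * indicator (box a b) x) = 0" if "cbox a b \<subseteq> G" for a b
  proof -
    have "(\<lambda>n. LINT x|lebesgue. g x * box_bump a b n x) \<longlonglongrightarrow> (LINT x|lebesgue. g x * indicator (box a b) x)"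
    proof (rule integral_dominated_convergence[where w = "\<lambda>x. \<bar>g x * indicator (box a b) x\<bar>"])
      show "AE x in lebesgue. (\<lambda>n. g x * box_bump a b n x) \<longlonglongrightarrow> g x * indicator (box a b) x"
        by (intro AE_I2 tendsto_mult tendsto_const box_bump_tendsto)
      show "AE x in lebesgue. norm (g x * box_bump a b n x) \<le> \<bar>g x * indicator (box a b) x\<bar>" for n
      proof (intro AE_I2)
        fix x
        show "norm (g x * box_bump a b n x) \<le> \<bar>g x * indicator (box a b) x\<bar>"
        proof (cases "x \<in> box a b")
          case True
          then show ?thesis
            using box_bump_le_1[of a b n x] box_bump_nonneg[of a b n x]
            by (simp add: abs_mult mult_left_le)
        next
          case False
          then have "box_bump a b n x = 0" by (simp add: box_bump_eq_0_iff)
          then show ?thesis by simp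
        qed
      qed
      have "box_bump a b n \<in> borel_measurable borel" for n
        using smooth_box_bump[of a b n] Ck1_continuous[OF smooth_on_imp_Ck1]
        by (intro borel_measurable_continuous_onI) auto
      then have [measurable]: "box_bump a b n \<in> borel_measurable lebesgue" for n
        by (intro measurable_completion) simp
      show "(\<lambda>x. g x * box_bump a b n x) \<in> borel_measurable lebesgue" for n by measurable
    qed (use gi[of a b] in auto)
    moreover have "(LINT x|lebesgue. g x * box_bump a b n x) = 0" for n
      by (rule zero[OF box_bump_test_fun[OF that]])
    ultimately show ?thesis by (simp add: LIMSEQ_const_iff)
  qed
  have ae_box: "AE x in lebesgue. x \<in> cbox a b \<longrightarrow> g x = 0" if "cbox a b \<subseteq> G" for a b
  proof -
    have "AE x in lebesgue. g x * indicator (box a b) x = 0"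
    proof (rule AE_eq_0_of_box_integrals[OF gi box0[OF that]])
      fix c d :: "real^'n"
      \<comment> \<open>Open and closed boxes are intersected with the same corners, so that the
        closed box of the intersection is still inside \<open>G\<close> and \<open>box0\<close>
        applies.\<close>
      obtain a' b' where ab: "box a b \<inter> box c d = box a' b'" "cbox a b \<inter> cbox c d = cbox a' b'"
        using box_Int_box[of a b c d] Int_interval[of a b c d] by blast
      have "(LINT x:box c d|lebesgue. g x * indicator (box a b) x)
          = (LINT x|lebesgue. g x * indicator (box a' b') x)"
        unfolding set_lebesgue_integral_def ab(1)[symmetric] indicator_inter_arith
        by (simp add: mult_ac)
      also have "\<dots> = 0" using ab(2) that by (intro box0) auto
      finally show "(LINT x:box c d|lebesgue. g x * indicator (box a b) x) = 0" .
    qed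
    \<comment> \<open>The faces of a box form a null set, which upgrades the open box to the closed
      one.\<close>
    moreover have "AE x in lebesgue. x \<notin> cbox a b - box a b"
      using negligible_frontier_interval[of a b] by (intro AE_not_in) (simp add: negligible_iff_null_sets)
    ultimately show ?thesis by eventually_elim (auto simp: indicator_def)
  qed
  obtain \<D> where D: "countable \<D>" "\<D> \<subseteq> Pow G" "\<And>X. X \<in> \<D> \<Longrightarrow> \<exists>a b. X = cbox a b" "\<Union>\<D> = G"
    using open_countable_Union_open_cbox[OF G] by blast
  have "AE x in lebesgue. x \<in> X \<longrightarrow> g x = 0" if X: "X \<in> \<D>" for X
  proof -
    obtain a b where "X = cbox a b" using D(3) X by blast
    then show ?thesis using ae_box[of a b] D(2) X by auto
  qed
  then have "AE x in lebesgue. \<forall>X\<in>\<D>. x \<in> X \<longrightarrow> g x = 0"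
    using AE_ball_countable[OF D(1), where M = lebesgue and P = "\<lambda>x X. x \<in> X \<longrightarrow> g x = 0"] by blast
  then show ?thesis by eventually_elim (use D(4) in blast)
qed

section \<open>Sobolev spaces as subspaces of a Hilbert space\<close>

text \<open>Extension by zero places the square-integrable functions on every \<open>G\<close> in
  one Hilbert space type; the values of \<open>u\<close> outside \<open>G\<close> drop out.\<close>

definition l2_class :: "(real^'n) set \<Rightarrow> (real^'n \<Rightarrow> real) \<Rightarrow> (real^'n) l2" where
  "l2_class G u = abs_l2 (\<lambda>x. indicator G x * u x)"

text \<open>The \<open>H\<^sup>1\<close>-norm is the norm of this tuple in \<open>L\<^sub>2 \<times> (L\<^sub>2)\<^sup>n\<close>.\<close>

definition jet :: "(real^'n) set \<Rightarrow> (real^'n \<Rightarrow> real) \<Rightarrow> (real^'n) l2 \<times> (((real^'n) l2)^'n)" where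
  "jet G u = (l2_class G u, \<chi> i. l2_class G (weak_partial G i u))"

text \<open>Defined as a closure on the Hilbert space side, so that it is closed by construction.
  That it is exactly the set of jets of \<open>H10 G\<close> is proved in
  \<open>jet_image_H10\<close>.\<close>

definition H10_jets :: "(real^'n) set \<Rightarrow> ((real^'n) l2 \<times> (((real^'n) l2)^'n)) set" where
  "H10_jets G = closure (jet G ` test_funs G)"

lemma subspace_closure:
  fixes S :: "'a::real_normed_vector set"
  assumes "subspace S" shows "subspace (closure S)"
proof (rule subspaceI)
  show "0 \<in> closure S" using assms closure_subset subspace_0 by blast
next
  fix x y assume "x \<in> closure S" "y \<in> closure S"
  then obtain f g where "\<And>n::nat. f n \<in> S" "f \<longlonglongrightarrow> x" "\<And>n::nat. g n \<in> S" "g \<longlonglongrightarrow> y"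
    by (auto simp: closure_sequential)
  then have "(\<lambda>n. f n + g n) \<longlonglongrightarrow> x + y" "\<And>n. f n + g n \<in> S"
    using assms by (auto intro: tendsto_add subspace_add)
  then show "x + y \<in> closure S" unfolding closure_sequential by (intro exI[of _ "\<lambda>n. f n + g n"]) auto
next
  fix x c assume "x \<in> closure S"
  then obtain f where "\<And>n::nat. f n \<in> S" "f \<longlonglongrightarrow> x" by (auto simp: closure_sequential)
  then have "(\<lambda>n. c *\<^sub>R f n) \<longlonglongrightarrow> c *\<^sub>R x" "\<And>n. c *\<^sub>R f n \<in> S"
    using assms by (auto intro: tendsto_scaleR subspace_scale)
  then show "c *\<^sub>R x \<in> closure S" unfolding closure_sequential by (intro exI[of _ "\<lambda>n. c *\<^sub>R f n"]) auto
qed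

locale bounded_open =
  fixes G :: "(real^'n) set"
  assumes open_G: "open G" and bounded_G: "bounded G"
begin

lemma G_sets: "G \<in> sets lebesgue" "G \<inter> space lebesgue \<in> sets lebesgue"
  using open_G by auto

lemma indicator_sq: "(indicator G x * (c::real))\<^sup>2 = indicator G x * c\<^sup>2"
  by (simp add: indicator_def)

lemma L2_iff: "u \<in> L2 G \<longleftrightarrow> (\<lambda>x. indicator G x * u x) \<in> sqint"
  unfolding L2_def sqint_def mem_Collect_eq
    borel_measurable_restrict_space_iff[OF G_sets(2)] integrable_restrict_space[OF G_sets(2)]
  by (simp add: indicator_sq)

lemma L2_inner_eq: "u \<in> L2 G \<Longrightarrow> v \<in> L2 G \<Longrightarrow> L2_inner G u v = inner (l2_class G u) (l2_class G v)"
  unfolding L2_inner_def l2_class_def L2_iff integral_restrict_space[OF G_sets(2)]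
  by (subst inner_abs_l2) (auto simp: indicator_def intro!: Bochner_Integration.integral_cong)

lemma L2_norm_eq: "u \<in> L2 G \<Longrightarrow> L2_norm G u = norm (l2_class G u)"
  by (simp add: L2_norm_def L2_inner_eq norm_eq_sqrt_inner)

lemma L2_add: "u \<in> L2 G \<Longrightarrow> v \<in> L2 G \<Longrightarrow> (\<lambda>x. u x + v x) \<in> L2 G"
  using sqint_add by (force simp: L2_iff distrib_left)

lemma L2_diff: "u \<in> L2 G \<Longrightarrow> v \<in> L2 G \<Longrightarrow> (\<lambda>x. u x - v x) \<in> L2 G"
  using sqint_diff by (force simp: L2_iff right_diff_distrib)

lemma L2_scale: "u \<in> L2 G \<Longrightarrow> (\<lambda>x. c * u x) \<in> L2 G"
  using sqint_scale[of "\<lambda>x. indicator G x * u x" c] by (simp add: L2_iff mult_ac)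

lemma l2_class_add: "u \<in> L2 G \<Longrightarrow> v \<in> L2 G \<Longrightarrow> l2_class G (\<lambda>x. u x + v x) = l2_class G u + l2_class G v"
  unfolding l2_class_def L2_iff by (simp add: abs_l2_add[symmetric] distrib_left)

lemma l2_class_diff: "u \<in> L2 G \<Longrightarrow> v \<in> L2 G \<Longrightarrow> l2_class G (\<lambda>x. u x - v x) = l2_class G u - l2_class G v"
  unfolding l2_class_def L2_iff by (simp add: abs_l2_diff[symmetric] right_diff_distrib)

lemma l2_class_scale: "u \<in> L2 G \<Longrightarrow> l2_class G (\<lambda>x. c * u x) = c *\<^sub>R l2_class G u"
  unfolding l2_class_def L2_iff by (simp add: abs_l2_scale[symmetric] mult_ac)

lemma l2_class_eq_iff: "u \<in> L2 G \<Longrightarrow> v \<in> L2 G \<Longrightarrow> l2_class G u = l2_class G v \<longleftrightarrow> ae_eq G u v"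
  unfolding l2_class_def L2_iff ae_eq_def AE_restrict_space_iff[OF G_sets(2)]
  by (subst abs_l2_eq_iff) (auto simp: indicator_def intro!: AE_cong)

text \<open>Multiplication by the indicator is the projection onto the classes that vanish outside
  \<open>G\<close>. Its continuity lets this support condition pass to limits.\<close>

lemma bounded_linear_restrict: "bounded_linear (mult_l2 (indicator G :: real^'n \<Rightarrow> real))"
  by (rule bounded_linear_mult_l2[where c = 1]) (use G_sets in \<open>auto simp: indicator_def\<close>)

lemma restrict_l2_class:
  assumes "u \<in> L2 G" shows "mult_l2 (indicator G) (l2_class G u) = l2_class G u"
  using assms unfolding l2_class_def L2_iff
  by (subst mult_l2_abs[where c = 1]) (use G_sets in \<open>auto simp: indicator_def intro!: arg_cong[where f = abs_l2]\<close>)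

lemma rep_l2_L2: "rep_l2 x \<in> L2 G"
  unfolding L2_iff
  by (rule sqint_bounded_mult[where c = 1]) (use G_sets rep_l2_sqint in \<open>auto simp: indicator_def\<close>)

lemma l2_class_rep_l2: "l2_class G (rep_l2 x) = mult_l2 (indicator G) x"
  by (simp add: l2_class_def mult_l2_def)

section \<open>Test functions\<close>

lemma test_fun_support:
  assumes "\<phi> \<in> test_funs G"
  obtains K where "compact K" "K \<subseteq> G" "\<And>x. x \<notin> K \<Longrightarrow> \<phi> x = 0" "\<And>x i. x \<notin> K \<Longrightarrow> partial_deriv i \<phi> x = 0"
proof
  let ?K = "closure {x. \<phi> x \<noteq> 0}"
  show "compact ?K" "?K \<subseteq> G" using assms by (auto simp: test_funs_def)
  show 0: "\<phi> x = 0" if "x \<notin> ?K" for x using that closure_subset[of "{x. \<phi> x \<noteq> 0}"] by auto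
  show "partial_deriv i \<phi> x = 0" if "x \<notin> ?K" for x i
    by (rule partial_deriv_eq_0_outside_closed[OF closed_closure 0 that])
qed

lemma test_fun_Ck1: "\<phi> \<in> test_funs G \<Longrightarrow> Ck_on (Suc 0) UNIV \<phi>"
  by (auto simp: test_funs_def intro: smooth_on_imp_Ck1)

lemma test_fun_sqint:
  assumes "\<phi> \<in> test_funs G" shows "\<phi> \<in> sqint" "partial_deriv i \<phi> \<in> sqint"
proof -
  obtain K where K: "compact K" "\<And>x. x \<notin> K \<Longrightarrow> \<phi> x = 0" "\<And>x i. x \<notin> K \<Longrightarrow> partial_deriv i \<phi> x = 0"
    using test_fun_support[OF assms] by metis
  show "\<phi> \<in> sqint" "partial_deriv i \<phi> \<in> sqint"
    using sqint_continuous_compact_support[OF Ck1_continuous[OF test_fun_Ck1[OF assms]] K(1,2)]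
      sqint_continuous_compact_support[OF Ck1_partial_continuous[OF test_fun_Ck1[OF assms]] K(1,3)] by auto
qed

lemma test_fun_indicator:
  assumes "\<phi> \<in> test_funs G"
  shows "indicator G x * \<phi> x = \<phi> x" "indicator G x * partial_deriv i \<phi> x = partial_deriv i \<phi> x"
proof -
  obtain K where K: "K \<subseteq> G" "\<And>x. x \<notin> K \<Longrightarrow> \<phi> x = 0" "\<And>x i. x \<notin> K \<Longrightarrow> partial_deriv i \<phi> x = 0"
    using test_fun_support[OF assms] by metis
  then show "indicator G x * \<phi> x = \<phi> x" "indicator G x * partial_deriv i \<phi> x = partial_deriv i \<phi> x"
    by (cases "x \<in> G"; force)+
qed

lemma test_fun_L2:
  assumes "\<phi> \<in> test_funs G" shows "\<phi> \<in> L2 G" "partial_deriv i \<phi> \<in> L2 G"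
  using test_fun_sqint[OF assms] by (auto simp: L2_iff test_fun_indicator[OF assms])

lemma l2_class_test_fun:
  assumes "\<phi> \<in> test_funs G"
  shows "l2_class G \<phi> = abs_l2 \<phi>" "l2_class G (partial_deriv i \<phi>) = abs_l2 (partial_deriv i \<phi>)"
  by (auto simp: l2_class_def test_fun_indicator[OF assms])

lemma test_funs_add:
  assumes "\<phi> \<in> test_funs G" "\<psi> \<in> test_funs G" shows "(\<lambda>x. \<phi> x + \<psi> x) \<in> test_funs G"
proof -
  have sub: "closure {x. \<phi> x + \<psi> x \<noteq> 0} \<subseteq> closure {x. \<phi> x \<noteq> 0} \<union> closure {x. \<psi> x \<noteq> 0}"
    unfolding closure_Un[symmetric] by (rule closure_mono) auto
  moreover have "compact (closure {x. \<phi> x + \<psi> x \<noteq> 0})"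
    using compact_Int_closed[OF compact_Un closed_closure] sub assms
    by (metis (mono_tags, lifting) inf.absorb2 mem_Collect_eq test_funs_def)
  ultimately show ?thesis using assms by (auto simp: test_funs_def smooth_on_def Ck_on_add)
qed

lemma test_funs_smooth_mult:
  assumes "\<phi> \<in> test_funs G" "smooth_on UNIV \<eta>" shows "(\<lambda>x. \<eta> x * \<phi> x) \<in> test_funs G"
proof -
  have sub: "closure {x. \<eta> x * \<phi> x \<noteq> 0} \<subseteq> closure {x. \<phi> x \<noteq> 0}"
    by (rule closure_mono) auto
  moreover have "compact (closure {x. \<eta> x * \<phi> x \<noteq> 0})"
    using compact_Int_closed[OF _ closed_closure] sub assms
    by (metis (mono_tags, lifting) inf.absorb2 mem_Collect_eq test_funs_def)
  ultimately show ?thesis using assms by (auto simp: test_funs_def smooth_on_def Ck_on_mult)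
qed

lemma test_funs_scale: "\<phi> \<in> test_funs G \<Longrightarrow> (\<lambda>x. c * \<phi> x) \<in> test_funs G"
  by (rule test_funs_smooth_mult) (auto simp: smooth_on_def Ck_on_const)

lemma test_funs_zero: "(\<lambda>x. 0) \<in> test_funs G"
  by (auto simp: test_funs_def smooth_on_def Ck_on_const)

section \<open>Weak derivatives and linearity of the jet\<close>

lemma has_weak_partial_iff:
  assumes "u \<in> L2 G"
  shows "has_weak_partial G i u g \<longleftrightarrow> g \<in> L2 G \<and> (\<forall>\<phi>\<in>test_funs G.
    inner (l2_class G u) (l2_class G (partial_deriv i \<phi>)) = - inner (l2_class G g) (l2_class G \<phi>))"
  unfolding has_weak_partial_def using assms by (auto simp: L2_inner_eq test_fun_L2)

lemma l2_class_eq_0_of_test: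
  assumes g: "g \<in> L2 G" and "\<And>\<phi>. \<phi> \<in> test_funs G \<Longrightarrow> inner (l2_class G g) (l2_class G \<phi>) = 0"
  shows "l2_class G g = 0"
proof -
  let ?g = "\<lambda>x. indicator G x * g x"
  have "AE x in lebesgue. x \<in> G \<longrightarrow> ?g x = 0"
  proof (rule fundamental_lemma_calculus_of_variations[OF open_G])
    show gs: "?g \<in> sqint" using g by (simp add: L2_iff)
    show "(LINT x|lebesgue. ?g x * \<phi> x) = 0" if "\<phi> \<in> test_funs G" for \<phi>
      using assms(2)[OF that] gs test_fun_sqint(1)[OF that]
      unfolding l2_class_test_fun(1)[OF that] unfolding l2_class_def by (simp add: inner_abs_l2)
  qed
  then have "AE x in lebesgue. ?g x = 0" by eventually_elim (auto simp: indicator_def)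
  then show ?thesis
    using g unfolding l2_class_def L2_iff abs_l2_zero[symmetric] by (simp add: abs_l2_eq_iff sqint_zero)
qed

text \<open>Two weak derivatives differ by a function orthogonal to all test functions, so the one
  picked by \<open>SOME\<close> has the same class as any other.\<close>

lemma weak_partial_class:
  assumes u: "u \<in> L2 G" and "has_weak_partial G i u g"
  shows "l2_class G (weak_partial G i u) = l2_class G g" "weak_partial G i u \<in> L2 G"
    "has_weak_partial G i u (weak_partial G i u)"
proof -
  show w: "has_weak_partial G i u (weak_partial G i u)"
    unfolding weak_partial_def by (rule someI[where P = "has_weak_partial G i u", OF assms(2)])
  then show wL: "weak_partial G i u \<in> L2 G" by (simp add: has_weak_partial_def)
  have gL: "g \<in> L2 G" using assms(2) by (simp add: has_weak_partial_def)
  have "l2_class G (\<lambda>x. weak_partial G i u x - g x) = 0"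
    by (rule l2_class_eq_0_of_test[OF L2_diff[OF wL gL]])
       (use w assms gL wL in \<open>simp add: has_weak_partial_iff l2_class_diff inner_diff_left\<close>)
  then show "l2_class G (weak_partial G i u) = l2_class G g" by (simp add: l2_class_diff wL gL)
qed

lemma H1_imp_L2: "u \<in> H1 G \<Longrightarrow> u \<in> L2 G" "u \<in> H1 G \<Longrightarrow> weak_partial G i u \<in> L2 G"
  "u \<in> H1 G \<Longrightarrow> has_weak_partial G i u (weak_partial G i u)"
  unfolding H1_def using weak_partial_class by blast+

text \<open>Any family of weak derivatives determines the jet. For sums and multiples it is then
  enough to name the obvious candidates.\<close>

lemma jet_eqI:
  assumes u: "u \<in> L2 G" and g: "\<And>i. has_weak_partial G i u (g i)"
  shows "u \<in> H1 G" "jet G u = (l2_class G u, \<chi> i. l2_class G (g i))"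
  using assms weak_partial_class(1)[OF u g] by (auto simp: H1_def jet_def)

lemma jet_add:
  assumes "u \<in> H1 G" "v \<in> H1 G"
  shows "(\<lambda>x. u x + v x) \<in> H1 G" "jet G (\<lambda>x. u x + v x) = jet G u + jet G v"
proof -
  have "has_weak_partial G i (\<lambda>x. u x + v x) (\<lambda>x. weak_partial G i u x + weak_partial G i v x)" for i
    using assms H1_imp_L2(3)[OF assms(1)] H1_imp_L2(3)[OF assms(2)]
    by (simp add: has_weak_partial_iff H1_imp_L2 L2_add l2_class_add inner_add_left)
  note * = jet_eqI[OF L2_add[OF H1_imp_L2(1)[OF assms(1)] H1_imp_L2(1)[OF assms(2)]] this]
  show "(\<lambda>x. u x + v x) \<in> H1 G" by (rule *)
  show "jet G (\<lambda>x. u x + v x) = jet G u + jet G v"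
    unfolding *(2) using assms by (simp add: jet_def l2_class_add H1_imp_L2 vec_eq_iff)
qed

lemma jet_scale:
  assumes "u \<in> H1 G"
  shows "(\<lambda>x. c * u x) \<in> H1 G" "jet G (\<lambda>x. c * u x) = c *\<^sub>R jet G u"
proof -
  have "has_weak_partial G i (\<lambda>x. c * u x) (\<lambda>x. c * weak_partial G i u x)" for i
    using assms H1_imp_L2(3)[OF assms]
    by (simp add: has_weak_partial_iff H1_imp_L2 L2_scale l2_class_scale)
  note * = jet_eqI[OF L2_scale[OF H1_imp_L2(1)[OF assms]] this]
  show "(\<lambda>x. c * u x) \<in> H1 G" by (rule *)
  show "jet G (\<lambda>x. c * u x) = c *\<^sub>R jet G u"
    unfolding *(2) using assms by (simp add: jet_def l2_class_scale H1_imp_L2 vec_eq_iff)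
qed

lemma jet_diff:
  assumes "u \<in> H1 G" "v \<in> H1 G"
  shows "(\<lambda>x. u x - v x) \<in> H1 G" "jet G (\<lambda>x. u x - v x) = jet G u - jet G v"
  using jet_add[OF assms(1) jet_scale(1)[OF assms(2), of "-1"]] jet_scale(2)[OF assms(2), of "-1"]
  by simp_all

lemma H1_norm_eq:
  assumes "u \<in> H1 G" shows "H1_norm G u = norm (jet G u)"
  unfolding H1_norm_def jet_def norm_Pair norm_vec_def L2_set_def
  using assms by (simp add: L2_norm_eq H1_imp_L2 sum_nonneg)

text \<open>Integration by parts makes the classical derivatives of a test function weak
  ones.\<close>

lemma test_fun_H1:
  assumes "\<phi> \<in> test_funs G"
  shows "\<phi> \<in> H1 G" "jet G \<phi> = (l2_class G \<phi>, \<chi> i. l2_class G (partial_deriv i \<phi>))"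
proof -
  have "has_weak_partial G i \<phi> (partial_deriv i \<phi>)" for i
  proof -
    have "inner (l2_class G \<phi>) (l2_class G (partial_deriv i \<psi>))
        = - inner (l2_class G (partial_deriv i \<phi>)) (l2_class G \<psi>)" if "\<psi> \<in> test_funs G" for \<psi>
    proof -
      obtain K where K: "compact K" "\<And>x. x \<notin> K \<Longrightarrow> \<phi> x = 0"
        using test_fun_support[OF assms] by metis
      show ?thesis
        unfolding l2_class_test_fun[OF assms] l2_class_test_fun[OF that]
        using test_fun_sqint[OF assms] test_fun_sqint[OF that]
          integration_by_parts[OF test_fun_Ck1[OF assms] test_fun_Ck1[OF that] K, of i]
        by (simp add: inner_abs_l2)
    qed
    then show ?thesis by (simp add: has_weak_partial_iff test_fun_L2 assms)
  qed
  from jet_eqI[OF test_fun_L2(1)[OF assms] this]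
  show "\<phi> \<in> H1 G" "jet G \<phi> = (l2_class G \<phi>, \<chi> i. l2_class G (partial_deriv i \<phi>))" .
qed

section \<open>The closed subspace of jets\<close>

lemma closed_H10_jets: "closed (H10_jets G)"
  by (simp add: H10_jets_def)

lemma subspace_H10_jets: "subspace (H10_jets G)"
  unfolding H10_jets_def
proof (rule subspace_closure, rule subspaceI)
  show "0 \<in> jet G ` test_funs G"
  proof (rule image_eqI[OF _ test_funs_zero])
    show "0 = jet G (\<lambda>x. 0)" using jet_scale(2)[OF test_fun_H1(1)[OF test_funs_zero], of 0] by simp
  qed
  show "x + y \<in> jet G ` test_funs G" if "x \<in> jet G ` test_funs G" "y \<in> jet G ` test_funs G" for x y
    using that test_funs_add jet_add(2) test_fun_H1(1) by (smt (verit) imageE image_eqI)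
  show "c *\<^sub>R x \<in> jet G ` test_funs G" if "x \<in> jet G ` test_funs G" for c x
    using that test_funs_scale jet_scale(2) test_fun_H1(1) by (smt (verit) imageE image_eqI)
qed

lemma H10_imp_jet:
  assumes "u \<in> H10 G" shows "u \<in> H1 G" "jet G u \<in> H10_jets G"
    and "\<exists>\<phi>. (\<forall>m. \<phi> m \<in> test_funs G) \<and> (\<lambda>m::nat. jet G (\<phi> m)) \<longlonglongrightarrow> jet G u"
proof -
  show u: "u \<in> H1 G" using assms by (simp add: H10_def)
  obtain \<phi> where \<phi>: "\<And>m. \<phi> m \<in> test_funs G" "(\<lambda>m::nat. H1_norm G (\<lambda>x. u x - \<phi> m x)) \<longlonglongrightarrow> 0"
    using assms by (auto simp: H10_def)
  have "H1_norm G (\<lambda>x. u x - \<phi> m x) = norm (jet G (\<phi> m) - jet G u)" for m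
    using u test_fun_H1(1)[OF \<phi>(1)] by (simp add: H1_norm_eq jet_diff norm_minus_commute)
  with \<phi>(2) have "(\<lambda>m. norm (jet G (\<phi> m) - jet G u)) \<longlonglongrightarrow> 0" by simp
  then have lim: "(\<lambda>m. jet G (\<phi> m)) \<longlonglongrightarrow> jet G u"
    by (rule LIM_zero_cancel[OF tendsto_norm_zero_cancel])
  then show "\<exists>\<phi>. (\<forall>m. \<phi> m \<in> test_funs G) \<and> (\<lambda>m::nat. jet G (\<phi> m)) \<longlonglongrightarrow> jet G u"
    using \<phi>(1) by (intro exI[of _ \<phi>]) simp
  show "jet G u \<in> H10_jets G"
    unfolding H10_jets_def closure_sequential using lim \<phi>(1)
    by (intro exI[of _ "\<lambda>m. jet G (\<phi> m)"]) simp
qed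

text \<open>Invariance under restriction to \<open>G\<close> is a closed condition that holds for
  jets of test functions. It guarantees that a representative of a component of \<open>p\<close>,
  viewed as a function on \<open>G\<close>, has that component as its class.\<close>

lemma H10_jets_restrict:
  assumes "p \<in> H10_jets G"
  shows "mult_l2 (indicator G) (fst p) = fst p" "mult_l2 (indicator G) (snd p $ i) = snd p $ i"
proof -
  interpret bounded_linear "mult_l2 (indicator G :: real^'n \<Rightarrow> real)" by (rule bounded_linear_restrict)
  let ?C = "{p. mult_l2 (indicator G) (fst p) = fst p \<and> mult_l2 (indicator G) (snd p $ i) = snd p $ i}"
  have "closed ?C"
    by (intro closed_Collect_conj closed_Collect_eq continuous_intros continuous_on)
  moreover have "jet G ` test_funs G \<subseteq> ?C"
    by (auto simp: test_fun_H1 restrict_l2_class test_fun_L2)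
  ultimately have "H10_jets G \<subseteq> ?C" unfolding H10_jets_def by (rule closure_minimal[rotated])
  then show "mult_l2 (indicator G) (fst p) = fst p" "mult_l2 (indicator G) (snd p $ i) = snd p $ i"
    using assms by auto
qed

text \<open>The criterion for membership in \<open>H10 G\<close>: only the L2 class of
  \<open>u\<close> has to be compared. Passing to the limit in the integration by parts formula
  shows that the gradient part of \<open>p\<close> consists of weak derivatives of \<open>u\<close>,
  and the test functions whose jets tend to \<open>p\<close> then approximate \<open>u\<close> in
  the H1 norm.\<close>

lemma H10I:
  assumes u: "u \<in> L2 G" and p: "p \<in> H10_jets G" and up: "l2_class G u = fst p"
  shows "u \<in> H10 G" "jet G u = p"
proof -
  obtain q where q: "\<And>m::nat. q m \<in> jet G ` test_funs G" "q \<longlonglongrightarrow> p"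
    using p unfolding H10_jets_def closure_sequential by blast
  then have "\<forall>m. \<exists>\<phi>. \<phi> \<in> test_funs G \<and> q m = jet G \<phi>" by blast
  then obtain \<phi> where \<phi>: "\<And>m. \<phi> m \<in> test_funs G" "\<And>m. q m = jet G (\<phi> m)" by metis
  have lim1: "(\<lambda>m. l2_class G (\<phi> m)) \<longlonglongrightarrow> fst p"
    using tendsto_fst[OF q(2)] by (simp add: \<phi> test_fun_H1)
  have lim2: "(\<lambda>m. l2_class G (partial_deriv i (\<phi> m))) \<longlonglongrightarrow> snd p $ i" for i
    using tendsto_vec_nth[OF tendsto_snd[OF q(2)], of i] by (simp add: \<phi> test_fun_H1)
  have cls: "l2_class G (rep_l2 (snd p $ i)) = snd p $ i" for i
    by (simp add: l2_class_rep_l2 H10_jets_restrict[OF p])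
  have "has_weak_partial G i u (rep_l2 (snd p $ i))" for i
    unfolding has_weak_partial_iff[OF u] cls up
  proof (intro conjI ballI rep_l2_L2)
    fix \<psi> assume \<psi>: "\<psi> \<in> test_funs G"
    \<comment> \<open>The classical derivative and the weak derivative picked by \<open>SOME\<close>
      have the same class, so the former inherits the defining identity.\<close>
    have "has_weak_partial G i (\<phi> m) (partial_deriv i (\<phi> m))" for m
    proof -
      have "l2_class G (weak_partial G i (\<phi> m)) = l2_class G (partial_deriv i (\<phi> m))"
        using test_fun_H1(2)[OF \<phi>(1)[of m]] by (auto simp: jet_def vec_eq_iff)
      then show ?thesis using H1_imp_L2(3)[OF test_fun_H1(1)[OF \<phi>(1)[of m]], of i]
        by (simp add: has_weak_partial_iff test_fun_L2 \<phi>)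
    qed
    then have "inner (l2_class G (\<phi> m)) (l2_class G (partial_deriv i \<psi>))
        = - inner (l2_class G (partial_deriv i (\<phi> m))) (l2_class G \<psi>)" for m
      using \<psi> by (simp add: has_weak_partial_iff test_fun_L2 \<phi>)
    moreover have "(\<lambda>m. inner (l2_class G (\<phi> m)) (l2_class G (partial_deriv i \<psi>)))
        \<longlonglongrightarrow> inner (fst p) (l2_class G (partial_deriv i \<psi>))" by (intro tendsto_intros lim1)
    moreover have "(\<lambda>m. - inner (l2_class G (partial_deriv i (\<phi> m))) (l2_class G \<psi>))
        \<longlonglongrightarrow> - inner (snd p $ i) (l2_class G \<psi>)" by (intro tendsto_intros lim2)
    ultimately show "inner (fst p) (l2_class G (partial_deriv i \<psi>)) = - inner (snd p $ i) (l2_class G \<psi>)"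
      using LIMSEQ_unique by fastforce
  qed
  from jet_eqI[OF u this] have u1: "u \<in> H1 G" and "jet G u = (fst p, \<chi> i. snd p $ i)"
    by (auto simp: cls up)
  then show j: "jet G u = p" by (simp add: vec_lambda_eta)
  have "H1_norm G (\<lambda>x. u x - \<phi> m x) = norm (q m - p)" for m
    using u1 test_fun_H1(1)[OF \<phi>(1)] by (simp add: H1_norm_eq jet_diff norm_minus_commute \<phi> j)
  moreover have "(\<lambda>m. norm (q m - p)) \<longlonglongrightarrow> 0" using q(2) by (simp add: LIM_zero tendsto_norm_zero)
  ultimately show "u \<in> H10 G" using u1 \<phi>(1) by (auto simp: H10_def intro!: exI[of _ \<phi>])
qed

lemma jet_image_H10: "jet G ` H10 G = H10_jets G"
proof
  show "jet G ` H10 G \<subseteq> H10_jets G" using H10_imp_jet by blast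
  show "H10_jets G \<subseteq> jet G ` H10 G"
  proof
    fix p assume p: "p \<in> H10_jets G"
    have "l2_class G (rep_l2 (fst p)) = fst p" by (simp add: l2_class_rep_l2 H10_jets_restrict[OF p])
    from H10I[OF rep_l2_L2 p this] show "p \<in> jet G ` H10 G" by (metis image_eqI)
  qed
qed

lemma H10_norm_eq: "u \<in> H10 G \<Longrightarrow> H1_norm G u = norm (jet G u)"
  using H10_imp_jet(1) H1_norm_eq by blast

lemma H10_L2: "u \<in> H10 G \<Longrightarrow> u \<in> L2 G"
  using H10_imp_jet(1) H1_imp_L2(1) by blast

lemma H10_add:
  assumes "u \<in> H10 G" "v \<in> H10 G"
  shows "(\<lambda>x. u x + v x) \<in> H10 G" "jet G (\<lambda>x. u x + v x) = jet G u + jet G v"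
proof -
  show j: "jet G (\<lambda>x. u x + v x) = jet G u + jet G v"
    using assms H10_imp_jet(1) jet_add(2) by blast
  show "(\<lambda>x. u x + v x) \<in> H10 G"
    by (rule H10I(1)[OF L2_add[OF H10_L2[OF assms(1)] H10_L2[OF assms(2)]], of "jet G u + jet G v"])
       (use assms H10_imp_jet(2) subspace_add[OF subspace_H10_jets] H10_L2 in \<open>auto simp: jet_def l2_class_add\<close>)
qed

lemma H10_scale:
  assumes "u \<in> H10 G"
  shows "(\<lambda>x. c * u x) \<in> H10 G" "jet G (\<lambda>x. c * u x) = c *\<^sub>R jet G u"
proof -
  show j: "jet G (\<lambda>x. c * u x) = c *\<^sub>R jet G u"
    using assms H10_imp_jet(1) jet_scale(2) by blast
  show "(\<lambda>x. c * u x) \<in> H10 G"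
    by (rule H10I(1)[OF L2_scale[OF H10_L2[OF assms(1)]], of "c *\<^sub>R jet G u"])
       (use assms H10_imp_jet(2) subspace_scale[OF subspace_H10_jets] H10_L2 in \<open>auto simp: jet_def l2_class_scale\<close>)
qed

lemma H10_zero: "(\<lambda>x. 0) \<in> H10 G" "jet G (\<lambda>x. 0) = 0"
  using H10I[OF test_fun_L2(1)[OF test_funs_zero] subspace_0[OF subspace_H10_jets]]
    l2_class_scale[OF test_fun_L2(1)[OF test_funs_zero], of 0] by auto

text \<open>Functions equal almost everywhere have the same L2 class, and \<open>H10I\<close>
  recovers the whole jet from that class.\<close>

lemma H10_jet_eq_iff:
  assumes "u \<in> H10 G" "v \<in> H10 G" shows "jet G u = jet G v \<longleftrightarrow> ae_eq G u v"
proof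
  assume "jet G u = jet G v"
  then show "ae_eq G u v" using assms H10_L2 l2_class_eq_iff by (auto simp: jet_def)
next
  assume "ae_eq G u v"
  then have "l2_class G u = fst (jet G v)" using assms H10_L2 l2_class_eq_iff by (auto simp: jet_def)
  then show "jet G u = jet G v" using H10I(2) H10_L2 H10_imp_jet(2) assms by blast
qed

text \<open>The inequality defines a closed set of pairs, so it passes from test functions to the
  closure.\<close>

lemma H10_Poincare:
  obtains c where "c \<ge> 0" "\<And>p. p \<in> H10_jets G \<Longrightarrow> (norm (fst p))\<^sup>2 \<le> c * (norm (snd p))\<^sup>2"
proof -
  obtain R where R: "\<And>x. x \<in> G \<Longrightarrow> norm x \<le> R" using bounded_G by (auto simp: bounded_iff)
  let ?C = "{p :: (real^'n) l2 \<times> (((real^'n) l2)^'n). (norm (fst p))\<^sup>2 \<le> 4 * R\<^sup>2 * (norm (snd p))\<^sup>2}"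
  have "closed ?C" by (intro closed_Collect_le continuous_intros)
  moreover have "jet G \<phi> \<in> ?C" if \<phi>: "\<phi> \<in> test_funs G" for \<phi>
  proof -
    obtain K where K: "compact K" "K \<subseteq> G" "\<And>x. x \<notin> K \<Longrightarrow> \<phi> x = 0"
      using test_fun_support[OF \<phi>] by metis
    \<comment> \<open>A single direction suffices, since one partial derivative is bounded by the
      full gradient.\<close>
    fix i :: 'n
    have "(LINT x|lebesgue. (\<phi> x)\<^sup>2) \<le> 4 * R\<^sup>2 * (LINT x|lebesgue. (partial_deriv i \<phi> x)\<^sup>2)"
      by (rule Poincare_inequality[OF test_fun_Ck1[OF \<phi>] K(1,3)]) (use R K in auto)
    then have "(norm (fst (jet G \<phi>)))\<^sup>2 \<le> 4 * R\<^sup>2 * (norm (snd (jet G \<phi>) $ i))\<^sup>2"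
      by (simp add: test_fun_H1 \<phi> l2_class_test_fun norm_abs_l2 test_fun_sqint integral_nonneg_AE)
    also have "\<dots> \<le> 4 * R\<^sup>2 * (norm (snd (jet G \<phi>)))\<^sup>2"
      by (intro mult_left_mono power_mono Finite_Cartesian_Product.norm_nth_le) auto
    finally show ?thesis by simp
  qed
  ultimately have "H10_jets G \<subseteq> ?C" unfolding H10_jets_def by (intro closure_minimal) auto
  then show ?thesis by (intro that[of "4 * R\<^sup>2"]) auto
qed

end

section \<open>Multiplication by Lipschitz functions\<close>

text \<open>McShane's formula: \<open>g\<close> is the infimum of the cones of slope
  \<open>L\<close> above the values of \<open>f\<close> on \<open>S\<close>, and keeps the constant
  \<open>L\<close>.\<close>

lemma Lipschitz_extension:
  fixes f :: "'a::metric_space \<Rightarrow> real"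
  assumes f: "L-lipschitz_on S f" and "S \<noteq> {}"
  shows "\<exists>g. L-lipschitz_on UNIV g \<and> (\<forall>x\<in>S. g x = f x)"
proof -
  have L: "0 \<le> L" using f by (rule lipschitz_on_nonneg)
  have lip: "\<bar>f x - f y\<bar> \<le> L * dist x y" if "x \<in> S" "y \<in> S" for x y
    using lipschitz_onD[OF f that] by (simp add: dist_real_def)
  define g where "g x = (INF y\<in>S. f y + L * dist x y)" for x
  have bdd: "bdd_below ((\<lambda>y. f y + L * dist x y) ` S)" for x
  proof -
    obtain y0 where y0: "y0 \<in> S" using \<open>S \<noteq> {}\<close> by blast
    have "f y0 - L * dist x y0 \<le> f y + L * dist x y" if "y \<in> S" for y
    proof -
      have "L * dist y0 y \<le> L * (dist x y0 + dist x y)"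
        using L by (intro mult_left_mono) (auto simp: dist_triangle3)
      then show ?thesis using lip[OF y0 that] by (simp add: distrib_left)
    qed
    then show ?thesis by (intro bdd_belowI[of _ "f y0 - L * dist x y0"]) auto
  qed
  have ge: "g x \<le> g y + L * dist x y" for x y
  proof -
    have "g x - L * dist x y \<le> g y"
      unfolding g_def[of y]
    proof (rule cINF_greatest[OF \<open>S \<noteq> {}\<close>])
      fix z assume z: "z \<in> S"
      have "g x \<le> f z + L * dist x z" unfolding g_def by (rule cINF_lower[OF bdd z])
      also have "L * dist x z \<le> L * (dist x y + dist y z)"
        using L by (intro mult_left_mono) (auto simp: dist_triangle)
      finally show "g x - L * dist x y \<le> f z + L * dist y z" by (simp add: distrib_left)
    qed
    then show ?thesis by simp
  qed
  have "L-lipschitz_on UNIV g"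
  proof (rule lipschitz_onI[OF _ L])
    show "dist (g x) (g y) \<le> L * dist x y" for x y
      using ge[of x y] ge[of y x] by (simp add: dist_real_def dist_commute abs_le_iff)
  qed
  moreover have "g x = f x" if "x \<in> S" for x
  proof (rule antisym)
    show "g x \<le> f x" unfolding g_def using cINF_lower[OF bdd that, of x] by simp
    show "f x \<le> g x" unfolding g_def
      by (rule cINF_greatest[OF \<open>S \<noteq> {}\<close>]) (use lip[OF that] in force)
  qed
  ultimately show ?thesis by blast
qed

lemma has_derivative_partial_deriv:
  fixes f :: "real^'n \<Rightarrow> real"
  assumes "f differentiable (at x)"
  shows "(f has_derivative (\<lambda>h. \<Sum>i\<in>UNIV. partial_deriv i f x * h $ i)) (at x)"
proof -
  let ?D = "frechet_derivative f (at x)"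
  have D: "(f has_derivative ?D) (at x)" using assms by (simp add: frechet_derivative_works)
  have lin: "linear ?D" by (rule has_derivative_linear[OF D])
  have "?D h = (\<Sum>i\<in>UNIV. partial_deriv i f x * h $ i)" for h
  proof -
    have "?D h = ?D (\<Sum>i\<in>UNIV. h $ i *\<^sub>R axis i 1)"
      using basis_expansion[of h] by (simp add: scalar_mult_eq_scaleR)
    also have "\<dots> = (\<Sum>i\<in>UNIV. partial_deriv i f x * h $ i)"
      using lin by (simp add: linear_sum linear_scale partial_deriv_def mult.commute)
    finally show ?thesis .
  qed
  then have "?D = (\<lambda>h. \<Sum>i\<in>UNIV. partial_deriv i f x * h $ i)" by blast
  then show ?thesis using D by simp
qed

text \<open>Differentiation under the integral sign. The derivative falls on the smooth kernel
  \<open>k\<close> alone, so continuity of \<open>\<zeta>\<close> is enough.\<close>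

lemma convolution_partial_deriv:
  fixes k \<zeta> :: "real^'n \<Rightarrow> real" and a b :: "real^'n"
  assumes \<zeta>: "continuous_on UNIV \<zeta>" and k: "smooth_on UNIV k"
  defines "F \<equiv> \<lambda>k x. integral (cbox a b) (\<lambda>z. \<zeta> z * k (x - z))"
  shows "F k differentiable (at x)" "partial_deriv i (F k) x = F (partial_deriv i k) x"
proof -
  have ck: "continuous_on UNIV k" using Ck1_continuous[OF smooth_on_imp_Ck1[OF k]] .
  have cd: "continuous_on UNIV (partial_deriv i k)" for i
    using Ck1_partial_continuous[OF smooth_on_imp_Ck1[OF k]] .
  \<comment> \<open>The total derivative of the integrand in \<open>x\<close>, packed as a bounded
    linear function, the form in which the Leibniz rule takes it.\<close>
  define fx where "fx x z = (\<Sum>i\<in>UNIV. (\<zeta> z * partial_deriv i k (x - z)) *\<^sub>R blinfun_inner_right (axis i (1::real)))"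
    for x z :: "real^'n"
  have fx_apply: "blinfun_apply (fx x z) h = \<zeta> z * (\<Sum>i\<in>UNIV. partial_deriv i k (x - z) * h $ i)"
    for x z h :: "real^'n"
    by (simp add: fx_def blinfun.sum_left blinfun.scaleR_left inner_axis' sum_distrib_left mult.assoc)
  have cont: "continuous_on (UNIV \<times> cbox a b) (\<lambda>(x, z). fx x z)"
    unfolding fx_def case_prod_beta
    by (intro continuous_intros continuous_on_compose2[OF \<zeta>] continuous_on_compose2[OF cd]) auto
  have "(F k has_derivative integral (cbox a b) (fx x)) (at x within UNIV)"
    unfolding F_def
  proof (rule leibniz_rule[OF _ _ cont])
    fix x z :: "real^'n"
    have "(k has_derivative (\<lambda>h. \<Sum>i\<in>UNIV. partial_deriv i k (x - z) * h $ i)) (at (x - z))"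
      by (rule has_derivative_partial_deriv[OF smooth_on_differentiable[OF k]])
    moreover have "((\<lambda>x. x - z) has_derivative (\<lambda>h. h)) (at x)"
      by (auto intro!: derivative_eq_intros)
    ultimately have "((\<lambda>x. k (x - z)) has_derivative (\<lambda>h. \<Sum>i\<in>UNIV. partial_deriv i k (x - z) * h $ i)) (at x)"
      by (rule has_derivative_compose[rotated])
    then show "((\<lambda>x. \<zeta> z * k (x - z)) has_derivative blinfun_apply (fx x z)) (at x within UNIV)"
      unfolding fx_apply[abs_def] by (rule has_derivative_mult_right)
    show "(\<lambda>z. \<zeta> z * k (x - z)) integrable_on cbox a b"
      by (intro integrable_continuous continuous_intros continuous_on_compose2[OF \<zeta>]
          continuous_on_compose2[OF ck]) auto
  qed auto
  then have D: "(F k has_derivative integral (cbox a b) (fx x)) (at x)" by simp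
  then show "F k differentiable (at x)" by (auto simp: differentiable_def)
  have "fx x integrable_on cbox a b"
    unfolding fx_def[abs_def]
    by (intro integrable_continuous continuous_intros continuous_on_compose2[OF \<zeta>]
          continuous_on_compose2[OF cd]) auto
  moreover have "blinfun_apply (fx x z) (axis i 1) = \<zeta> z * partial_deriv i k (x - z)" for z
    unfolding fx_apply by (simp add: axis_def if_distrib cong: if_cong)
  ultimately show "partial_deriv i (F k) x = F (partial_deriv i k) x"
    unfolding partial_derivI[OF D] by (simp add: blinfun_apply_integral F_def)
qed

text \<open>Induction on the order with the kernel kept general: a partial derivative of the
  convolution is the convolution with a partial derivative of the kernel.\<close>

lemma smooth_convolution:
  fixes k \<zeta> :: "real^'n \<Rightarrow> real"
  assumes \<zeta>: "continuous_on UNIV \<zeta>" and k: "smooth_on UNIV k"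
  shows "smooth_on UNIV (\<lambda>x. integral (cbox a b) (\<lambda>z. \<zeta> z * k (x - z)))"
proof -
  have "Ck_on j UNIV (\<lambda>x. integral (cbox a b) (\<lambda>z. \<zeta> z * k (x - z)))" for j
    using k
  proof (induction j arbitrary: k)
    case 0
    then show ?case using convolution_partial_deriv(1)[OF \<zeta> 0]
      by (auto simp: continuous_on_eq_continuous_at intro: differentiable_imp_continuous_within)
  next
    case (Suc j)
    have "partial_deriv i (\<lambda>x. integral (cbox a b) (\<lambda>z. \<zeta> z * k (x - z)))
        = (\<lambda>x. integral (cbox a b) (\<lambda>z. \<zeta> z * partial_deriv i k (x - z)))" for i
      using convolution_partial_deriv(2)[OF \<zeta> Suc.prems] by blast
    then show ?case
      using convolution_partial_deriv(1)[OF \<zeta> Suc.prems] Suc.IH[OF smooth_on_partial_deriv[OF Suc.prems]]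
      by (simp add: Ck_on_Suc_UNIV)
  qed
  then show ?thesis by (simp add: smooth_on_def)
qed

lemma integral_lborel_reflect:
  fixes f :: "'a::euclidean_space \<Rightarrow> real"
  assumes "f \<in> borel_measurable borel"
  shows "(LINT z|lborel. f (x - z)) = (LINT z|lborel. f z)"
proof -
  have "distr lborel borel (\<lambda>z. x - z) = (lborel :: 'a measure)"
    using lborel_affine[of "-1" x] by (simp add: density_1)
  then show ?thesis
    using integral_distr[of "\<lambda>z. x - z" lborel borel f] assms by simp
qed

text \<open>An average of translates of \<open>\<zeta>\<close> over shifts of length at most
  \<open>\<delta>\<close> moves each value by at most \<open>L * \<delta>\<close> and keeps the
  Lipschitz constant. This uniform constant is what later bounds the derivatives of the
  mollifications.\<close>

lemma Lipschitz_mollification: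
  fixes \<zeta> :: "real^'n \<Rightarrow> real"
  assumes \<zeta>: "L-lipschitz_on UNIV \<zeta>" and G: "bounded G" and \<delta>: "\<delta> > 0"
  shows "\<exists>g. smooth_on UNIV g \<and> (\<forall>x\<in>G. \<bar>g x - \<zeta> x\<bar> \<le> L * \<delta>) \<and>
             (\<forall>x\<in>G. \<forall>y\<in>G. \<bar>g x - g y\<bar> \<le> L * dist x y)"
proof -
  have L: "0 \<le> L" using \<zeta> by (rule lipschitz_on_nonneg)
  have lip: "\<bar>\<zeta> x - \<zeta> y\<bar> \<le> L * dist x y" for x y
    using lipschitz_onD[OF \<zeta>, of x y] by (simp add: dist_real_def)
  have c\<zeta>: "continuous_on UNIV \<zeta>" using lipschitz_on_continuous_on[OF \<zeta>] .
  \<comment> \<open>Half the side of the box that carries the kernel. The norm is at most the sum of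
    the absolute coordinates, so this box lies in the ball of radius
    \<open>\<delta>\<close>.\<close>
  define e where "e = \<delta> / real CARD('n)"
  have e: "e > 0" using \<delta> by (simp add: e_def)
  define k where "k = box_bump (- (\<chi> i. e)) (\<chi> i::'n. e) 0"
  have k: "smooth_on UNIV k" unfolding k_def by (rule smooth_box_bump)
  have ck: "continuous_on UNIV k" using Ck1_continuous[OF smooth_on_imp_Ck1[OF k]] .
  have k_nonneg: "0 \<le> k z" for z unfolding k_def by (rule box_bump_nonneg)
  have k_supp: "k z = 0" if "z \<notin> cball 0 \<delta>" for z
  proof (rule ccontr)
    assume "k z \<noteq> 0"
    then have "z \<in> box (- (\<chi> i. e)) (\<chi> i. e)" by (simp add: k_def box_bump_eq_0_iff)
    then have "\<bar>z $ i\<bar> \<le> e" for i unfolding mem_box_cart by (simp add: abs_le_iff less_imp_le minus_less_iff)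
    then have "norm z \<le> (\<Sum>i\<in>(UNIV::'n set). e)" using norm_le_l1_cart[of z] sum_mono[of UNIV "\<lambda>i. \<bar>z $ i\<bar>" "\<lambda>i. e"]
      by (meson order_trans)
    then show False using that by (simp add: e_def)
  qed
  have int_k: "integrable lborel (\<lambda>z. f z * k z)" if "continuous_on UNIV f" for f
    by (rule integrable_continuous_compact_support(1)[of _ "cball 0 \<delta>"])
       (use that ck k_supp in \<open>auto intro!: continuous_on_mult\<close>)
  define c where "c = (LINT z|lborel. k z)"
  have c: "c > 0"
  proof -
    have "0 \<le> c" unfolding c_def using k_nonneg by (intro integral_nonneg_AE) auto
    \<comment> \<open>A nonnegative kernel with integral zero would vanish almost everywhere, but
      the set where \<open>k\<close> is nonzero is open and contains the origin.\<close>
    moreover have "c \<noteq> 0"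
    proof
      assume "c = 0"
      have "continuous_on UNIV (\<lambda>z. 1::real)" by simp
      from int_k[OF this] have "integrable lborel k" by simp
      then have "AE z in lborel. k z = 0"
        using \<open>c = 0\<close> k_nonneg unfolding c_def by (subst (asm) integral_nonneg_eq_0_iff_AE) auto
      moreover have o: "open {z. k z \<noteq> 0}"
        using ck by (simp add: open_Collect_neq)
      ultimately have "emeasure lborel {z. k z \<noteq> 0} = 0"
        using AE_iff_measurable[of "{z. k z \<noteq> 0}" lborel "\<lambda>z. k z = 0"] by auto
      then have "negligible {z. k z \<noteq> 0}"
        using o by (simp add: negligible_iff_null_sets null_sets_def)
      moreover have "k 0 \<noteq> 0" using e by (simp add: k_def box_bump_eq_0_iff mem_box_cart)
      ultimately show False using open_not_negligible[OF o] by blast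
    qed
    ultimately show ?thesis by simp
  qed
  \<comment> \<open>One box that contains every \<open>x - z\<close> with \<open>x\<close> in
    \<open>G\<close> and \<open>z\<close> in the ball. For \<open>x\<close> in \<open>G\<close> the
    integral over this fixed box is thus the full convolution.\<close>
  obtain a where a: "(\<Union>x\<in>G. \<Union>z\<in>cball 0 \<delta>. {x - z}) \<subseteq> cbox (- a) a"
    using bounded_subset_cbox_symmetric[OF bounded_differences[OF G bounded_cball]] by metis
  define F where "F x = integral (cbox (- a) a) (\<lambda>z. \<zeta> z * k (x - z))" for x
  have F_eq: "F x = (LINT z|lborel. \<zeta> (x - z) * k z)" if x: "x \<in> G" for x
  proof -
    have cz: "continuous_on UNIV (\<lambda>z. \<zeta> z * k (x - z))"
      by (intro continuous_intros c\<zeta> continuous_on_compose2[OF ck]) auto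
    have "\<zeta> z * k (x - z) = 0" if "z \<notin> cbox (- a) a" for z
    proof -
      have "x - z \<notin> cball 0 \<delta>"
      proof
        assume "x - z \<in> cball 0 \<delta>"
        then have "x - (x - z) \<in> cbox (- a) a" using a x by blast
        then show False using that by simp
      qed
      then show ?thesis using k_supp by simp
    qed
    note z0 = this
    have i: "integrable lborel (\<lambda>z. \<zeta> z * k (x - z))"
      by (rule integrable_continuous_compact_support(1)[OF cz compact_cbox z0])
    have "F x = integral UNIV (\<lambda>z. if z \<in> cbox (- a) a then \<zeta> z * k (x - z) else 0)"
      unfolding F_def by (rule integral_restrict_UNIV[symmetric])
    also have "(\<lambda>z. if z \<in> cbox (- a) a then \<zeta> z * k (x - z) else 0) = (\<lambda>z. \<zeta> z * k (x - z))"
      using z0 by auto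
    also have "integral UNIV (\<lambda>z. \<zeta> z * k (x - z)) = (LINT z|lborel. \<zeta> z * k (x - z))"
      by (rule integral_lborel[OF i])
    also have "\<dots> = (LINT z|lborel. \<zeta> (x - z) * k (x - (x - z)))"
      by (rule integral_lborel_reflect[symmetric]) (use cz in \<open>rule borel_measurable_continuous_onI\<close>)
    finally show ?thesis by simp
  qed
  \<comment> \<open>Used twice: with a constant second function for the distance from
    \<open>\<zeta>\<close>, and with two translates of \<open>\<zeta>\<close> for the Lipschitz
    bound.\<close>
  have estimate: "\<bar>(LINT z|lborel. f z * k z) - (LINT z|lborel. g z * k z)\<bar> \<le> B * c"
    if fg: "continuous_on UNIV f" "continuous_on UNIV g" and B: "\<And>z. z \<in> cball 0 \<delta> \<Longrightarrow> \<bar>f z - g z\<bar> \<le> B"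
    for f g B
  proof -
    have "(LINT z|lborel. f z * k z) - (LINT z|lborel. g z * k z) = (LINT z|lborel. (f z - g z) * k z)"
      using int_k[OF fg(1)] int_k[OF fg(2)] by (simp add: left_diff_distrib)
    also have "\<bar>\<dots>\<bar> \<le> (LINT z|lborel. \<bar>(f z - g z) * k z\<bar>)" by (rule integral_abs_bound)
    also have "\<dots> \<le> (LINT z|lborel. B * k z)"
    proof (rule integral_mono)
      show "integrable lborel (\<lambda>z. \<bar>(f z - g z) * k z\<bar>)"
        using fg by (intro integrable_abs int_k continuous_on_diff)
      show "integrable lborel (\<lambda>z. B * k z)" by (intro int_k continuous_on_const)
      show "\<bar>(f z - g z) * k z\<bar> \<le> B * k z" for z
        using B[of z] k_supp[of z] k_nonneg[of z]
        by (cases "z \<in> cball 0 \<delta>") (auto simp: abs_mult intro: mult_right_mono)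
    qed
    also have "\<dots> = B * c" by (simp add: c_def)
    finally show ?thesis .
  qed
  have csh: "continuous_on UNIV (\<lambda>z. \<zeta> (x - z))" for x
    by (intro continuous_on_compose2[OF c\<zeta>] continuous_intros) auto
  define g where "g x = (1 / c) * F x" for x
  have "smooth_on UNIV g"
    using smooth_convolution[OF c\<zeta> k, of "- a" a]
    unfolding g_def F_def smooth_on_def 
    by (intro allI Ck_on_mult Ck_on_const) blast
  moreover have "\<bar>g x - \<zeta> x\<bar> \<le> L * \<delta>" if "x \<in> G" for x
  proof -
    have "\<bar>F x - (LINT z|lborel. \<zeta> x * k z)\<bar> \<le> (L * \<delta>) * c"
      unfolding F_eq[OF that]
    proof (rule estimate[OF csh continuous_on_const])
      fix z :: "real^'n" assume z: "z \<in> cball 0 \<delta>"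
      have "\<bar>\<zeta> (x - z) - \<zeta> x\<bar> \<le> L * dist (x - z) x" by (rule lip)
      also have "\<dots> \<le> L * \<delta>" using z L by (intro mult_left_mono) (auto simp: dist_norm)
      finally show "\<bar>\<zeta> (x - z) - \<zeta> x\<bar> \<le> L * \<delta>" .
    qed
    then have "\<bar>F x - \<zeta> x * c\<bar> \<le> (L * \<delta>) * c" by (simp add: c_def)
    moreover have "F x - \<zeta> x * c = (g x - \<zeta> x) * c" using c by (simp add: g_def field_simps)
    ultimately show ?thesis using c by (simp add: abs_mult)
  qed
  moreover have "\<bar>g x - g y\<bar> \<le> L * dist x y" if "x \<in> G" "y \<in> G" for x y
  proof -
    have "\<bar>F x - F y\<bar> \<le> (L * dist x y) * c"
      unfolding F_eq[OF that(1)] F_eq[OF that(2)]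
    proof (rule estimate[OF csh csh])
      show "\<bar>\<zeta> (x - z) - \<zeta> (y - z)\<bar> \<le> L * dist x y" for z
        using lip[of "x - z" "y - z"] by (simp add: dist_norm)
    qed
    moreover have "F x - F y = (g x - g y) * c" using c by (simp add: g_def field_simps)
    ultimately show ?thesis using c by (simp add: abs_mult)
  qed
  ultimately show ?thesis by blast
qed

text \<open>Difference quotients at \<open>x\<close> use only points of the open set
  \<open>G\<close> once the increment is small. The mollifications are known to be Lipschitz only
  there.\<close>

lemma partial_deriv_le_Lipschitz:
  fixes f :: "real^'n \<Rightarrow> real"
  assumes G: "open G" "x \<in> G" and f: "f differentiable (at x)"
    and lip: "\<And>y. y \<in> G \<Longrightarrow> \<bar>f y - f x\<bar> \<le> L * dist y x"
  shows "\<bar>partial_deriv i f x\<bar> \<le> L"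
proof -
  have "((\<lambda>h. f (x + h *\<^sub>R axis i 1)) has_real_derivative partial_deriv i f (x + 0 *\<^sub>R axis i 1)) (at 0)"
    using f by (intro has_real_derivative_along_axis) simp
  then have "((\<lambda>h. (f (x + h *\<^sub>R axis i 1) - f x) / h) \<longlongrightarrow> partial_deriv i f x) (at 0)"
    by (simp add: DERIV_def)
  then have lim: "((\<lambda>h. \<bar>(f (x + h *\<^sub>R axis i 1) - f x) / h\<bar>) \<longlongrightarrow> \<bar>partial_deriv i f x\<bar>) (at 0)"
    by (rule tendsto_rabs)
  have "((\<lambda>h. x + h *\<^sub>R axis i 1) \<longlongrightarrow> x + 0 *\<^sub>R axis i 1) (at (0::real))" by (intro tendsto_intros)
  then have "\<forall>\<^sub>F h in at (0::real). x + h *\<^sub>R axis i 1 \<in> G"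
    using G by (intro topological_tendstoD[of _ "x"]) auto
  then have "\<forall>\<^sub>F h in at (0::real). \<bar>(f (x + h *\<^sub>R axis i 1) - f x) / h\<bar> \<le> L"
    using eventually_neq_at_within[of 0 0 UNIV]
  proof eventually_elim
    case (elim h)
    then have "\<bar>f (x + h *\<^sub>R axis i 1) - f x\<bar> \<le> L * \<bar>h\<bar>"
      using lip[of "x + h *\<^sub>R axis i 1"] by (simp add: dist_norm)
    then show ?case using elim by (simp add: abs_divide divide_le_eq)
  qed
  then show ?thesis by (intro tendsto_upperbound[OF lim]) auto
qed

context bounded_open
begin

lemma l2_class_dominated:
  assumes u: "u \<in> L2 G" and w: "(\<lambda>x. indicator G x * w x) \<in> borel_measurable lebesgue"
    and le: "\<And>x. x \<in> G \<Longrightarrow> \<bar>w x\<bar> \<le> c * \<bar>u x\<bar>" and c: "0 \<le> c"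
  shows "w \<in> L2 G" "norm (l2_class G w) \<le> c * norm (l2_class G u)"
proof -
  have le': "\<bar>indicator G x * w x\<bar> \<le> c * \<bar>indicator G x * u x\<bar>" for x
    using le[of x] by (auto simp: indicator_def)
  show "w \<in> L2 G" unfolding L2_iff by (rule sqint_dominated[OF u[unfolded L2_iff] w le'])
  show "norm (l2_class G w) \<le> c * norm (l2_class G u)"
    unfolding l2_class_def by (rule norm_abs_l2_le[OF u[unfolded L2_iff] w le' c])
qed

lemma L2_restrict_measurable:
  "u \<in> L2 G \<Longrightarrow> b \<in> borel_measurable borel \<Longrightarrow> (\<lambda>x. indicator G x * (b x * u x)) \<in> borel_measurable lebesgue"
proof -
  assume u: "u \<in> L2 G" and b: "b \<in> borel_measurable borel"
  have "b \<in> borel_measurable lebesgue" using b by (intro measurable_completion) simp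
  then have "(\<lambda>x. b x * (indicator G x * u x)) \<in> borel_measurable lebesgue"
    using sqint_measurable[OF u[unfolded L2_iff]] by (rule borel_measurable_times)
  then show ?thesis by (simp add: mult_ac)
qed

lemma norm_jet_le: "norm (jet G u) \<le> norm (fst (jet G u)) + (\<Sum>i\<in>UNIV. norm (snd (jet G u) $ i))"
proof -
  have "norm (snd (jet G u)) \<le> (\<Sum>i\<in>UNIV. norm (snd (jet G u) $ i))"
    unfolding norm_vec_def by (rule L2_set_le_sum) simp
  then show ?thesis using norm_Pair_le[of "fst (jet G u)" "snd (jet G u)"] by simp
qed

lemma jet_component_le: "norm (fst p) \<le> norm p" "norm (snd p $ i) \<le> norm p"
  for p :: "(real^'n) l2 \<times> (((real^'n) l2)^'n)"
  using norm_fst_le[of "fst p" "snd p"] norm_snd_le[of "snd p" "fst p"]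
    Finite_Cartesian_Product.norm_nth_le[of "snd p" i] by auto

text \<open>A product of a Lipschitz function \<open>\<eta>\<close> with \<open>v \<in> H\<^sup>1\<^sub>0(G)\<close> is the \<open>L\<^sub>2\<close>-limit of products of
  mollifications of \<open>\<eta>\<close> with test functions. Their jets are bounded, so they have a weak limit
  point, which must be the jet of \<open>\<eta> v\<close>. This avoids Rademacher's theorem.\<close>

lemma H10_Lipschitz_mult:
  assumes "G \<noteq> {}" and \<eta>: "L-lipschitz_on G \<eta>" and M: "\<And>x. x \<in> G \<Longrightarrow> \<bar>\<eta> x\<bar> \<le> M"
  shows "\<exists>K\<ge>0. \<forall>v\<in>H10 G. (\<lambda>x. \<eta> x * v x) \<in> H10 G \<and> norm (jet G (\<lambda>x. \<eta> x * v x)) \<le> K * norm (jet G v)"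
proof -
  have L: "0 \<le> L" using \<eta> by (rule lipschitz_on_nonneg)
  have M0: "0 \<le> M" using M \<open>G \<noteq> {}\<close> by force
  obtain \<zeta> where \<zeta>: "L-lipschitz_on UNIV \<zeta>" "\<And>x. x \<in> G \<Longrightarrow> \<zeta> x = \<eta> x"
    using Lipschitz_extension[OF \<eta> \<open>G \<noteq> {}\<close>] by blast
  have \<zeta>_meas: "\<zeta> \<in> borel_measurable borel"
    by (rule borel_measurable_continuous_onI[OF lipschitz_on_continuous_on[OF \<zeta>(1)]])
  define d where "d m = 1 / real (Suc m)" for m
  have d: "0 < d m" "d m \<le> 1" for m by (auto simp: d_def)
  have d_lim: "d \<longlonglongrightarrow> 0" unfolding d_def by (intro LIMSEQ_Suc lim_1_over_n)
  have "\<forall>m. \<exists>g. smooth_on UNIV g \<and> (\<forall>x\<in>G. \<bar>g x - \<zeta> x\<bar> \<le> L * d m) \<and>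
      (\<forall>x\<in>G. \<forall>y\<in>G. \<bar>g x - g y\<bar> \<le> L * dist x y)"
    using Lipschitz_mollification[OF \<zeta>(1) bounded_G d(1)] by blast
  then obtain g where g: "\<And>m. smooth_on UNIV (g m)" "\<And>m x. x \<in> G \<Longrightarrow> \<bar>g m x - \<zeta> x\<bar> \<le> L * d m"
      "\<And>m x y. x \<in> G \<Longrightarrow> y \<in> G \<Longrightarrow> \<bar>g m x - g m y\<bar> \<le> L * dist x y"
    by metis
  have g_bound: "\<bar>g m x\<bar> \<le> M + L" if "x \<in> G" for m x
  proof -
    have "L * d m \<le> L * 1" using d L by (intro mult_left_mono) auto
    then show ?thesis using g(2)[OF that, of m] M[OF that] \<zeta>(2)[OF that] by (simp add: abs_le_iff)
  qed
  have dg_bound: "\<bar>partial_deriv i (g m) x\<bar> \<le> L" if "x \<in> G" for i m x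
    by (rule partial_deriv_le_Lipschitz[OF open_G that smooth_on_differentiable[OF g(1)]])
       (use g(3) that in auto)
  have g_meas: "g m \<in> borel_measurable borel" "partial_deriv i (g m) \<in> borel_measurable borel" for m i
    using Ck1_continuous[OF smooth_on_imp_Ck1[OF g(1)[of m]]]
      Ck1_partial_continuous[OF smooth_on_imp_Ck1[OF g(1)[of m]], of i]
    by (auto intro: borel_measurable_continuous_onI)
  \<comment> \<open>\<open>M + L\<close> bounds the mollifications on \<open>G\<close> because
    \<open>d m \<le> 1\<close>. By the product rule each of the \<open>CARD('n)\<close> derivatives
    contributes \<open>L + (M + L)\<close>.\<close>
  define K where "K = (M + L) + real CARD('n) * (M + 2 * L)"
  have K: "0 \<le> K" using M0 L by (simp add: K_def)
  have test_bound: "(\<lambda>x. g m x * \<phi> x) \<in> test_funs G \<and> norm (jet G (\<lambda>x. g m x * \<phi> x)) \<le> K * norm (jet G \<phi>)"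
    if \<phi>: "\<phi> \<in> test_funs G" for m \<phi>
  proof
    show t: "(\<lambda>x. g m x * \<phi> x) \<in> test_funs G" by (rule test_funs_smooth_mult[OF \<phi> g(1)])
    have 1: "norm (fst (jet G (\<lambda>x. g m x * \<phi> x))) \<le> (M + L) * norm (jet G \<phi>)"
    proof -
      have "norm (l2_class G (\<lambda>x. g m x * \<phi> x)) \<le> (M + L) * norm (l2_class G \<phi>)"
        by (rule l2_class_dominated(2)[OF test_fun_L2(1)[OF \<phi>] L2_restrict_measurable[OF test_fun_L2(1)[OF \<phi>] g_meas(1)]])
           (use g_bound M0 L in \<open>auto simp: abs_mult intro: mult_right_mono\<close>)
      also have "\<dots> \<le> (M + L) * norm (jet G \<phi>)"
        using jet_component_le(1)[of "jet G \<phi>"] M0 L by (intro mult_left_mono) (auto simp: jet_def)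
      finally show ?thesis by (simp add: jet_def)
    qed
    have 2: "norm (snd (jet G (\<lambda>x. g m x * \<phi> x)) $ i) \<le> (M + 2 * L) * norm (jet G \<phi>)" for i
    proof -
      have pd: "partial_deriv i (\<lambda>x. g m x * \<phi> x) = (\<lambda>x. partial_deriv i (g m) x * \<phi> x + g m x * partial_deriv i \<phi> x)"
        by (intro ext partial_deriv_mult smooth_on_differentiable[OF g(1)]
            Ck1_differentiable[OF test_fun_Ck1[OF \<phi>]])
      note a = l2_class_dominated[OF test_fun_L2(1)[OF \<phi>] L2_restrict_measurable[OF test_fun_L2(1)[OF \<phi>] g_meas(2)], where c = L]
      note b = l2_class_dominated[OF test_fun_L2(2)[OF \<phi>] L2_restrict_measurable[OF test_fun_L2(2)[OF \<phi>] g_meas(1)], where c = "M + L"]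
      have a': "(\<lambda>x. partial_deriv i (g m) x * \<phi> x) \<in> L2 G"
          "norm (l2_class G (\<lambda>x. partial_deriv i (g m) x * \<phi> x)) \<le> L * norm (l2_class G \<phi>)"
        by (rule a; use dg_bound L in \<open>auto simp: abs_mult intro: mult_right_mono\<close>)+
      have b': "(\<lambda>x. g m x * partial_deriv i \<phi> x) \<in> L2 G"
          "norm (l2_class G (\<lambda>x. g m x * partial_deriv i \<phi> x)) \<le> (M + L) * norm (l2_class G (partial_deriv i \<phi>))"
        by (rule b; use g_bound M0 L in \<open>auto simp: abs_mult intro: mult_right_mono\<close>)+
      have "snd (jet G (\<lambda>x. g m x * \<phi> x)) $ i =
          l2_class G (\<lambda>x. partial_deriv i (g m) x * \<phi> x) + l2_class G (\<lambda>x. g m x * partial_deriv i \<phi> x)"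
        using a'(1) b'(1) by (simp add: test_fun_H1(2)[OF t] pd l2_class_add)
      also have "norm \<dots> \<le> L * norm (l2_class G \<phi>) + (M + L) * norm (l2_class G (partial_deriv i \<phi>))"
        using a'(2) b'(2) by (meson add_mono norm_triangle_ineq order_trans)
      also have "\<dots> \<le> L * norm (jet G \<phi>) + (M + L) * norm (jet G \<phi>)"
        using jet_component_le(1)[of "jet G \<phi>"] jet_component_le(2)[of "jet G \<phi>" i] M0 L
        by (intro add_mono mult_left_mono) (auto simp: test_fun_H1(2)[OF \<phi>])
      finally show ?thesis by (simp add: algebra_simps)
    qed
    have "norm (jet G (\<lambda>x. g m x * \<phi> x)) \<le>
        (M + L) * norm (jet G \<phi>) + (\<Sum>i\<in>(UNIV::'n set). (M + 2 * L) * norm (jet G \<phi>))"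
      by (rule order_trans[OF norm_jet_le add_mono[OF 1 sum_mono[OF 2]]])
    then show "norm (jet G (\<lambda>x. g m x * \<phi> x)) \<le> K * norm (jet G \<phi>)"
      by (simp add: K_def algebra_simps)
  qed
  have "(\<lambda>x. \<eta> x * v x) \<in> H10 G \<and> norm (jet G (\<lambda>x. \<eta> x * v x)) \<le> K * norm (jet G v)"
    if v: "v \<in> H10 G" for v
  proof -
    obtain \<phi> where \<phi>: "\<And>m. \<phi> m \<in> test_funs G" "(\<lambda>m::nat. jet G (\<phi> m)) \<longlonglongrightarrow> jet G v"
      using H10_imp_jet(3)[OF v] by blast
    define \<psi> where "\<psi> m = (\<lambda>x. g m x * \<phi> m x)" for m
    have \<psi>: "\<psi> m \<in> test_funs G" "norm (jet G (\<psi> m)) \<le> K * norm (jet G (\<phi> m))" for m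
      using test_bound[OF \<phi>(1)] by (auto simp: \<psi>_def)
    have vL: "v \<in> L2 G" by (rule H10_L2[OF v])
    have ind: "(\<lambda>x. indicator G x * (\<eta> x * w x)) = (\<lambda>x. indicator G x * (\<zeta> x * w x))" for w
      using \<zeta>(2) by (auto simp: indicator_def)
    have mult: "(\<lambda>x. \<eta> x * w x) \<in> L2 G" "norm (l2_class G (\<lambda>x. \<eta> x * w x)) \<le> M * norm (l2_class G w)"
      if "w \<in> L2 G" for w
      by (rule l2_class_dominated[OF that];
          use M M0 L2_restrict_measurable[OF that \<zeta>_meas] in \<open>auto simp: ind abs_mult intro: mult_right_mono\<close>)+
    \<comment> \<open>The error splits into the mollification error of the multiplier, applied to
      the test function, and the exact multiplier, applied to the error of the test
      function.\<close>
    have close: "norm (l2_class G (\<psi> m) - l2_class G (\<lambda>x. \<eta> x * v x)) \<le>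
        (L * d m) * norm (l2_class G (\<phi> m)) + M * norm (l2_class G (\<phi> m) - l2_class G v)" for m
    proof -
      let ?\<phi> = "\<phi> m"
      have pL: "?\<phi> \<in> L2 G" by (rule test_fun_L2(1)[OF \<phi>(1)])
      have "(\<lambda>x. indicator G x * (\<psi> m x - \<eta> x * ?\<phi> x)) \<in> borel_measurable lebesgue"
        using sqint_measurable[OF L2_diff[OF test_fun_L2(1)[OF \<psi>(1)] mult(1)[OF pL], unfolded L2_iff]] .
      then have 1: "norm (l2_class G (\<lambda>x. \<psi> m x - \<eta> x * ?\<phi> x)) \<le> (L * d m) * norm (l2_class G ?\<phi>)"
      proof (rule l2_class_dominated(2)[OF pL])
        show "\<bar>\<psi> m x - \<eta> x * ?\<phi> x\<bar> \<le> L * d m * \<bar>?\<phi> x\<bar>" if "x \<in> G" for x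
          using g(2)[OF that, of m] \<zeta>(2)[OF that]
          by (simp add: \<psi>_def left_diff_distrib[symmetric] abs_mult mult_right_mono)
      qed (use L d[of m] in auto)
      have 2: "norm (l2_class G (\<lambda>x. \<eta> x * (?\<phi> x - v x))) \<le> M * norm (l2_class G ?\<phi> - l2_class G v)"
        using mult(2)[OF L2_diff[OF pL vL]] by (simp add: l2_class_diff pL vL)
      have 3: "l2_class G (\<psi> m) - l2_class G (\<lambda>x. \<eta> x * v x) =
          l2_class G (\<lambda>x. \<psi> m x - \<eta> x * ?\<phi> x) + l2_class G (\<lambda>x. \<eta> x * (?\<phi> x - v x))"
        using mult(1)[OF pL] mult(1)[OF vL] test_fun_L2(1)[OF \<psi>(1)]
        by (simp add: right_diff_distrib l2_class_diff)
      show ?thesis unfolding 3 by (rule order_trans[OF norm_triangle_ineq add_mono[OF 1 2]])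
    qed
    have cl: "(\<lambda>m. l2_class G (\<phi> m)) \<longlonglongrightarrow> l2_class G v"
      using tendsto_fst[OF \<phi>(2)] by (simp add: jet_def)
    have "(\<lambda>m. (L * d m) * norm (l2_class G (\<phi> m)) + M * norm (l2_class G (\<phi> m) - l2_class G v))
        \<longlonglongrightarrow> (L * 0) * norm (l2_class G v) + M * norm (l2_class G v - l2_class G v)"
      by (intro tendsto_intros cl d_lim)
    then have small: "(\<lambda>m. (L * d m) * norm (l2_class G (\<phi> m)) + M * norm (l2_class G (\<phi> m) - l2_class G v))
        \<longlonglongrightarrow> 0" by simp
    have "Bseq (\<lambda>m. jet G (\<phi> m))" using \<phi>(2) by (rule convergent_imp_Bseq[OF convergentI])
    then obtain B where B: "\<And>m. norm (jet G (\<phi> m)) \<le> B" by (auto simp: Bseq_def)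
    have "norm (jet G (\<psi> m)) \<le> K * B" for m
      using \<psi>(2)[of m] mult_left_mono[OF B[of m] K] by linarith
    then have "\<exists>p. \<forall>C n. closed C \<and> convex C \<and> (\<forall>m\<ge>n. jet G (\<psi> m) \<in> C) \<longrightarrow> p \<in> C"
      by (rule bounded_seq_weak_limit)
    then obtain p where
      "\<forall>C n. closed C \<and> convex C \<and> (\<forall>m\<ge>n. jet G (\<psi> m) \<in> C) \<longrightarrow> p \<in> C" by (rule exE)
    then have p: "p \<in> C" if "closed C" "convex C" "\<forall>m\<ge>n. jet G (\<psi> m) \<in> C" for C n
      using that by meson
    have pS: "p \<in> H10_jets G"
    proof (rule p[OF closed_H10_jets subspace_imp_convex[OF subspace_H10_jets]])
      show "\<forall>m\<ge>0. jet G (\<psi> m) \<in> H10_jets G"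
        using \<psi>(1) closure_subset[of "jet G ` test_funs G"] unfolding H10_jets_def by blast
    qed
    \<comment> \<open>The pairs whose first component is within \<open>e\<close> of the class of the
      product form a closed convex set that contains a tail of the sequence, hence also
      \<open>p\<close>.\<close>
    have "norm (fst p - l2_class G (\<lambda>x. \<eta> x * v x)) \<le> e" if "e > 0" for e
    proof -
      let ?C = "{q :: (real^'n) l2 \<times> (((real^'n) l2)^'n). norm (fst q - l2_class G (\<lambda>x. \<eta> x * v x)) \<le> e}"
      have "\<forall>\<^sub>F m in sequentially. (L * d m) * norm (l2_class G (\<phi> m)) + M * norm (l2_class G (\<phi> m) - l2_class G v) < e"
        by (rule order_tendstoD(2)[OF small that])
      then obtain n where n: "\<And>m. m \<ge> n \<Longrightarrow>
          (L * d m) * norm (l2_class G (\<phi> m)) + M * norm (l2_class G (\<phi> m) - l2_class G v) < e"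
        by (auto simp: eventually_sequentially)
      have "p \<in> ?C"
      proof (rule p[of _ n])
        show "closed ?C" by (intro closed_Collect_le continuous_intros)
        have "?C = fst -` cball (l2_class G (\<lambda>x. \<eta> x * v x)) e" by (auto simp: dist_norm norm_minus_commute)
        then show "convex ?C" by (simp add: convex_linear_vimage linear_fst)
        show "\<forall>m\<ge>n. jet G (\<psi> m) \<in> ?C"
          using less_imp_le[OF le_less_trans[OF close n]] by (simp add: jet_def)
      qed
      then show ?thesis by simp
    qed
    then have "norm (fst p - l2_class G (\<lambda>x. \<eta> x * v x)) \<le> 0" by (rule field_le_epsilon[of _ 0, simplified])
    then have fp: "l2_class G (\<lambda>x. \<eta> x * v x) = fst p" by simp
    \<comment> \<open>With the first component identified, the product lies in \<open>H10 G\<close>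
      and its jet is \<open>p\<close>. What remains is the norm of \<open>p\<close>, again found by
      testing with balls that contain a tail.\<close>
    note H = H10I[OF mult(1)[OF vL] pS fp]
    have "norm p \<le> K * norm (jet G v) + e" if "e > 0" for e
    proof -
      have "(\<lambda>m. K * norm (jet G (\<phi> m))) \<longlonglongrightarrow> K * norm (jet G v)" by (intro tendsto_intros \<phi>(2))
      then have "\<forall>\<^sub>F m in sequentially. K * norm (jet G (\<phi> m)) < K * norm (jet G v) + e"
        using that by (intro order_tendstoD(2)) auto
      then obtain n where n: "\<And>m. m \<ge> n \<Longrightarrow> K * norm (jet G (\<phi> m)) < K * norm (jet G v) + e"
        by (auto simp: eventually_sequentially)
      have "p \<in> cball 0 (K * norm (jet G v) + e)"
      proof (rule p[of _ n])
        show "\<forall>m\<ge>n. jet G (\<psi> m) \<in> cball 0 (K * norm (jet G v) + e)"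
          using less_imp_le[OF le_less_trans[OF \<psi>(2) n]] by simp
      qed auto
      then show ?thesis by simp
    qed
    then have "norm p \<le> K * norm (jet G v)" by (rule field_le_epsilon)
    then show ?thesis using H by simp
  qed
  then show ?thesis using K by blast
qed

end

section \<open>The elliptic problem\<close>

lemma bounded_bilinear_zero: "bounded_bilinear (\<lambda>x y. 0)"
  by (rule bounded_bilinear.intro) (auto intro: exI[of _ 0])

lemma bounded_bilinear_add:
  assumes "bounded_bilinear f" "bounded_bilinear g"
  shows "bounded_bilinear (\<lambda>x y. f x y + g x y)"
proof -
  interpret f: bounded_bilinear f by fact
  interpret g: bounded_bilinear g by fact
  obtain K1 K2 where K: "\<And>x y. norm (f x y) \<le> norm x * norm y * K1" "\<And>x y. norm (g x y) \<le> norm x * norm y * K2"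
    using f.bounded g.bounded by metis
  show ?thesis
  proof
    show "\<exists>K. \<forall>a b. norm (f a b + g a b) \<le> norm a * norm b * K"
    proof (intro exI allI)
      fix a b
      show "norm (f a b + g a b) \<le> norm a * norm b * (K1 + K2)"
        unfolding distrib_left by (rule order_trans[OF norm_triangle_ineq add_mono[OF K]])
    qed
  qed (simp_all add: f.add_left f.add_right g.add_left g.add_right f.scaleR_left f.scaleR_right
      g.scaleR_left g.scaleR_right scaleR_add_right)
qed

lemma bounded_bilinear_sum:
  "(\<And>i. i \<in> I \<Longrightarrow> bounded_bilinear (f i)) \<Longrightarrow> bounded_bilinear (\<lambda>x y. \<Sum>i\<in>I. f i x y)"
  by (induction I rule: infinite_finite_induct) (auto intro: bounded_bilinear_zero bounded_bilinear_add)

lemma Hm1_add: "F \<in> Hm1 G \<Longrightarrow> u \<in> H10 G \<Longrightarrow> v \<in> H10 G \<Longrightarrow> F (\<lambda>x. u x + v x) = F u + F v"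
  and Hm1_scale: "F \<in> Hm1 G \<Longrightarrow> u \<in> H10 G \<Longrightarrow> F (\<lambda>x. c * u x) = c * F u"
  by (simp_all add: Hm1_def)

definition coeff_bounded :: "(real^'n) set \<Rightarrow> ('n \<Rightarrow> 'n \<Rightarrow> real^'n \<Rightarrow> real) \<Rightarrow> bool" where
  "coeff_bounded G b \<longleftrightarrow> (\<forall>i j. b i j \<in> borel_measurable (lebesgue_on G) \<and> bounded (b i j ` G))"

text \<open>The negative of \<open>div_op\<close>, transported to jets. It is defined for all pairs
  of tuples, so it is a bounded bilinear form on the whole Hilbert space, free of the choices in
  \<open>weak_partial\<close>.\<close>

definition div_form :: "(real^'n) set \<Rightarrow> ('n \<Rightarrow> 'n \<Rightarrow> real^'n \<Rightarrow> real) \<Rightarrow>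
    (real^'n) l2 \<times> (((real^'n) l2)^'n) \<Rightarrow> (real^'n) l2 \<times> (((real^'n) l2)^'n) \<Rightarrow> real" where
  "div_form G b p q = (\<Sum>i\<in>UNIV. \<Sum>j\<in>UNIV.
     inner (mult_l2 (\<lambda>x. indicator G x * b i j x) (snd p $ j)) (snd q $ i))"

context bounded_open
begin

section \<open>The operators and the dual space in terms of jets\<close>

lemma H10_jetsE:
  assumes "p \<in> H10_jets G" obtains u where "u \<in> H10 G" "jet G u = p"
  using assms unfolding jet_image_H10[symmetric] by auto

lemma coeff_boundedD:
  assumes "coeff_bounded G b"
  shows "(\<lambda>x. indicator G x * b i j x) \<in> borel_measurable lebesgue"
    and "\<exists>c. \<forall>x. \<bar>indicator G x * b i j x\<bar> \<le> c"
proof -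
  show "(\<lambda>x. indicator G x * b i j x) \<in> borel_measurable lebesgue"
    using assms borel_measurable_restrict_space_iff[OF G_sets(2), of "b i j"]
    by (simp add: coeff_bounded_def)
  obtain c where "\<And>x. x \<in> G \<Longrightarrow> \<bar>b i j x\<bar> \<le> c"
    using assms by (force simp: coeff_bounded_def bounded_iff)
  then have "\<bar>indicator G x * b i j x\<bar> \<le> max c 0" for x
    by (cases "x \<in> G") (auto intro: max.coboundedI1)
  then show "\<exists>c. \<forall>x. \<bar>indicator G x * b i j x\<bar> \<le> c" by blast
qed

lemma bounded_bilinear_div_form:
  assumes "coeff_bounded G b" shows "bounded_bilinear (div_form G b)"
  unfolding div_form_def
proof (intro bounded_bilinear_sum bounded_bilinear.comp[OF bounded_bilinear_inner])
  fix i j :: 'n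
  obtain c where c: "\<And>x. \<bar>indicator G x * b i j x\<bar> \<le> c" using coeff_boundedD(2)[OF assms] by blast
  show "bounded_linear (\<lambda>p. mult_l2 (\<lambda>x. indicator G x * b i j x) (snd p $ j))"
    by (intro bounded_linear_compose[OF bounded_linear_mult_l2[OF coeff_boundedD(1)[OF assms] c]]
        bounded_linear_compose[OF bounded_linear_vec_nth bounded_linear_snd])
  show "bounded_linear (\<lambda>p. snd p $ i)"
    by (rule bounded_linear_compose[OF bounded_linear_vec_nth bounded_linear_snd])
qed

lemma L2_coeff_mult:
  assumes b: "coeff_bounded G b" and u: "u \<in> L2 G"
  shows "(\<lambda>x. b i j x * u x) \<in> L2 G"
    "l2_class G (\<lambda>x. b i j x * u x) = mult_l2 (\<lambda>x. indicator G x * b i j x) (l2_class G u)"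
proof -
  obtain c where c: "\<And>x. \<bar>indicator G x * b i j x\<bar> \<le> c" using coeff_boundedD(2)[OF b] by blast
  have eq: "(\<lambda>x. indicator G x * (b i j x * u x)) = (\<lambda>x. (indicator G x * b i j x) * (indicator G x * u x))"
    by (auto simp: indicator_def)
  show "(\<lambda>x. b i j x * u x) \<in> L2 G"
    unfolding L2_iff eq by (rule sqint_bounded_mult[OF coeff_boundedD(1)[OF b] c u[unfolded L2_iff]])
  show "l2_class G (\<lambda>x. b i j x * u x) = mult_l2 (\<lambda>x. indicator G x * b i j x) (l2_class G u)"
    unfolding l2_class_def eq
    by (rule mult_l2_abs[symmetric, OF coeff_boundedD(1)[OF b] c u[unfolded L2_iff]])
qed

lemma L2_sum:
  assumes "\<And>i. i \<in> I \<Longrightarrow> u i \<in> L2 G"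
  shows "(\<lambda>x. \<Sum>i\<in>I. u i x) \<in> L2 G" "l2_class G (\<lambda>x. \<Sum>i\<in>I. u i x) = (\<Sum>i\<in>I. l2_class G (u i))"
proof -
  have eq: "(\<lambda>x. indicator G x * (\<Sum>i\<in>I. u i x)) = (\<lambda>x. \<Sum>i\<in>I. indicator G x * u i x)"
    by (simp add: sum_distrib_left)
  show "(\<lambda>x. \<Sum>i\<in>I. u i x) \<in> L2 G"
    unfolding L2_iff eq by (rule sqint_sum) (use assms in \<open>simp add: L2_iff\<close>)
  show "l2_class G (\<lambda>x. \<Sum>i\<in>I. u i x) = (\<Sum>i\<in>I. l2_class G (u i))"
    unfolding l2_class_def eq by (rule abs_l2_sum) (use assms in \<open>simp add: L2_iff\<close>)
qed

lemma div_op_eq: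
  assumes b: "coeff_bounded G b" and u: "u \<in> H10 G" and v: "v \<in> H10 G"
  shows "div_op G b u v = - div_form G b (jet G u) (jet G v)"
proof -
  have uL: "weak_partial G j u \<in> L2 G" and vL: "weak_partial G j v \<in> L2 G" for j
    using u v H10_imp_jet(1) H1_imp_L2(2) by blast+
  have "L2_inner G (\<lambda>x. \<Sum>j\<in>UNIV. b i j x * weak_partial G j u x) (weak_partial G i v)
      = (\<Sum>j\<in>UNIV. inner (mult_l2 (\<lambda>x. indicator G x * b i j x) (snd (jet G u) $ j)) (snd (jet G v) $ i))" for i
    using L2_sum(1)[of UNIV "\<lambda>j x. b i j x * weak_partial G j u x", OF L2_coeff_mult(1)[OF b uL]]
      L2_sum(2)[of UNIV "\<lambda>j x. b i j x * weak_partial G j u x", OF L2_coeff_mult(1)[OF b uL]]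
    by (simp add: L2_inner_eq vL L2_coeff_mult(2)[OF b uL] inner_sum_left jet_def)
  then show ?thesis by (simp add: div_op_def div_form_def sum_negf)
qed

text \<open>A functional in \<open>Hm1 G\<close> acts on functions; its bound forces it to vanish on
  differences with jet zero, so it factors through jets.\<close>

lemma Hm1_jet_cong:
  assumes F: "F \<in> Hm1 G" and "u \<in> H10 G" "v \<in> H10 G" "jet G u = jet G v"
  shows "F u = F v"
proof -
  obtain K where K: "\<And>w. w \<in> H10 G \<Longrightarrow> \<bar>F w\<bar> \<le> K * H1_norm G w" using F unfolding Hm1_def by blast
  have v': "(\<lambda>x. (-1) * v x) \<in> H10 G" by (rule H10_scale(1)[OF assms(3)])
  have w: "(\<lambda>x. u x + (-1) * v x) \<in> H10 G" "jet G (\<lambda>x. u x + (-1) * v x) = 0"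
    using H10_add[OF assms(2) v'] H10_scale(2)[OF assms(3), of "-1"] assms(4) by auto
  have "F (\<lambda>x. u x + (-1) * v x) = F u + F (\<lambda>x. (-1) * v x)"
    by (rule Hm1_add[OF F assms(2) v'])
  also have "F (\<lambda>x. (-1) * v x) = (-1) * F v" by (rule Hm1_scale[OF F assms(3)])
  finally have "F (\<lambda>x. u x + (-1) * v x) = F u - F v" by simp
  moreover have "\<bar>F (\<lambda>x. u x + (-1) * v x)\<bar> \<le> 0" using K[OF w(1)] w by (simp add: H10_norm_eq)
  ultimately show ?thesis by simp
qed

lemma Hm1_bdd_above:
  assumes "F \<in> Hm1 G"
  shows "bdd_above ((\<lambda>v. \<bar>F v\<bar>) ` {v \<in> H10 G. H1_norm G v \<le> 1})"
proof -
  obtain K where K: "\<And>w. w \<in> H10 G \<Longrightarrow> \<bar>F w\<bar> \<le> K * H1_norm G w" using assms unfolding Hm1_def by blast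
  show ?thesis
  proof (rule bdd_aboveI2)
    fix y assume y: "y \<in> {v \<in> H10 G. H1_norm G v \<le> 1}"
    have "\<bar>F y\<bar> \<le> K * H1_norm G y" using K y by simp
    also have "\<dots> \<le> \<bar>K\<bar> * 1" using y by (intro mult_mono) (auto simp: H10_norm_eq)
    finally show "\<bar>F y\<bar> \<le> \<bar>K\<bar>" by simp
  qed
qed

lemma Hm1_norm_nonneg:
  assumes "F \<in> Hm1 G" shows "0 \<le> Hm1_norm G F"
proof -
  have "\<bar>F (\<lambda>x. 0)\<bar> \<le> Hm1_norm G F"
    unfolding Hm1_norm_def using H10_zero by (intro cSUP_upper Hm1_bdd_above[OF assms]) (simp add: H10_norm_eq)
  then show ?thesis by (rule order_trans[OF abs_ge_zero])
qed

text \<open>Scaling to the unit ball; when the jet is zero, the bound in the definition of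
  \<open>Hm1 G\<close> already gives \<open>F v = 0\<close>.\<close>

lemma Hm1_norm_bound:
  assumes F: "F \<in> Hm1 G" and v: "v \<in> H10 G"
  shows "\<bar>F v\<bar> \<le> Hm1_norm G F * norm (jet G v)"
proof -
  obtain K where K: "\<And>w. w \<in> H10 G \<Longrightarrow> \<bar>F w\<bar> \<le> K * H1_norm G w" using F unfolding Hm1_def by blast
  show ?thesis
  proof (cases "jet G v = 0")
    case True
    then show ?thesis using K[OF v] v by (simp add: H10_norm_eq)
  next
    case False
    let ?n = "norm (jet G v)"
    let ?w = "\<lambda>x. (1 / ?n) * v x"
    have w: "?w \<in> H10 G" "H1_norm G ?w \<le> 1"
      using H10_scale[OF v, of "1 / ?n"] False by (simp_all add: H10_norm_eq)
    have "\<bar>F ?w\<bar> \<le> Hm1_norm G F"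
      unfolding Hm1_norm_def using w by (intro cSUP_upper Hm1_bdd_above[OF F]) auto
    then have "\<bar>(1 / ?n) * F v\<bar> \<le> Hm1_norm G F" by (simp only: Hm1_scale[OF F v])
    then show ?thesis using False by (simp add: abs_mult pos_divide_le_eq)
  qed
qed

text \<open>The product with \<open>\<eta>\<close> must stay in \<open>H10 G\<close> for the
  functional to be given by \<open>div_form\<close>, and its norm bound then makes the functional
  bounded.\<close>

lemma M_op_Hm1:
  assumes b: "coeff_bounded G b" and u: "u \<in> H10 G"
    and \<eta>: "\<And>v. v \<in> H10 G \<Longrightarrow> (\<lambda>x. \<eta> x * v x) \<in> H10 G"
      "\<And>v. v \<in> H10 G \<Longrightarrow> norm (jet G (\<lambda>x. \<eta> x * v x)) \<le> K * norm (jet G v)"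
  shows "M_op G b \<eta> u \<in> Hm1 G"
proof -
  interpret B: bounded_bilinear "div_form G b" by (rule bounded_bilinear_div_form[OF b])
  have M: "M_op G b \<eta> u v = - div_form G b (jet G u) (jet G (\<lambda>x. \<eta> x * v x))" if "v \<in> H10 G" for v
    unfolding M_op_def by (rule div_op_eq[OF b u \<eta>(1)[OF that]])
  obtain c where c: "c \<ge> 0" "\<And>p q. norm (div_form G b p q) \<le> norm p * norm q * c"
    using B.nonneg_bounded by blast
  show ?thesis
    unfolding Hm1_def mem_Collect_eq
  proof (intro conjI ballI allI)
    fix v w assume v: "v \<in> H10 G" and w: "w \<in> H10 G"
    show "M_op G b \<eta> u (\<lambda>x. v x + w x) = M_op G b \<eta> u v + M_op G b \<eta> u w"
      using H10_add(2)[OF \<eta>(1)[OF v] \<eta>(1)[OF w]]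
      by (simp add: M H10_add(1) v w distrib_left B.add_right)
  next
    fix r v assume v: "v \<in> H10 G"
    show "M_op G b \<eta> u (\<lambda>x. r * v x) = r * M_op G b \<eta> u v"
      using H10_scale(2)[OF \<eta>(1)[OF v], of r]
      by (simp add: M H10_scale(1) v mult.left_commute B.scaleR_right)
  next
    show "\<exists>K. \<forall>v\<in>H10 G. \<bar>M_op G b \<eta> u v\<bar> \<le> K * H1_norm G v"
    proof (intro exI ballI)
      fix v assume v: "v \<in> H10 G"
      have "\<bar>M_op G b \<eta> u v\<bar> \<le> norm (jet G u) * norm (jet G (\<lambda>x. \<eta> x * v x)) * c"
        using c(2)[of "jet G u" "jet G (\<lambda>x. \<eta> x * v x)"] by (simp add: M[OF v])
      also have "\<dots> \<le> norm (jet G u) * (K * norm (jet G v)) * c"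
        using \<eta>(2)[OF v] c(1) by (intro mult_right_mono mult_left_mono) auto
      finally show "\<bar>M_op G b \<eta> u v\<bar> \<le> (norm (jet G u) * K * c) * H1_norm G v"
        using v by (simp add: H10_norm_eq mult_ac)
    qed
  qed
qed

end

section \<open>Coercivity and inversion of A\<close>

locale elliptic = bounded_open G for G :: "(real^'n) set" +
  fixes a :: "'n \<Rightarrow> 'n \<Rightarrow> real^'n \<Rightarrow> real" and A\<^sub>1 :: real
  assumes a_bounded: "coeff_bounded G a" and A1_pos: "0 < A\<^sub>1"
    and a_elliptic: "\<And>x y. x \<in> G \<Longrightarrow> A\<^sub>1 * (norm y)\<^sup>2 \<le> (\<Sum>i\<in>UNIV. \<Sum>j\<in>UNIV. a i j x * y $ i * y $ j)"
begin

text \<open>Pointwise ellipticity is applied to the gradient vector and integrated; outside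
  \<open>G\<close> both integrands vanish.\<close>

lemma div_form_gradient_coercive:
  assumes u: "u \<in> H10 G"
  shows "A\<^sub>1 * (norm (snd (jet G u)))\<^sup>2 \<le> div_form G a (jet G u) (jet G u)"
proof -
  define D where "D i x = indicator G x * weak_partial G i u x" for i x
  let ?a = "\<lambda>i j x. indicator G x * a i j x"
  have D: "D i \<in> sqint" for i
    using H1_imp_L2(2)[OF H10_imp_jet(1)[OF u], of i] by (simp add: L2_iff D_def[abs_def])
  have jet: "snd (jet G u) $ i = abs_l2 (D i)" for i
    by (simp add: jet_def l2_class_def D_def[abs_def])
  have aD: "(\<lambda>x. ?a i j x * D j x) \<in> sqint" "mult_l2 (?a i j) (abs_l2 (D j)) = abs_l2 (\<lambda>x. ?a i j x * D j x)" for i j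
  proof -
    obtain c where c: "\<And>x. \<bar>?a i j x\<bar> \<le> c" using coeff_boundedD(2)[OF a_bounded] by blast
    show "(\<lambda>x. ?a i j x * D j x) \<in> sqint" "mult_l2 (?a i j) (abs_l2 (D j)) = abs_l2 (\<lambda>x. ?a i j x * D j x)"
      using sqint_bounded_mult[OF coeff_boundedD(1)[OF a_bounded] c D]
        mult_l2_abs[OF coeff_boundedD(1)[OF a_bounded] c D] by auto
  qed
  have int: "integrable lebesgue (\<lambda>x. ?a i j x * D j x * D i x)" for i j
    by (rule sqint_mult_integrable[OF aD(1) D])
  have "A\<^sub>1 * (norm (snd (jet G u)))\<^sup>2 = A\<^sub>1 * (\<Sum>i\<in>UNIV. LINT x|lebesgue. (D i x)\<^sup>2)"
    by (simp add: norm_vec_def L2_set_def sum_nonneg jet norm_abs_l2 D integral_nonneg_AE)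
  also have "\<dots> = (LINT x|lebesgue. A\<^sub>1 * (\<Sum>i\<in>UNIV. (D i x)\<^sup>2))"
    using sqint_square_integrable[OF D] by (simp add: Bochner_Integration.integral_sum)
  also have "\<dots> \<le> (LINT x|lebesgue. (\<Sum>i\<in>UNIV. \<Sum>j\<in>UNIV. ?a i j x * D j x * D i x))"
  proof (rule integral_mono)
    fix x
    show "A\<^sub>1 * (\<Sum>i\<in>UNIV. (D i x)\<^sup>2) \<le> (\<Sum>i\<in>UNIV. \<Sum>j\<in>UNIV. ?a i j x * D j x * D i x)"
    proof (cases "x \<in> G")
      case True
      have "(norm (\<chi> i. D i x))\<^sup>2 = (\<Sum>i\<in>UNIV. (D i x)\<^sup>2)"
        by (simp add: norm_vec_def L2_set_def sum_nonneg)
      then show ?thesis using a_elliptic[OF True, of "\<chi> i. D i x"] True by (simp add: mult_ac)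
    qed (simp add: D_def)
  qed (use int sqint_square_integrable[OF D] in \<open>auto intro!: Bochner_Integration.integrable_sum\<close>)
  also have "\<dots> = div_form G a (jet G u) (jet G u)"
    using int by (simp add: div_form_def jet aD D inner_abs_l2 Bochner_Integration.integral_sum)
  finally show ?thesis .
qed

text \<open>The squared norm of a jet is the sum of the squares of its two components, and Poincare
  bounds it by \<open>k + 1\<close> times the gradient part; hence the constant
  \<open>A\<^sub>1 / (k + 1)\<close>.\<close>

lemma coercive:
  obtains c where "c > 0" "\<And>p. p \<in> H10_jets G \<Longrightarrow> c * (norm p)\<^sup>2 \<le> div_form G a p p"
proof -
  obtain k where k: "k \<ge> 0" "\<And>p. p \<in> H10_jets G \<Longrightarrow> (norm (fst p))\<^sup>2 \<le> k * (norm (snd p))\<^sup>2"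
    using H10_Poincare by blast
  show ?thesis
  proof (rule that[of "A\<^sub>1 / (k + 1)"])
    show "A\<^sub>1 / (k + 1) > 0" using A1_pos k(1) by simp
    fix p assume p: "p \<in> H10_jets G"
    then obtain u where u: "u \<in> H10 G" "jet G u = p" by (rule H10_jetsE)
    have "(norm p)\<^sup>2 = (norm (fst p))\<^sup>2 + (norm (snd p))\<^sup>2"
      using norm_Pair[of "fst p" "snd p"] by simp
    also have "\<dots> \<le> (k + 1) * (norm (snd p))\<^sup>2" using k(2)[OF p] by (simp add: distrib_right)
    finally have "A\<^sub>1 / (k + 1) * (norm p)\<^sup>2 \<le> A\<^sub>1 / (k + 1) * ((k + 1) * (norm (snd p))\<^sup>2)"
      using A1_pos k(1) by (intro mult_left_mono) auto
    also have "\<dots> = A\<^sub>1 * (norm (snd p))\<^sup>2" using k(1) by simp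
    also have "\<dots> \<le> div_form G a p p" using div_form_gradient_coercive[OF u(1)] u(2) by simp
    finally show "A\<^sub>1 / (k + 1) * (norm p)\<^sup>2 \<le> div_form G a p p" .
  qed
qed

lemma A_op_eq: "u \<in> H10 G \<Longrightarrow> v \<in> H10 G \<Longrightarrow> A_op G a u v = div_form G a (jet G u) (jet G v)"
  by (simp add: A_op_def div_op_eq[OF a_bounded])

text \<open>Lax-Milgram works on jets while \<open>F\<close> takes functions. The map
  \<open>r\<close> picks a function for each jet, and since \<open>F\<close> factors through jets,
  \<open>F\<close> after \<open>r\<close> is linear although \<open>r\<close> is not.\<close>

lemma A_op_surj:
  assumes F: "F \<in> Hm1 G"
  shows "\<exists>w\<in>H10 G. \<forall>v\<in>H10 G. A_op G a w v = F v"
proof -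
  obtain c where c: "c > 0" "\<And>p. p \<in> H10_jets G \<Longrightarrow> c * (norm p)\<^sup>2 \<le> div_form G a p p"
    using coercive by blast
  define r where "r p = (SOME u. u \<in> H10 G \<and> jet G u = p)" for p
  have r: "r p \<in> H10 G \<and> jet G (r p) = p" if "p \<in> H10_jets G" for p
  proof -
    have "\<exists>u. u \<in> H10 G \<and> jet G u = p" using that by (elim H10_jetsE) auto
    from someI_ex[OF this] show ?thesis unfolding r_def .
  qed
  have F_r: "F (r p) = F v" if v: "v \<in> H10 G" "jet G v = p" for p v
  proof -
    have "p \<in> H10_jets G" using H10_imp_jet(2)[OF v(1)] v(2) by simp
    then show ?thesis using r[of p] v by (intro Hm1_jet_cong[OF F _ v(1)]) simp_all
  qed
  have "\<exists>w\<in>H10_jets G. \<forall>v\<in>H10_jets G. div_form G a w v = F (r v)"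
  proof (rule Lax_Milgram_subspace[OF closed_H10_jets subspace_H10_jets
        bounded_bilinear_div_form[OF a_bounded] c, where B = "Hm1_norm G F"])
    fix p q assume p: "p \<in> H10_jets G" and q: "q \<in> H10_jets G"
    have "F (r (p + q)) = F (\<lambda>x. r p x + r q x)"
      using r[OF p] r[OF q] by (intro F_r) (auto simp: H10_add)
    also have "\<dots> = F (r p) + F (r q)" using r[OF p] r[OF q] by (intro Hm1_add[OF F]) auto
    finally show "F (r (p + q)) = F (r p) + F (r q)" .
  next
    fix t p assume p: "p \<in> H10_jets G"
    have "F (r (t *\<^sub>R p)) = F (\<lambda>x. t * r p x)" using r[OF p] by (intro F_r) (auto simp: H10_scale)
    also have "\<dots> = t * F (r p)" using r[OF p] by (intro Hm1_scale[OF F]) auto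
    finally show "F (r (t *\<^sub>R p)) = t * F (r p)" .
  next
    fix p assume p: "p \<in> H10_jets G"
    show "\<bar>F (r p)\<bar> \<le> Hm1_norm G F * norm p" using Hm1_norm_bound[OF F, of "r p"] r[OF p] by simp
  qed
  then obtain p where p: "p \<in> H10_jets G" "\<And>v. v \<in> H10_jets G \<Longrightarrow> div_form G a p v = F (r v)" by blast
  have "A_op G a (r p) v = F v" if v: "v \<in> H10 G" for v
    using p(2)[OF H10_imp_jet(2)[OF v]] r[OF p(1)] F_r[OF v] by (simp add: A_op_eq v)
  then show ?thesis using r[OF p(1)] by blast
qed

text \<open>The two functionals are tested with a function whose jet is the difference
  \<open>d\<close>; coercivity then gives \<open>d = 0\<close>.\<close>

lemma A_op_inj:
  assumes u: "u \<in> H10 G" and w: "w \<in> H10 G"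
    and eq: "\<And>v. v \<in> H10 G \<Longrightarrow> A_op G a u v = A_op G a w v"
  shows "jet G u = jet G w"
proof -
  interpret B: bounded_bilinear "div_form G a" by (rule bounded_bilinear_div_form[OF a_bounded])
  obtain c where c: "c > 0" "\<And>p. p \<in> H10_jets G \<Longrightarrow> c * (norm p)\<^sup>2 \<le> div_form G a p p"
    using coercive by blast
  define d where "d = jet G u - jet G w"
  have d: "d \<in> H10_jets G"
    unfolding d_def using H10_imp_jet(2) u w subspace_diff[OF subspace_H10_jets] by blast
  then obtain v where v: "v \<in> H10 G" "jet G v = d" by (rule H10_jetsE)
  have "div_form G a d d = 0"
    using eq[OF v(1)] by (simp add: A_op_eq u w v d_def B.diff_left)
  then have "c * (norm d)\<^sup>2 \<le> 0" using c(2)[OF d] by simp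
  then have "d = 0" using c(1) by (simp add: mult_le_0_iff)
  then show ?thesis by (simp add: d_def)
qed

lemma A_inv:
  assumes "F \<in> Hm1 G"
  shows "A_inv G a F \<in> H10 G" "\<And>v. v \<in> H10 G \<Longrightarrow> A_op G a (A_inv G a F) v = F v"
proof -
  have "\<exists>w. w \<in> H10 G \<and> (\<forall>v\<in>H10 G. A_op G a w v = F v)" using A_op_surj[OF assms] by blast
  from someI_ex[OF this] have "A_inv G a F \<in> H10 G \<and> (\<forall>v\<in>H10 G. A_op G a (A_inv G a F) v = F v)"
    unfolding A_inv_def .
  then show "A_inv G a F \<in> H10 G" "\<And>v. v \<in> H10 G \<Longrightarrow> A_op G a (A_inv G a F) v = F v" by auto
qed

text \<open>Testing the equation with the solution w itself gives c ||w||^2 <= F w <= ||F|| ||w||,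
  with c the coercivity constant.\<close>

lemma A_inv_bound:
  obtains c where "c > 0" "\<And>F. F \<in> Hm1 G \<Longrightarrow> norm (jet G (A_inv G a F)) \<le> Hm1_norm G F / c"
proof -
  obtain c where c: "c > 0" "\<And>p. p \<in> H10_jets G \<Longrightarrow> c * (norm p)\<^sup>2 \<le> div_form G a p p"
    using coercive by blast
  show ?thesis
  proof (rule that[OF c(1)])
    fix F assume F: "F \<in> Hm1 G"
    let ?w = "A_inv G a F"
    have w: "?w \<in> H10 G" by (rule A_inv(1)[OF F])
    have "c * (norm (jet G ?w))\<^sup>2 \<le> div_form G a (jet G ?w) (jet G ?w)" by (rule c(2)[OF H10_imp_jet(2)[OF w]])
    also have "\<dots> = F ?w" using A_inv(2)[OF F w] by (simp add: A_op_eq w)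
    also have "\<dots> \<le> Hm1_norm G F * norm (jet G ?w)" using Hm1_norm_bound[OF F w] by simp
    finally have le: "c * (norm (jet G ?w))\<^sup>2 \<le> Hm1_norm G F * norm (jet G ?w)" .
    from Hm1_norm_nonneg[OF F] c(1) le show "norm (jet G ?w) \<le> Hm1_norm G F / c"
      by (cases "jet G ?w = 0") (auto simp: power2_eq_square field_simps)
  qed
qed

end

section \<open>Multi-indices\<close>

lemma mi_size_superset:
  assumes "finite S" "Poly_Mapping.keys \<alpha> \<subseteq> S"
  shows "mi_size \<alpha> = (\<Sum>k\<in>S. Poly_Mapping.lookup \<alpha> k)"
  unfolding mi_size_def by (rule sum.mono_neutral_left) (use assms in \<open>auto simp: in_keys_iff\<close>)

lemma lookup_minus_single:
  "Poly_Mapping.lookup (\<alpha> - Poly_Mapping.single k (m::nat)) j =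
     (if j = k then Poly_Mapping.lookup \<alpha> k - m else Poly_Mapping.lookup \<alpha> j)"
  by (simp add: lookup_minus lookup_single)

lemma keys_minus_single: "Poly_Mapping.keys (\<alpha> - Poly_Mapping.single k (m::nat)) \<subseteq> Poly_Mapping.keys \<alpha>"
  by (auto simp: in_keys_iff lookup_minus_single split: if_splits)

lemma mi_size_minus_single:
  assumes "k \<in> Poly_Mapping.keys \<alpha>"
  shows "mi_size \<alpha> = Suc (mi_size (\<alpha> - Poly_Mapping.single k 1))"
proof -
  have fin: "finite (Poly_Mapping.keys \<alpha>)" by simp
  have "0 < Poly_Mapping.lookup \<alpha> k" using assms by (simp add: in_keys_iff)
  then show ?thesis
    using assms unfolding mi_size_superset[OF fin order_refl] mi_size_superset[OF fin keys_minus_single[of \<alpha> k 1]]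
    by (simp add: sum.remove[OF fin assms] lookup_minus_single)
qed

lemma mi_size_eq_0_iff: "mi_size \<alpha> = 0 \<longleftrightarrow> \<alpha> = 0"
proof
  assume "mi_size \<alpha> = 0"
  then show "\<alpha> = 0" by (intro poly_mapping_eqI) (auto simp: mi_size_def in_keys_iff)
qed (simp add: mi_size_def)

lemma add_minus_single:
  assumes "k \<in> Poly_Mapping.keys \<alpha>"
  shows "\<alpha> - Poly_Mapping.single k (1::nat) + Poly_Mapping.single k 1 = \<alpha>"
  using assms by (intro poly_mapping_eqI) (auto simp: lookup_add lookup_minus_single lookup_single in_keys_iff when_def)

text \<open>Passing from alpha - eps_k to alpha multiplies the numerator of the weight by
  \<open>q k\<close> and the factorial under the root by |alpha|.\<close>

lemma chaos_weight_square_minus_single: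
  assumes k: "k \<in> Poly_Mapping.keys \<alpha>"
  shows "(chaos_weight q \<alpha>)\<^sup>2 * real (mi_size \<alpha>) = (q k)\<^sup>2 * (chaos_weight q (\<alpha> - Poly_Mapping.single k 1))\<^sup>2"
proof -
  let ?\<beta> = "\<alpha> - Poly_Mapping.single k (1::nat)"
  have fin: "finite (Poly_Mapping.keys \<alpha>)" by simp
  have "(\<Prod>j\<in>Poly_Mapping.keys ?\<beta>. q j ^ Poly_Mapping.lookup ?\<beta> j) = (\<Prod>j\<in>Poly_Mapping.keys \<alpha>. q j ^ Poly_Mapping.lookup ?\<beta> j)"
    by (rule prod.mono_neutral_left[OF fin keys_minus_single]) (auto simp: in_keys_iff)
  also have "q k * \<dots> = (\<Prod>j\<in>Poly_Mapping.keys \<alpha>. q j ^ Poly_Mapping.lookup \<alpha> j)"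
  proof -
    have "0 < Poly_Mapping.lookup \<alpha> k" using k by (simp add: in_keys_iff)
    then have "q k * q k ^ (Poly_Mapping.lookup \<alpha> k - 1) = q k ^ Poly_Mapping.lookup \<alpha> k"
      by (metis Suc_diff_1 power_Suc)
    then show ?thesis
      by (simp add: prod.remove[OF fin k] lookup_minus_single mult.assoc[symmetric])
  qed
  finally have p: "(\<Prod>j\<in>Poly_Mapping.keys \<alpha>. q j ^ Poly_Mapping.lookup \<alpha> j)
      = q k * (\<Prod>j\<in>Poly_Mapping.keys ?\<beta>. q j ^ Poly_Mapping.lookup ?\<beta> j)" by simp
  have "real (fact (mi_size \<alpha>)) = real (mi_size \<alpha>) * fact (mi_size ?\<beta>)" "real (mi_size \<alpha>) \<noteq> 0"
    unfolding mi_size_minus_single[OF k] by (simp_all add: distrib_right)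
  then show ?thesis
    unfolding chaos_weight_def p by (simp add: power_divide power_mult_distrib)
qed

lemma chaos_weight_0: "chaos_weight q 0 = 1"
  by (simp add: chaos_weight_def mi_size_def)

text \<open>One level is compared with the previous one. After exchanging the sums, lowering by
  eps_k maps the indices that contain k injectively into the previous level, so each k contributes
  at most \<open>x k\<close> times the bound for that level.\<close>

lemma multi_index_level_sum_le:
  fixes t :: "multi_index \<Rightarrow> real" and x :: "nat \<Rightarrow> real"
  assumes t: "\<And>\<alpha>. 0 \<le> t \<alpha>" and x: "\<And>k. 0 \<le> x k" "summable x"
    and step: "\<And>\<alpha>. \<alpha> \<noteq> 0 \<Longrightarrow> t \<alpha> \<le> (\<Sum>k\<in>Poly_Mapping.keys \<alpha>. x k * t (\<alpha> - Poly_Mapping.single k 1))"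
  shows "finite F \<Longrightarrow> (\<And>\<alpha>. \<alpha> \<in> F \<Longrightarrow> mi_size \<alpha> = n) \<Longrightarrow> sum t F \<le> suminf x ^ n * t 0"
proof (induction n arbitrary: F)
  case 0
  then have "F \<subseteq> {0}" by (auto simp: mi_size_eq_0_iff)
  then have "sum t F \<le> sum t {0}" using t by (intro sum_mono2) auto
  then show ?case by simp
next
  case (Suc n)
  let ?e = "\<lambda>k. Poly_Mapping.single k (1::nat)"
  define K where "K = (\<Union>\<alpha>\<in>F. Poly_Mapping.keys \<alpha>)"
  have K: "finite K" using Suc.prems by (auto simp: K_def)
  define S where "S k = {\<alpha>\<in>F. k \<in> Poly_Mapping.keys \<alpha>}" for k
  have "sum t F \<le> (\<Sum>\<alpha>\<in>F. \<Sum>k\<in>Poly_Mapping.keys \<alpha>. x k * t (\<alpha> - ?e k))"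
    using Suc.prems by (intro sum_mono step) (auto simp: mi_size_eq_0_iff[symmetric])
  also have "\<dots> = (\<Sum>\<alpha>\<in>F. \<Sum>k\<in>{k\<in>K. k \<in> Poly_Mapping.keys \<alpha>}. x k * t (\<alpha> - ?e k))"
    by (intro sum.cong) (auto simp: K_def)
  also have "\<dots> = (\<Sum>k\<in>K. \<Sum>\<alpha>\<in>S k. x k * t (\<alpha> - ?e k))"
    unfolding S_def by (rule sum.swap_restrict[OF Suc.prems(1) K])
  also have "\<dots> \<le> (\<Sum>k\<in>K. x k * (suminf x ^ n * t 0))"
  proof (rule sum_mono)
    fix k
    \<comment> \<open>Adding eps_k back undoes the subtraction when k occurs in the index; truncated
      subtraction would not be injective elsewhere.\<close>
    have inj: "inj_on (\<lambda>\<alpha>. \<alpha> - ?e k) (S k)"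
      by (rule inj_onI) (metis (mono_tags, lifting) S_def add_minus_single mem_Collect_eq)
    have "(\<Sum>\<alpha>\<in>S k. t (\<alpha> - ?e k)) = sum t ((\<lambda>\<alpha>. \<alpha> - ?e k) ` S k)"
      by (simp add: sum.reindex[OF inj] o_def del: One_nat_def)
    also have "\<dots> \<le> suminf x ^ n * t 0"
    proof (rule Suc.IH)
      show "finite ((\<lambda>\<alpha>. \<alpha> - ?e k) ` S k)" using Suc.prems by (simp add: S_def)
      show "mi_size \<beta> = n" if "\<beta> \<in> (\<lambda>\<alpha>. \<alpha> - ?e k) ` S k" for \<beta>
        using that Suc.prems(2) mi_size_minus_single[of k] by (force simp: S_def)
    qed
    finally show "(\<Sum>\<alpha>\<in>S k. x k * t (\<alpha> - ?e k)) \<le> x k * (suminf x ^ n * t 0)"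
      using x(1) by (simp add: sum_distrib_left[symmetric] mult_left_mono)
  qed
  also have "\<dots> = sum x K * (suminf x ^ n * t 0)" by (simp add: sum_distrib_right)
  also have "\<dots> \<le> suminf x * (suminf x ^ n * t 0)"
    using x t K by (intro mult_right_mono sum_le_suminf mult_nonneg_nonneg zero_le_power suminf_nonneg) auto
  finally show ?case by (simp add: mult.assoc)
qed

text \<open>A finite set of multi-indices is split by size, and the level bounds add up to at most a
  geometric series. The bound is uniform over finite sets.\<close>

lemma multi_index_summable:
  fixes t :: "multi_index \<Rightarrow> real" and x :: "nat \<Rightarrow> real"
  assumes t: "\<And>\<alpha>. 0 \<le> t \<alpha>" and x: "\<And>k. 0 \<le> x k" "summable x" "suminf x < 1"
    and step: "\<And>\<alpha>. \<alpha> \<noteq> 0 \<Longrightarrow> t \<alpha> \<le> (\<Sum>k\<in>Poly_Mapping.keys \<alpha>. x k * t (\<alpha> - Poly_Mapping.single k 1))"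
  shows "t summable_on UNIV" "infsum t UNIV \<le> t 0 / (1 - suminf x)"
proof -
  have X0: "0 \<le> suminf x" using x by (intro suminf_nonneg)
  have bound: "sum t F \<le> t 0 / (1 - suminf x)" if F: "finite F" for F
  proof -
    \<comment> \<open>The inserted 0 gives the maximum a meaning for empty \<open>F\<close>.\<close>
    define N where "N = Suc (Max (insert 0 (mi_size ` F)))"
    have N: "mi_size \<alpha> < N" if "\<alpha> \<in> F" for \<alpha>
      unfolding N_def using that F by (intro le_imp_less_Suc Max_ge) auto
    have "sum t F = (\<Sum>n<N. sum t {\<alpha>\<in>F. mi_size \<alpha> = n})"
      by (rule sum.group[symmetric]) (use F N in auto)
    also have "\<dots> \<le> (\<Sum>n<N. suminf x ^ n * t 0)"
      using F by (intro sum_mono multi_index_level_sum_le[OF t x(1,2) step]) auto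
    also have "\<dots> = (\<Sum>n<N. suminf x ^ n) * t 0" by (simp add: sum_distrib_right)
    also have "\<dots> \<le> (1 / (1 - suminf x)) * t 0"
    proof (rule mult_right_mono[OF _ t])
      have "(\<Sum>n<N. suminf x ^ n) \<le> suminf (\<lambda>n. suminf x ^ n)"
        using X0 x(3) by (intro sum_le_suminf summable_geometric) auto
      also have "\<dots> = 1 / (1 - suminf x)" using X0 x(3) by (intro suminf_geometric) auto
      finally show "(\<Sum>n<N. suminf x ^ n) \<le> 1 / (1 - suminf x)" .
    qed
    finally show ?thesis by simp
  qed
  show s: "t summable_on UNIV"
    by (rule nonneg_bdd_above_summable_on) (use t bound in \<open>auto intro!: bdd_aboveI2\<close>)
  show "infsum t UNIV \<le> t 0 / (1 - suminf x)"
    by (rule infsum_le_finite_sums[OF s bound])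
qed

text \<open>The recursion for the coefficients, carried out on functions rather than classes;
  \<open>T k\<close> stands for the inverse of A after M_k and \<open>w\<close> for the coefficient
  at zero.\<close>

function chaos_coeff ::
  "(nat \<Rightarrow> ('a \<Rightarrow> real) \<Rightarrow> 'a \<Rightarrow> real) \<Rightarrow> ('a \<Rightarrow> real) \<Rightarrow> multi_index \<Rightarrow> 'a \<Rightarrow> real"
  where
  "chaos_coeff T w \<alpha> = (if \<alpha> = 0 then w else (\<lambda>x. \<Sum>k\<in>Poly_Mapping.keys \<alpha>.
     (- sqrt (real (Poly_Mapping.lookup \<alpha> k))) * T k (chaos_coeff T w (\<alpha> - Poly_Mapping.single k 1)) x))"
  by pat_completeness auto
termination
  by (relation "Wellfounded.measure (\<lambda>(T, w, \<alpha>). mi_size \<alpha>)") (auto simp: mi_size_minus_single)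

declare chaos_coeff.simps[simp del]

section \<open>The chaos expansion of the solution\<close>

context bounded_open
begin

lemma H10_sum:
  assumes "\<And>i. i \<in> I \<Longrightarrow> u i \<in> H10 G"
  shows "(\<lambda>x. \<Sum>i\<in>I. c i * u i x) \<in> H10 G \<and> jet G (\<lambda>x. \<Sum>i\<in>I. c i * u i x) = (\<Sum>i\<in>I. c i *\<^sub>R jet G (u i))"
  using assms
proof (induction I rule: infinite_finite_induct)
  case (insert i I)
  then have "(\<lambda>x. c i * u i x) \<in> H10 G" "jet G (\<lambda>x. c i * u i x) = c i *\<^sub>R jet G (u i)"
    using H10_scale by auto
  then show ?case using insert H10_add[of "\<lambda>x. c i * u i x" "\<lambda>x. \<Sum>i\<in>I. c i * u i x"] by simp
qed (simp_all add: H10_zero)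

end

locale chaos_problem = elliptic G a A\<^sub>1 for G :: "(real^'n) set" and a A\<^sub>1 +
  fixes \<sigma> :: "'n \<Rightarrow> 'n \<Rightarrow> real^'n \<Rightarrow> real" and h :: "nat \<Rightarrow> real^'n \<Rightarrow> real" and C :: "nat \<Rightarrow> real"
  assumes \<sigma>_bounded: "coeff_bounded G \<sigma>"
    and h_mult: "\<exists>K. \<forall>v\<in>H10 G. (\<lambda>x. h k x * v x) \<in> H10 G \<and>
                    norm (jet G (\<lambda>x. h k x * v x)) \<le> K * norm (jet G v)"
    and C_bound: "v \<in> H10 G \<Longrightarrow> H1_norm G (A_inv G a (M_op G \<sigma> (h k) v)) \<le> C k * H1_norm G v"
begin

definition AinvM :: "nat \<Rightarrow> (real^'n \<Rightarrow> real) \<Rightarrow> real^'n \<Rightarrow> real" where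
  "AinvM k v = A_inv G a (M_op G \<sigma> (h k) v)"

definition sol_coeff :: "((real^'n \<Rightarrow> real) \<Rightarrow> real) \<Rightarrow> multi_index \<Rightarrow> real^'n \<Rightarrow> real" where
  "sol_coeff f = chaos_coeff AinvM (A_inv G a f)"

lemma M_op_in_Hm1: "u \<in> H10 G \<Longrightarrow> M_op G \<sigma> (h k) u \<in> Hm1 G"
proof -
  assume u: "u \<in> H10 G"
  obtain K where K: "\<And>v. v \<in> H10 G \<Longrightarrow> (\<lambda>x. h k x * v x) \<in> H10 G"
      "\<And>v. v \<in> H10 G \<Longrightarrow> norm (jet G (\<lambda>x. h k x * v x)) \<le> K * norm (jet G v)"
    using h_mult[of k] by meson
  show ?thesis by (rule M_op_Hm1[OF \<sigma>_bounded u K])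
qed

lemma AinvM:
  assumes "v \<in> H10 G"
  shows "AinvM k v \<in> H10 G" "w \<in> H10 G \<Longrightarrow> A_op G a (AinvM k v) w = M_op G \<sigma> (h k) v w"
    "norm (jet G (AinvM k v)) \<le> C k * norm (jet G v)"
proof -
  show AinvM: "AinvM k v \<in> H10 G" unfolding AinvM_def by (rule A_inv(1)[OF M_op_in_Hm1[OF assms]])
  show "w \<in> H10 G \<Longrightarrow> A_op G a (AinvM k v) w = M_op G \<sigma> (h k) v w"
    unfolding AinvM_def by (rule A_inv(2)[OF M_op_in_Hm1[OF assms]])
  show "norm (jet G (AinvM k v)) \<le> C k * norm (jet G v)"
    using C_bound[OF assms, of k] AinvM unfolding AinvM_def by (simp add: H10_norm_eq assms)
qed

text \<open>For the induction in \<open>solution_unique\<close>, where the lower coefficients of two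
  solutions are known to agree only as jets.\<close>

lemma M_op_jet_cong:
  assumes "u \<in> H10 G" "w \<in> H10 G" "jet G u = jet G w" "v \<in> H10 G"
  shows "M_op G \<sigma> (h k) u v = M_op G \<sigma> (h k) w v"
proof -
  have "(\<lambda>x. h k x * v x) \<in> H10 G" using h_mult[of k] assms(4) by blast
  then show ?thesis unfolding M_op_def using assms by (simp add: div_op_eq[OF \<sigma>_bounded])
qed

lemma sol_coeff_H10:
  assumes f: "f \<in> Hm1 G" shows "sol_coeff f \<alpha> \<in> H10 G"
proof (induction "mi_size \<alpha>" arbitrary: \<alpha> rule: less_induct)
  case less
  show ?case
  proof (cases "\<alpha> = 0")
    case True
    then show ?thesis using A_inv(1)[OF f] by (simp add: sol_coeff_def chaos_coeff.simps)
  next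
    case False
    have "AinvM k (sol_coeff f (\<alpha> - Poly_Mapping.single k 1)) \<in> H10 G" if "k \<in> Poly_Mapping.keys \<alpha>" for k
      using mi_size_minus_single[OF that] by (intro AinvM(1) less) simp
    then have "(\<lambda>x. \<Sum>k\<in>Poly_Mapping.keys \<alpha>. (- sqrt (real (Poly_Mapping.lookup \<alpha> k))) *
        AinvM k (sol_coeff f (\<alpha> - Poly_Mapping.single k 1)) x) \<in> H10 G"
      by (intro conjunct1[OF H10_sum])
    then show ?thesis using False unfolding sol_coeff_def by (subst chaos_coeff.simps) simp
  qed
qed

lemma sol_coeff_0: "sol_coeff f 0 = A_inv G a f"
  by (simp add: sol_coeff_def chaos_coeff.simps)

lemma jet_sol_coeff:
  assumes f: "f \<in> Hm1 G" and "\<alpha> \<noteq> 0"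
  shows "jet G (sol_coeff f \<alpha>) = (\<Sum>k\<in>Poly_Mapping.keys \<alpha>. (- sqrt (real (Poly_Mapping.lookup \<alpha> k))) *\<^sub>R
    jet G (AinvM k (sol_coeff f (\<alpha> - Poly_Mapping.single k 1))))"
proof -
  have "sol_coeff f \<alpha> = (\<lambda>x. \<Sum>k\<in>Poly_Mapping.keys \<alpha>. (- sqrt (real (Poly_Mapping.lookup \<alpha> k))) *
        AinvM k (sol_coeff f (\<alpha> - Poly_Mapping.single k 1)) x)"
    using assms(2) unfolding sol_coeff_def by (subst chaos_coeff.simps) simp
  then show ?thesis
    using conjunct2[OF H10_sum[of "Poly_Mapping.keys \<alpha>" "\<lambda>k. AinvM k (sol_coeff f (\<alpha> - Poly_Mapping.single k 1))"
          "\<lambda>k. - sqrt (real (Poly_Mapping.lookup \<alpha> k))"]] AinvM(1)[OF sol_coeff_H10[OF f]]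
    by metis
qed

lemma sol_coeff_is_solution:
  assumes f: "f \<in> Hm1 G" shows "is_solution G a \<sigma> h f (sol_coeff f)"
  unfolding is_solution_def
proof (intro conjI allI ballI)
  show "sol_coeff f \<alpha> \<in> H10 G" for \<alpha> by (rule sol_coeff_H10[OF f])
  fix \<alpha> v assume v: "v \<in> H10 G"
  interpret B: bounded_bilinear "div_form G a" by (rule bounded_bilinear_div_form[OF a_bounded])
  let ?u = "\<lambda>k. sol_coeff f (\<alpha> - Poly_Mapping.single k 1)"
  show "A_op G a (sol_coeff f \<alpha>) v + (\<Sum>k\<in>Poly_Mapping.keys \<alpha>. sqrt (real (Poly_Mapping.lookup \<alpha> k)) *
      M_op G \<sigma> (h k) (?u k) v) = (if \<alpha> = 0 then f v else 0)"
  proof (cases "\<alpha> = 0")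
    case True
    then show ?thesis using A_inv(2)[OF f v] by (simp add: sol_coeff_0)
  next
    case False
    have "A_op G a (sol_coeff f \<alpha>) v = (\<Sum>k\<in>Poly_Mapping.keys \<alpha>. - (sqrt (real (Poly_Mapping.lookup \<alpha> k)) *
        div_form G a (jet G (AinvM k (?u k))) (jet G v)))"
      by (simp add: A_op_eq[OF sol_coeff_H10[OF f] v] jet_sol_coeff[OF f False] B.sum_left B.minus_left B.scaleR_left del: One_nat_def)
    also have "\<dots> = (\<Sum>k\<in>Poly_Mapping.keys \<alpha>. - (sqrt (real (Poly_Mapping.lookup \<alpha> k)) * M_op G \<sigma> (h k) (?u k) v))"
      by (simp only: A_op_eq[OF AinvM(1)[OF sol_coeff_H10[OF f]] v, symmetric] AinvM(2)[OF sol_coeff_H10[OF f] v])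
    finally show ?thesis using False by (simp add: sum_negf)
  qed
qed

lemma is_solutionD:
  assumes "is_solution G a \<sigma> h f u"
  shows "u \<alpha> \<in> H10 G"
    and "v \<in> H10 G \<Longrightarrow> A_op G a (u \<alpha>) v + (\<Sum>k\<in>Poly_Mapping.keys \<alpha>. sqrt (real (Poly_Mapping.lookup \<alpha> k)) *
      M_op G \<sigma> (h k) (u (\<alpha> - Poly_Mapping.single k 1)) v) = (if \<alpha> = 0 then f v else 0)"
  using assms unfolding is_solution_def by simp_all

text \<open>The equation at alpha prescribes A u_alpha through coefficients of size |alpha| - 1,
  which agree by induction, and A is injective on jets.\<close>

lemma solution_unique:
  assumes u: "is_solution G a \<sigma> h f u" and w: "is_solution G a \<sigma> h f w"
  shows "jet G (u \<alpha>) = jet G (w \<alpha>)"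
proof (induction "mi_size \<alpha>" arbitrary: \<alpha> rule: less_induct)
  case less
  have uH: "u \<alpha> \<in> H10 G" and wH: "w \<alpha> \<in> H10 G" for \<alpha>
    by (rule is_solutionD(1)[OF u], rule is_solutionD(1)[OF w])
  show ?case
  proof (rule A_op_inj[OF uH wH])
    fix v assume v: "v \<in> H10 G"
    have eq: "A_op G a (u \<alpha>) v + (\<Sum>k\<in>Poly_Mapping.keys \<alpha>. sqrt (real (Poly_Mapping.lookup \<alpha> k)) *
          M_op G \<sigma> (h k) (u (\<alpha> - Poly_Mapping.single k 1)) v) =
        A_op G a (w \<alpha>) v + (\<Sum>k\<in>Poly_Mapping.keys \<alpha>. sqrt (real (Poly_Mapping.lookup \<alpha> k)) *
          M_op G \<sigma> (h k) (w (\<alpha> - Poly_Mapping.single k 1)) v)"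
      using is_solutionD(2)[OF u v, of \<alpha>] is_solutionD(2)[OF w v, of \<alpha>] by (rule trans[OF _ sym])
    have "M_op G \<sigma> (h k) (u (\<alpha> - Poly_Mapping.single k 1)) v = M_op G \<sigma> (h k) (w (\<alpha> - Poly_Mapping.single k 1)) v"
      if "k \<in> Poly_Mapping.keys \<alpha>" for k
      using mi_size_minus_single[OF that] by (intro M_op_jet_cong uH wH v less) simp
    then have "(\<Sum>k\<in>Poly_Mapping.keys \<alpha>. sqrt (real (Poly_Mapping.lookup \<alpha> k)) *
          M_op G \<sigma> (h k) (u (\<alpha> - Poly_Mapping.single k 1)) v) =
        (\<Sum>k\<in>Poly_Mapping.keys \<alpha>. sqrt (real (Poly_Mapping.lookup \<alpha> k)) *
          M_op G \<sigma> (h k) (w (\<alpha> - Poly_Mapping.single k 1)) v)"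
      by (intro sum.cong) auto
    with eq show "A_op G a (u \<alpha>) v = A_op G a (w \<alpha>) v" by simp
  qed
qed

text \<open>By the Cauchy-Schwarz inequality
  \<open>\<parallel>u\<^sub>\<alpha>\<parallel>\<^sup>2 \<le> (\<Sum>\<^sub>k \<alpha>\<^sub>k) (\<Sum>\<^sub>k C\<^sub>k\<^sup>2 \<parallel>u\<^bsub>\<alpha>-\<epsilon>\<^sub>k\<^esub>\<parallel>\<^sup>2)\<close>, and the factor \<open>|\<alpha>|\<close> is absorbed by the weight.\<close>

lemma weighted_sol_coeff_step:
  fixes q :: "nat \<Rightarrow> real"
  assumes f: "f \<in> Hm1 G" and "\<alpha> \<noteq> 0"
  defines "t \<equiv> \<lambda>\<alpha>. (chaos_weight q \<alpha>)\<^sup>2 * (norm (jet G (sol_coeff f \<alpha>)))\<^sup>2"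
  shows "t \<alpha> \<le> (\<Sum>k\<in>Poly_Mapping.keys \<alpha>. ((C k)\<^sup>2 * (q k)\<^sup>2) * t (\<alpha> - Poly_Mapping.single k 1))"
proof -
  let ?K = "Poly_Mapping.keys \<alpha>" and ?s = "\<lambda>k. sqrt (real (Poly_Mapping.lookup \<alpha> k))"
  define n where "n k = norm (jet G (sol_coeff f (\<alpha> - Poly_Mapping.single k 1)))" for k
  have "norm (jet G (sol_coeff f \<alpha>)) \<le> (\<Sum>k\<in>?K. ?s k * (C k * n k))"
    unfolding jet_sol_coeff[OF f assms(2)]
  proof (rule sum_norm_le)
    fix k
    show "norm ((- ?s k) *\<^sub>R jet G (AinvM k (sol_coeff f (\<alpha> - Poly_Mapping.single k 1)))) \<le> ?s k * (C k * n k)"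
      using AinvM(3)[OF sol_coeff_H10[OF f, of "\<alpha> - Poly_Mapping.single k 1"], of k] unfolding n_def
      by (simp add: mult_left_mono)
  qed
  then have "(norm (jet G (sol_coeff f \<alpha>)))\<^sup>2 \<le> (\<Sum>k\<in>?K. ?s k * (C k * n k))\<^sup>2"
    by (intro power_mono) auto
  also have "\<dots> \<le> (\<Sum>k\<in>?K. (?s k)\<^sup>2) * (\<Sum>k\<in>?K. (C k * n k)\<^sup>2)" by (rule Cauchy_Schwarz_ineq_sum)
  also have "(\<Sum>k\<in>?K. (?s k)\<^sup>2) = real (mi_size \<alpha>)" by (simp add: mi_size_def)
  finally have "t \<alpha> \<le> (chaos_weight q \<alpha>)\<^sup>2 * (real (mi_size \<alpha>) * (\<Sum>k\<in>?K. (C k * n k)\<^sup>2))"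
    unfolding t_def by (intro mult_left_mono) auto
  also have "\<dots> = (\<Sum>k\<in>?K. ((chaos_weight q \<alpha>)\<^sup>2 * real (mi_size \<alpha>)) * ((C k)\<^sup>2 * (n k)\<^sup>2))"
    by (simp add: sum_distrib_left power_mult_distrib mult.assoc)
  also have "\<dots> = (\<Sum>k\<in>?K. ((C k)\<^sup>2 * (q k)\<^sup>2) * t (\<alpha> - Poly_Mapping.single k 1))"
  proof (rule sum.cong[OF refl])
    fix k assume k: "k \<in> ?K"
    show "(chaos_weight q \<alpha>)\<^sup>2 * real (mi_size \<alpha>) * ((C k)\<^sup>2 * (n k)\<^sup>2) =
        (C k)\<^sup>2 * (q k)\<^sup>2 * t (\<alpha> - Poly_Mapping.single k 1)"
      unfolding chaos_weight_square_minus_single[OF k] t_def n_def by (simp only: mult_ac)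
  qed
  finally show ?thesis .
qed

theorem chaos_solution:
  assumes q: "summable (\<lambda>k. (C k)\<^sup>2 * (q k)\<^sup>2)" "suminf (\<lambda>k. (C k)\<^sup>2 * (q k)\<^sup>2) < 1"
  shows "\<exists>K::real. \<forall>f\<in>Hm1 G. \<exists>u\<in>RL2 (chaos_weight q) (H10 G) (H1_norm G).
           is_solution G a \<sigma> h f u \<and>
           RL2_norm (chaos_weight q) (H1_norm G) u \<le> K * Hm1_norm G f \<and>
           (\<forall>w\<in>RL2 (chaos_weight q) (H10 G) (H1_norm G).
              is_solution G a \<sigma> h f w \<longrightarrow> (\<forall>\<alpha>. ae_eq G (w \<alpha>) (u \<alpha>)))"
proof -
  define X where "X = suminf (\<lambda>k. (C k)\<^sup>2 * (q k)\<^sup>2)"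
  have X: "X < 1" using q by (simp add: X_def)
  obtain c where c: "c > 0" "\<And>F. F \<in> Hm1 G \<Longrightarrow> norm (jet G (A_inv G a F)) \<le> Hm1_norm G F / c"
    using A_inv_bound by blast
  show ?thesis
  proof (intro exI ballI)
    fix f assume f: "f \<in> Hm1 G"
    define t where "t \<alpha> = (chaos_weight q \<alpha>)\<^sup>2 * (norm (jet G (sol_coeff f \<alpha>)))\<^sup>2" for \<alpha>
    have t_eq: "(\<lambda>\<alpha>. (chaos_weight q \<alpha>)\<^sup>2 * (H1_norm G (sol_coeff f \<alpha>))\<^sup>2) = t"
      by (simp add: t_def[abs_def] H10_norm_eq[OF sol_coeff_H10[OF f]])
    have t: "t summable_on UNIV" "infsum t UNIV \<le> t 0 / (1 - X)"
      unfolding X_def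
      by (rule multi_index_summable[where x = "\<lambda>k. (C k)\<^sup>2 * (q k)\<^sup>2"];
          use q weighted_sol_coeff_step[OF f] in \<open>auto simp: t_def\<close>)+
    \<comment> \<open>The witness for \<open>K\<close> combines 1/c from the inverse of A with the
      square root of the geometric factor 1 / (1 - X). Both \<open>c\<close> and \<open>X\<close>
      are fixed before \<open>f\<close>.\<close>
    show "\<exists>u\<in>RL2 (chaos_weight q) (H10 G) (H1_norm G). is_solution G a \<sigma> h f u \<and>
        RL2_norm (chaos_weight q) (H1_norm G) u \<le> (1 / (c * sqrt (1 - X))) * Hm1_norm G f \<and>
        (\<forall>w\<in>RL2 (chaos_weight q) (H10 G) (H1_norm G).
          is_solution G a \<sigma> h f w \<longrightarrow> (\<forall>\<alpha>. ae_eq G (w \<alpha>) (u \<alpha>)))"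
    proof (intro bexI[of _ "sol_coeff f"] conjI ballI impI allI)
      show "is_solution G a \<sigma> h f (sol_coeff f)" by (rule sol_coeff_is_solution[OF f])
      show "sol_coeff f \<in> RL2 (chaos_weight q) (H10 G) (H1_norm G)"
        using t(1) sol_coeff_H10[OF f] by (simp add: RL2_def t_eq)
      show "ae_eq G (w \<alpha>) (sol_coeff f \<alpha>)" if "is_solution G a \<sigma> h f w" for w \<alpha>
        using solution_unique[OF that sol_coeff_is_solution[OF f], of \<alpha>] that sol_coeff_H10[OF f, of \<alpha>]
          H10_jet_eq_iff[of "w \<alpha>" "sol_coeff f \<alpha>"] by (simp add: is_solution_def)
      have "RL2_norm (chaos_weight q) (H1_norm G) (sol_coeff f) \<le> sqrt (t 0 / (1 - X))"
        unfolding RL2_norm_def t_eq using t(2) by simp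
      also have "\<dots> = norm (jet G (A_inv G a f)) / sqrt (1 - X)"
        by (simp add: t_def chaos_weight_0 sol_coeff_0 real_sqrt_divide)
      also have "\<dots> \<le> (Hm1_norm G f / c) / sqrt (1 - X)"
        using c(2)[OF f] X by (intro divide_right_mono) auto
      finally show "RL2_norm (chaos_weight q) (H1_norm G) (sol_coeff f) \<le> (1 / (c * sqrt (1 - X))) * Hm1_norm G f"
        by simp
    qed
  qed
qed

end

lemma coeff_bounded_closure:
  fixes b :: "'n \<Rightarrow> 'n \<Rightarrow> real^'n \<Rightarrow> real"
  assumes "open G" "\<And>i j. b i j \<in> borel_measurable (lebesgue_on (closure G))"
    and "\<And>i j. bounded (b i j ` closure G)"
  shows "coeff_bounded G b"
  unfolding coeff_bounded_def
proof (intro allI conjI)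
  fix i j
  show "b i j \<in> borel_measurable (lebesgue_on G)"
    by (rule measurable_restrict_mono[OF assms(2) closure_subset])
  show "bounded (b i j ` G)"
    by (rule bounded_subset[OF assms(3) image_mono[OF closure_subset]])
qed

text \<open>The first conjunct says that admissible \<open>q\<close> exist; the second holds for
  each of them. \<open>summable\<close> accompanies every bound on \<open>suminf\<close>, which says
  nothing about a divergent series. Uniqueness is up to \<open>ae_eq\<close> in each coefficient
  because coefficients are functions, not classes.\<close>

theorem theorem4:
  fixes G :: "(real^'n) set"
    and P :: "'w measure" and \<xi> :: "nat \<Rightarrow> 'w \<Rightarrow> real"
    and h :: "nat \<Rightarrow> real^'n \<Rightarrow> real"
    and a \<sigma> :: "'n \<Rightarrow> 'n \<Rightarrow> real^'n \<Rightarrow> real"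
    and C :: "nat \<Rightarrow> real"
  assumes "gaussian_space P \<xi>"
    and "smooth_bounded_domain G"
    and "L2_orthonormal_basis G h"
    and E1: "\<And>i j. a i j \<in> borel_measurable (lebesgue_on (closure G))"
      "\<And>i j. bounded (a i j ` closure G)"
      "\<And>i j. \<sigma> i j \<in> borel_measurable (lebesgue_on (closure G))"
      "\<And>i j. bounded (\<sigma> i j ` closure G)"
    and E2: "\<exists>A\<^sub>1>0. \<exists>A\<^sub>2>0. \<forall>x\<in>closure G. \<forall>y.
        A\<^sub>1 * (norm y)\<^sup>2 \<le> (\<Sum>i\<in>UNIV. \<Sum>j\<in>UNIV. a i j x * y $ i * y $ j) \<and>
        (\<Sum>i\<in>UNIV. \<Sum>j\<in>UNIV. a i j x * y $ i * y $ j) \<le> A\<^sub>2 * (norm y)\<^sup>2"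
    and E3: "\<And>k. bounded (h k ` G)" "\<And>k. \<exists>L. L-lipschitz_on G (h k)"
    and C_pos: "\<And>k. 0 < C k"
    and C_bound: "\<And>k v. v \<in> H10 G \<Longrightarrow>
        H1_norm G (A_inv G a (M_op G \<sigma> (h k) v)) \<le> C k * H1_norm G v"
  shows "(\<exists>q. (\<forall>k. 0 < q k) \<and> summable (\<lambda>k. (C k)\<^sup>2 * (q k)\<^sup>2) \<and>
              suminf (\<lambda>k. (C k)\<^sup>2 * (q k)\<^sup>2) < 1) \<and>
         (\<forall>q. (\<forall>k. 0 < q k) \<and> summable (\<lambda>k. (C k)\<^sup>2 * (q k)\<^sup>2) \<and>
              suminf (\<lambda>k. (C k)\<^sup>2 * (q k)\<^sup>2) < 1 \<longrightarrow>
            (\<exists>K::real. \<forall>f\<in>Hm1 G. \<exists>u\<in>RL2 (chaos_weight q) (H10 G) (H1_norm G).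
               is_solution G a \<sigma> h f u \<and>
               RL2_norm (chaos_weight q) (H1_norm G) u \<le> K * Hm1_norm G f \<and>
               (\<forall>w\<in>RL2 (chaos_weight q) (H10 G) (H1_norm G).
                  is_solution G a \<sigma> h f w \<longrightarrow> (\<forall>\<alpha>. ae_eq G (w \<alpha>) (u \<alpha>)))))"
proof
  \<comment> \<open>This makes \<open>C k * q k\<close> equal to (1/2)^(k+1), so the squares sum to
    1/3.\<close>
  define q where "q k = (1/2) ^ Suc k / C k" for k
  have "(\<lambda>k. (C k)\<^sup>2 * (q k)\<^sup>2) = (\<lambda>k. (1/4) * (1/4) ^ k)"
  proof
    fix k
    have "(C k)\<^sup>2 * (q k)\<^sup>2 = ((1/2) ^ Suc k)\<^sup>2"
      using C_pos[of k] unfolding power_mult_distrib[symmetric] by (simp add: q_def)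
    also have "\<dots> = (1/4) ^ Suc k" by (simp add: power2_eq_square power_mult_distrib[symmetric])
    finally show "(C k)\<^sup>2 * (q k)\<^sup>2 = (1/4) * (1/4) ^ k" by simp
  qed
  moreover have "(\<lambda>k. (1/4::real) * (1/4) ^ k) sums ((1/4) * (1 / (1 - 1/4)))"
    by (intro sums_mult geometric_sums) simp
  ultimately have "(\<lambda>k. (C k)\<^sup>2 * (q k)\<^sup>2) sums (1/3)" by simp
  moreover have "0 < q k" for k using C_pos by (simp add: q_def)
  ultimately show "\<exists>q. (\<forall>k. 0 < q k) \<and> summable (\<lambda>k. (C k)\<^sup>2 * (q k)\<^sup>2) \<and>
      suminf (\<lambda>k. (C k)\<^sup>2 * (q k)\<^sup>2) < 1"
    by (intro exI[of _ q]) (auto simp: sums_iff)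
next
  have G: "open G" "bounded G" "G \<noteq> {}" using assms(2) by (auto simp: smooth_bounded_domain_def)
  obtain A\<^sub>1 where A1: "A\<^sub>1 > 0" "\<And>x y. x \<in> closure G \<Longrightarrow>
      A\<^sub>1 * (norm y)\<^sup>2 \<le> (\<Sum>i\<in>UNIV. \<Sum>j\<in>UNIV. a i j x * y $ i * y $ j)"
    using E2 by blast
  interpret bounded_open G by unfold_locales (use G in auto)
  interpret elliptic G a A\<^sub>1
    by unfold_locales
       (use coeff_bounded_closure[OF G(1) E1(1,2)] A1 closure_subset[of G] in auto)
  have mult: "\<exists>K. \<forall>v\<in>H10 G. (\<lambda>x. h k x * v x) \<in> H10 G \<and>
      norm (jet G (\<lambda>x. h k x * v x)) \<le> K * norm (jet G v)" for k
  proof -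
    obtain L where L: "L-lipschitz_on G (h k)" using E3(2) by blast
    obtain M where "\<And>x. x \<in> G \<Longrightarrow> \<bar>h k x\<bar> \<le> M" using E3(1)[of k] by (auto simp: bounded_iff)
    from H10_Lipschitz_mult[OF G(3) L this] show ?thesis by blast
  qed
  interpret chaos_problem G a A\<^sub>1 \<sigma> h C
    by unfold_locales
       (use coeff_bounded_closure[OF G(1) E1(3,4)] mult C_bound in auto)
  show "\<forall>q. (\<forall>k. 0 < q k) \<and> summable (\<lambda>k. (C k)\<^sup>2 * (q k)\<^sup>2) \<and>
              suminf (\<lambda>k. (C k)\<^sup>2 * (q k)\<^sup>2) < 1 \<longrightarrow>
            (\<exists>K::real. \<forall>f\<in>Hm1 G. \<exists>u\<in>RL2 (chaos_weight q) (H10 G) (H1_norm G).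
               is_solution G a \<sigma> h f u \<and>
               RL2_norm (chaos_weight q) (H1_norm G) u \<le> K * Hm1_norm G f \<and>
               (\<forall>w\<in>RL2 (chaos_weight q) (H10 G) (H1_norm G).
                  is_solution G a \<sigma> h f w \<longrightarrow> (\<forall>\<alpha>. ae_eq G (w \<alpha>) (u \<alpha>))))"
    using chaos_solution by blast
qed

end
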